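(* Let $(M,\tilde g)$ be a transverse signature-type changing manifold of dimension $n\geq 2$, with degeneracy locus $\mathcal H$ and Riemannian component $M_R$, and suppose that $M_R\cup\mathcal H$ admits a smooth non-vanishing line element field that is transverse to the boundary $\mathcal H$. Then $\tilde g$ is a transverse type-changing metric with a transverse radical if and only if $\tilde g$ is obtained from a Lorentzian metric on $M$ via the Transformation Prescription, i.e. there exist a Lorentzian metric $g$ on $M$, a smooth non-vanishing line element field $\{V,-V\}$ on $M$ with $g(V,V)=-1$, and a smooth function $f\colon M\to\mathbb R$ such that $\tilde g=g+f\,V^\flat\otimes V^\flat$, where for all $q\in\mathcal H=f^{-1}(1)$ $$df(q)\neq 0\quad\text{and}\quad (df(V))(q)\neq 0 .$$
   Context: Manifolds are smooth, connected, second countable, Hausdorff and without boundary unless stated; Lorentzian metrics have signature $(-,+,\ldots,+)$. A signature-type changing manifold $(M,\tilde g)$ is a manifold $M$ with a smooth symmetric $(0,2)$-tensor field $\tilde g$ such that the set $\mathcal H=\{q\in M:\tilde g|_q\text{ is degenerate}\}$ is non-empty, one connected component $M_R$ of $M\setminus\mathcal H$ is Riemannian ($\tilde g$ positive definite), and all other connected components of $M\setminus\mathcal H$ are Lorentzian (their union is $M_L$). $\tilde g$ (or $(M,\tilde g)$) is transverse (type-changing) if for every $q\in\mathcal H$ and every local coordinate system around $q$, $d(\det[\tilde g_{\mu\nu}])_q\neq 0$. Then $\mathcal H$ is a smoothly embedded hypersurface, $M_R\cup\mathcal H$ is a manifold with boundary $\mathcal H$, and for $q\in\mathcal H$ the radical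 $\mathrm{Rad}_q=\{w\in T_qM:\tilde g(w,\cdot)=0\}$ is one-dimensional. The metric has a transverse radical if $\mathrm{Rad}_q\oplus T_q\mathcal H=T_qM$ for every $q\in\mathcal H$. A smooth non-vanishing line element field is a smooth assignment to each point $p$ of an unordered pair $\{V_p,-V_p\}$ of opposite nonzero tangent vectors; it is transverse to $\mathcal H$ if $V_q\notin T_q\mathcal H$ for every $q\in\mathcal H$. $V^\flat=g(V,\cdot)$ is taken with respect to $g$, so $V^\flat\otimes V^\flat$ is independent of the choice of sign, as is the condition $df(V)\neq0$. *)

theory Defs
  imports "HOL-Analysis.Analysis" "HOL-Library.Function_Algebras"
begin

text \<open>Functions into a real vector space form a real vector space pointwise; this makes the
  library notions of subspace, span and linear independence available for tangent vectors.\<close>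

instantiation "fun" :: (type, real_vector) real_vector
begin

definition scaleR_fun :: "real \<Rightarrow> ('a \<Rightarrow> 'b) \<Rightarrow> 'a \<Rightarrow> 'b" where
  "scaleR_fun a f = (\<lambda>x. a *\<^sub>R f x)"

instance
  by standard
    (simp_all add: scaleR_fun_def plus_fun_def fun_eq_iff scaleR_add_right scaleR_add_left)

end


section \<open>Smooth maps between Euclidean spaces\<close>

fun Ck_on :: "nat \<Rightarrow> 'a::real_normed_vector set \<Rightarrow> ('a \<Rightarrow> 'b::real_normed_vector) \<Rightarrow> bool" where
  "Ck_on 0 U f \<longleftrightarrow> continuous_on U f"
| "Ck_on (Suc k) U f \<longleftrightarrow> (\<forall>x\<in>U. f differentiable (at x)) \<and>
     (\<forall>v. Ck_on k U (\<lambda>x. frechet_derivative f (at x) v))"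

text \<open>Only used for open \<open>U\<close>.\<close>

definition smooth_on :: "'a::real_normed_vector set \<Rightarrow> ('a \<Rightarrow> 'b::real_normed_vector) \<Rightarrow> bool" where
  "smooth_on U f \<longleftrightarrow> (\<forall>k. Ck_on k U f)"


section \<open>Smooth manifolds\<close>

text \<open>The points of the manifold are the elements of a type \<open>'m\<close>. A chart is a pair of a domain and
  a map into the model space; the values of the map outside the domain carry no information.\<close>

type_synonym ('m, 'n) chart = "'m set \<times> ('m \<Rightarrow> real ^ 'n)"

abbreviation dom_chart :: "('m, 'n) chart \<Rightarrow> 'm set" where
  "dom_chart c \<equiv> fst c"

abbreviation app_chart :: "('m, 'n) chart \<Rightarrow> 'm \<Rightarrow> real ^ 'n" where
  "app_chart c \<equiv> snd c"

definition inv_chart :: "('m, 'n) chart \<Rightarrow> real ^ 'n \<Rightarrow> 'm" where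
  "inv_chart c = inv_into (dom_chart c) (app_chart c)"

definition is_chart :: "('m::topological_space, 'n::finite) chart \<Rightarrow> bool" where
  "is_chart c \<longleftrightarrow> open (dom_chart c) \<and> open (app_chart c ` dom_chart c) \<and>
     homeomorphism (dom_chart c) (app_chart c ` dom_chart c) (app_chart c) (inv_chart c)"

definition smooth_transition :: "('m, 'n::finite) chart \<Rightarrow> ('m, 'n) chart \<Rightarrow> bool" where
  "smooth_transition c d \<longleftrightarrow>
     smooth_on (app_chart c ` (dom_chart c \<inter> dom_chart d)) (app_chart d \<circ> inv_chart c)"

text \<open>A smooth structure is a maximal atlas, so that membership in it means being
  a local coordinate system.\<close>

definition smooth_structure :: "('m::topological_space, 'n::finite) chart set \<Rightarrow> bool" where
  "smooth_structure S \<longleftrightarrow>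
     (\<forall>c\<in>S. is_chart c) \<and>
     (\<Union>c\<in>S. dom_chart c) = UNIV \<and>
     (\<forall>c\<in>S. \<forall>d\<in>S. smooth_transition c d) \<and>
     (\<forall>c. is_chart c \<longrightarrow> (\<forall>d\<in>S. smooth_transition c d \<and> smooth_transition d c) \<longrightarrow> c \<in> S)"

definition smooth_manifold ::
    "('m::{t2_space, second_countable_topology}, 'n::finite) chart set \<Rightarrow> bool" where
  "smooth_manifold S \<longleftrightarrow> smooth_structure S \<and> connected (UNIV :: 'm set)"

definition smooth_function :: "('m, 'n::finite) chart set \<Rightarrow> ('m \<Rightarrow> real) \<Rightarrow> bool" where
  "smooth_function S f \<longleftrightarrow> (\<forall>c\<in>S. smooth_on (app_chart c ` dom_chart c) (f \<circ> inv_chart c))"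


section \<open>Tangent vectors\<close>

text \<open>A tangent vector at \<open>p\<close> is the family of its coordinate representations in all charts
  around \<open>p\<close>, related by the Jacobians of the coordinate changes. The family is zero at all
  other arguments, so that the tangent space is a linear subspace of dimension \<open>CARD('n)\<close>
  of the function space.\<close>

type_synonym ('m, 'n) tvec = "('m, 'n) chart \<Rightarrow> real ^ 'n"

definition tangent_space :: "('m, 'n::finite) chart set \<Rightarrow> 'm \<Rightarrow> ('m, 'n) tvec set" where
  "tangent_space S p = {w.
     (\<forall>c\<in>S. \<forall>d\<in>S. p \<in> dom_chart c \<longrightarrow> p \<in> dom_chart d \<longrightarrow>
        w d = frechet_derivative (app_chart d \<circ> inv_chart c) (at (app_chart c p)) (w c)) \<and>
     (\<forall>d. \<not> (d \<in> S \<and> p \<in> dom_chart d) \<longrightarrow> w d = 0)}"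

text \<open>The tangent vector at \<open>p\<close> whose representation in the chart \<open>c\<close> is \<open>x\<close>; for \<open>x = axis \<mu> 1\<close>
  this is the coordinate vector \<open>\<partial>\<^sub>\<mu>\<close> of \<open>c\<close> at \<open>p\<close>.\<close>

definition coord_vec ::
    "('m, 'n::finite) chart set \<Rightarrow> ('m, 'n) chart \<Rightarrow> 'm \<Rightarrow> real ^ 'n \<Rightarrow> ('m, 'n) tvec" where
  "coord_vec S c p x = (\<lambda>d. if d \<in> S \<and> p \<in> dom_chart d
     then frechet_derivative (app_chart d \<circ> inv_chart c) (at (app_chart c p)) x else 0)"

text \<open>\<open>df\<^sub>p(v)\<close> for \<open>v\<close> in the tangent space at \<open>p\<close>, computed in an arbitrary chart around \<open>p\<close>; by
  the chain rule the choice is immaterial. Only the germ of \<open>f\<close> at \<open>p\<close> matters.\<close>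

definition differential ::
    "('m, 'n::finite) chart set \<Rightarrow> ('m \<Rightarrow> real) \<Rightarrow> 'm \<Rightarrow> ('m, 'n) tvec \<Rightarrow> real" where
  "differential S f p v = (let c = (SOME c. c \<in> S \<and> p \<in> dom_chart c)
     in frechet_derivative (f \<circ> inv_chart c) (at (app_chart c p)) (v c))"

definition smooth_curve ::
    "('m::topological_space, 'n::finite) chart set \<Rightarrow> real set \<Rightarrow> (real \<Rightarrow> 'm) \<Rightarrow> bool" where
  "smooth_curve S I \<gamma> \<longleftrightarrow> continuous_on I \<gamma> \<and>
     (\<forall>c\<in>S. smooth_on {t \<in> I. \<gamma> t \<in> dom_chart c} (app_chart c \<circ> \<gamma>))"

text \<open>The tangent space at \<open>q\<close> of an embedded submanifold \<open>N\<close>, as the subset of the tangent space of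
  the ambient manifold consisting of the velocities of smooth curves in \<open>N\<close> through \<open>q\<close>.\<close>

definition tangent_space_sub ::
    "('m::topological_space, 'n::finite) chart set \<Rightarrow> 'm set \<Rightarrow> 'm \<Rightarrow> ('m, 'n) tvec set" where
  "tangent_space_sub S N q = {v \<in> tangent_space S q.
     \<exists>\<epsilon>>0. \<exists>\<gamma>. smooth_curve S {-\<epsilon><..<\<epsilon>} \<gamma> \<and> \<gamma> ` {-\<epsilon><..<\<epsilon>} \<subseteq> N \<and> \<gamma> 0 = q \<and>
       (\<forall>c\<in>S. q \<in> dom_chart c \<longrightarrow> ((app_chart c \<circ> \<gamma>) has_vector_derivative v c) (at 0))}"


section \<open>Vector fields and line element fields\<close>

definition smooth_vector_field ::
    "('m, 'n::finite) chart set \<Rightarrow> 'm set \<Rightarrow> ('m \<Rightarrow> ('m, 'n) tvec) \<Rightarrow> bool" where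
  "smooth_vector_field S U V \<longleftrightarrow>
     (\<forall>p\<in>U. V p \<in> tangent_space S p) \<and>
     (\<forall>c\<in>S. smooth_on (app_chart c ` (dom_chart c \<inter> U)) (\<lambda>x. V (inv_chart c x) c))"

text \<open>A smooth non-vanishing line element field on \<open>A\<close>: around each point of \<open>A\<close> it is \<open>{V, -V}\<close> for
  a smooth vector field \<open>V\<close> on a neighbourhood in the ambient manifold. If \<open>A\<close> is a closed domain
  with smooth boundary, this is smoothness up to the boundary in the usual sense. Only the values
  on \<open>A\<close> matter.\<close>

definition line_element_field ::
    "('m::topological_space, 'n::finite) chart set \<Rightarrow> 'm set \<Rightarrow> ('m \<Rightarrow> ('m, 'n) tvec set) \<Rightarrow> bool" where
  "line_element_field S A L \<longleftrightarrow>
     (\<forall>p\<in>A. \<exists>U V. open U \<and> p \<in> U \<and> smooth_vector_field S U V \<and>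
        (\<forall>q\<in>U \<inter> A. V q \<noteq> 0 \<and> L q = {V q, - V q}))"

definition transverse_line_field ::
    "('m::topological_space, 'n::finite) chart set \<Rightarrow> 'm set \<Rightarrow> ('m \<Rightarrow> ('m, 'n) tvec set) \<Rightarrow> bool" where
  "transverse_line_field S N L \<longleftrightarrow> (\<forall>q\<in>N. \<forall>v\<in>L q. v \<notin> tangent_space_sub S N q)"


section \<open>Symmetric bilinear forms\<close>

definition sym_bilinear_on :: "'v::real_vector set \<Rightarrow> ('v \<Rightarrow> 'v \<Rightarrow> real) \<Rightarrow> bool" where
  "sym_bilinear_on T b \<longleftrightarrow>
     (\<forall>u\<in>T. \<forall>v\<in>T. b u v = b v u) \<and>
     (\<forall>u\<in>T. \<forall>v\<in>T. \<forall>w\<in>T. b (u + v) w = b u w + b v w) \<and>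
     (\<forall>a. \<forall>u\<in>T. \<forall>v\<in>T. b (a *\<^sub>R u) v = a * b u v)"

definition radical_on :: "'v::real_vector set \<Rightarrow> ('v \<Rightarrow> 'v \<Rightarrow> real) \<Rightarrow> 'v set" where
  "radical_on T b = {w \<in> T. \<forall>v\<in>T. b w v = 0}"

definition degenerate_on :: "'v::real_vector set \<Rightarrow> ('v \<Rightarrow> 'v \<Rightarrow> real) \<Rightarrow> bool" where
  "degenerate_on T b \<longleftrightarrow> radical_on T b \<noteq> {0}"

definition positive_definite_on :: "'v::real_vector set \<Rightarrow> ('v \<Rightarrow> 'v \<Rightarrow> real) \<Rightarrow> bool" where
  "positive_definite_on T b \<longleftrightarrow> (\<forall>v\<in>T. v \<noteq> 0 \<longrightarrow> b v v > 0)"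

text \<open>Signature \<open>(-,+,\<dots>,+)\<close>: there is a basis \<open>E\<close> of \<open>T\<close>, one member of which is \<open>t\<close>, in which \<open>b\<close>
  has the matrix \<open>diag(-1,1,\<dots>,1)\<close>.\<close>

definition lorentzian_on :: "'v::real_vector set \<Rightarrow> ('v \<Rightarrow> 'v \<Rightarrow> real) \<Rightarrow> bool" where
  "lorentzian_on T b \<longleftrightarrow> (\<exists>E t. independent E \<and> span E = T \<and> t \<in> E \<and> b t t = -1 \<and>
     (\<forall>e\<in>E - {t}. b e e = 1) \<and> (\<forall>e\<in>E. \<forall>e'\<in>E. e \<noteq> e' \<longrightarrow> b e e' = 0))"


section \<open>Metrics\<close>

text \<open>Only the values of a tensor on tangent vectors matter.\<close>

type_synonym ('m, 'n) tensor02 = "'m \<Rightarrow> ('m, 'n) tvec \<Rightarrow> ('m, 'n) tvec \<Rightarrow> real"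

definition tensor_comp ::
    "('m, 'n::finite) chart set \<Rightarrow> ('m, 'n) tensor02 \<Rightarrow> ('m, 'n) chart \<Rightarrow> 'm \<Rightarrow> real ^ 'n ^ 'n" where
  "tensor_comp S g c p =
     (\<chi> \<mu> \<nu>. g p (coord_vec S c p (axis \<mu> 1)) (coord_vec S c p (axis \<nu> 1)))"

definition smooth_sym_tensor :: "('m, 'n::finite) chart set \<Rightarrow> ('m, 'n) tensor02 \<Rightarrow> bool" where
  "smooth_sym_tensor S g \<longleftrightarrow>
     (\<forall>p. sym_bilinear_on (tangent_space S p) (g p)) \<and>
     (\<forall>c\<in>S. \<forall>\<mu> \<nu>. smooth_on (app_chart c ` dom_chart c)
        (\<lambda>x. tensor_comp S g c (inv_chart c x) $ \<mu> $ \<nu>))"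

definition lorentzian_metric :: "('m, 'n::finite) chart set \<Rightarrow> ('m, 'n) tensor02 \<Rightarrow> bool" where
  "lorentzian_metric S g \<longleftrightarrow>
     smooth_sym_tensor S g \<and> (\<forall>p. lorentzian_on (tangent_space S p) (g p))"

definition degeneracy_locus :: "('m, 'n::finite) chart set \<Rightarrow> ('m, 'n) tensor02 \<Rightarrow> 'm set" where
  "degeneracy_locus S g = {q. degenerate_on (tangent_space S q) (g q)}"

text \<open>\<open>M\<^sub>R\<close> is the Riemannian component.\<close>

definition signature_type_changing ::
    "('m::topological_space, 'n::finite) chart set \<Rightarrow> ('m, 'n) tensor02 \<Rightarrow> 'm set \<Rightarrow> bool" where
  "signature_type_changing S g M\<^sub>R \<longleftrightarrow>
     smooth_sym_tensor S g \<and>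
     degeneracy_locus S g \<noteq> {} \<and>
     M\<^sub>R \<in> components (- degeneracy_locus S g) \<and>
     (\<forall>p\<in>M\<^sub>R. positive_definite_on (tangent_space S p) (g p)) \<and>
     (\<forall>C\<in>components (- degeneracy_locus S g). C \<noteq> M\<^sub>R \<longrightarrow>
        (\<forall>p\<in>C. lorentzian_on (tangent_space S p) (g p)))"

definition transverse_type_changing ::
    "('m::topological_space, 'n::finite) chart set \<Rightarrow> ('m, 'n) tensor02 \<Rightarrow> 'm set \<Rightarrow> bool" where
  "transverse_type_changing S g M\<^sub>R \<longleftrightarrow>
     signature_type_changing S g M\<^sub>R \<and>
     (\<forall>q\<in>degeneracy_locus S g. \<forall>c\<in>S. q \<in> dom_chart c \<longrightarrow>
        (\<exists>v\<in>tangent_space S q. differential S (\<lambda>p. det (tensor_comp S g c p)) q v \<noteq> 0))"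

definition transverse_radical ::
    "('m::topological_space, 'n::finite) chart set \<Rightarrow> ('m, 'n) tensor02 \<Rightarrow> bool" where
  "transverse_radical S g \<longleftrightarrow> (\<forall>q\<in>degeneracy_locus S g.
     let Rad = radical_on (tangent_space S q) (g q);
         TH = tangent_space_sub S (degeneracy_locus S g) q
     in Rad \<inter> TH = {0} \<and> {r + h | r h. r \<in> Rad \<and> h \<in> TH} = tangent_space S q)"

text \<open>In the third conjunct of the body \<open>V\<close> ranges over both representatives of the line element at
  \<open>p\<close>, and \<open>V\<^sup>\<flat>(u) = g(V,u)\<close>.\<close>

definition transformation_prescription ::
    "('m::topological_space, 'n::finite) chart set \<Rightarrow> ('m, 'n) tensor02 \<Rightarrow>
     ('m, 'n) tensor02 \<Rightarrow> ('m \<Rightarrow> ('m, 'n) tvec set) \<Rightarrow> ('m \<Rightarrow> real) \<Rightarrow> bool" where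
  "transformation_prescription S g' g L f \<longleftrightarrow>
     lorentzian_metric S g \<and>
     line_element_field S UNIV L \<and>
     (\<forall>p. \<forall>V\<in>L p. g p V V = -1 \<and>
        (\<forall>u\<in>tangent_space S p. \<forall>w\<in>tangent_space S p.
           g' p u w = g p u w + f p * (g p V u * g p V w))) \<and>
     smooth_function S f \<and>
     degeneracy_locus S g' = {q. f q = 1} \<and>
     (\<forall>q\<in>degeneracy_locus S g'.
        (\<exists>v\<in>tangent_space S q. differential S f q v \<noteq> 0) \<and>
        (\<forall>V\<in>L q. differential S f q V \<noteq> 0))"

end

theory Submission
  imports Defs
begin

text \<open>A metric as in the prescription is \<open>gt - (1 + s) \<beta> \<otimes> \<beta>\<close> for a covector field \<open>\<beta> = -V\<^sup>\<flat>\<close>, defined up to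
  sign, on whose kernel \<open>gt\<close> is positive definite: then there are a unique \<open>V\<close> and \<open>s\<close> with
  \<open>gt(V, \<cdot>) = s \<beta>\<close> and \<open>\<beta>(V) = 1\<close>, they depend smoothly on the point even where \<open>gt\<close> degenerates,
  and \<open>f = 1 + s\<close>. So everything reduces to the global existence of \<open>\<beta>\<close>. Locally one takes the
  differential of \<open>det gt\<close> near \<open>\<H>\<close> (where transversality of the radical makes its kernel
  spacelike), the dual of a timelike vector on \<open>M\<^sub>L\<close>, and a covector not vanishing on the given
  line on \<open>M\<^sub>R\<close>. Near each point the admissible covectors form two opposite convex cones, so the
  local choices can be added up after adjusting their signs. Finally \<open>V\<close> spans the radical on
  \<open>\<H>\<close>, so \<open>df(V) \<noteq> 0\<close> expresses that the radical is transverse to \<open>\<H>\<close>; this also gives the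
  converse.\<close>


section \<open>Calculus of smooth maps\<close>

text \<open>The equations for \<open>V\<close> and \<open>s\<close> are forced: if gt = g + f
  \<open>V\<^sup>\<flat> \<otimes> V\<^sup>\<flat>\<close> and g(V,V) = -1, inserting V gives
  gt(V,.) = (1 - f) \<open>V\<^sup>\<flat>\<close>, which is (f - 1) \<beta>, and \<beta>(V) = 1; on
  the kernel of \<beta> the forms gt and g agree. The obstacle is the sign of \<beta>. No global
  sign need exist, and objects defined up to sign cannot be averaged. Admissible covectors are
  therefore required not to vanish on a set Z of vectors at each point on which any two of them have
  a constant relative sign. On \<open>M\<^sub>R\<close> every non-zero covector has a kernel on
  which gt is positive definite, so the metric prefers none of them; the given line element field
  makes the choice there. At \<H> it meets the choice made by the causal vectors, which are the
  radical ones. Requiring \<beta> to annihilate the tangent vectors of \<H> leaves only the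
  multiples of one covector, so that the two choices cannot conflict.\<close>

lemma frechet_derivative_has_derivative:
  "f differentiable (at x) \<Longrightarrow> (f has_derivative frechet_derivative f (at x)) (at x)"
  by (simp add: frechet_derivative_works)

lemma Ck_on_subset: "Ck_on k U f \<Longrightarrow> V \<subseteq> U \<Longrightarrow> Ck_on k V f"
  by (induction k arbitrary: f) (auto intro: continuous_on_subset)

lemma Ck_on_cong:
  assumes "open U" "\<And>x. x \<in> U \<Longrightarrow> f x = g x"
  shows "Ck_on k U f \<longleftrightarrow> Ck_on k U g"
  using assms(2)
proof (induction k arbitrary: f g)
  case 0
  then show ?case by (auto cong: continuous_on_cong)
next
  case (Suc k)
  have d: "(f has_derivative D) (at x) \<longleftrightarrow> (g has_derivative D) (at x)" if "x \<in> U" for x D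
    using has_derivative_transform_within_open[OF _ assms(1) that, of f D UNIV g]
      has_derivative_transform_within_open[OF _ assms(1) that, of g D UNIV f] Suc.prems by auto
  have e: "f differentiable (at x) \<longleftrightarrow> g differentiable (at x)"
    "frechet_derivative f (at x) = frechet_derivative g (at x)" if "x \<in> U" for x
    using d[OF that] by (simp_all add: differentiable_def frechet_derivative_def)
  have "Ck_on k U (\<lambda>x. frechet_derivative f (at x) v)
      \<longleftrightarrow> Ck_on k U (\<lambda>x. frechet_derivative g (at x) v)" for v
    by (rule Suc.IH) (simp add: e)
  then show ?case using e by simp
qed

lemma Ck_on_local:
  assumes "\<And>x. x \<in> U \<Longrightarrow> \<exists>N. open N \<and> x \<in> N \<and> Ck_on k N f"
  shows "Ck_on k U f"
  using assms
proof (induction k arbitrary: f)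
  case 0
  show ?case
    unfolding Ck_on.simps
  proof (rule continuous_at_imp_continuous_on, rule ballI)
    fix x assume "x \<in> U"
    then obtain N where "open N" "x \<in> N" "continuous_on N f"
      using 0[of x] by auto
    then show "isCont f x"
      by (simp add: continuous_on_eq_continuous_at)
  qed
next
  case (Suc k)
  have "Ck_on k U (\<lambda>x. frechet_derivative f (at x) v)" for v
  proof (rule Suc.IH)
    fix x assume "x \<in> U"
    then show "\<exists>N. open N \<and> x \<in> N \<and> Ck_on k N (\<lambda>x. frechet_derivative f (at x) v)"
      using Suc.prems[of x] by auto
  qed
  moreover have "f differentiable (at x)" if "x \<in> U" for x
    using Suc.prems[OF that] by auto
  ultimately show ?case by simp
qed

text \<open>\<open>Ck_on\<close> is defined through \<open>frechet_derivative\<close>; this form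
  lets an induction on the order work with an explicit formula for the derivative.\<close>

lemma Ck_on_SucI:
  assumes "open U" "\<And>x. x \<in> U \<Longrightarrow> (f has_derivative f' x) (at x)"
    "\<And>v. Ck_on k U (\<lambda>x. f' x v)"
  shows "Ck_on (Suc k) U f"
proof -
  have "frechet_derivative f (at x) = f' x" if "x \<in> U" for x
    using assms(2)[OF that] by (metis frechet_derivative_at)
  then have "Ck_on k U (\<lambda>x. frechet_derivative f (at x) v)" for v
    using assms(3)[of v] Ck_on_cong[OF assms(1), of "\<lambda>x. frechet_derivative f (at x) v" "\<lambda>x. f' x v"]
    by simp
  then show ?thesis using assms(2) by (auto simp: differentiable_def)
qed

lemma Ck_on_SucD: "Ck_on (Suc k) U f \<Longrightarrow> Ck_on k U f"
proof (induction k arbitrary: f)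
  case 0
  then have "f differentiable (at x)" if "x \<in> U" for x using that by simp
  then show ?case
    by (auto intro: continuous_at_imp_continuous_on differentiable_imp_continuous_within)
next
  case (Suc k)
  then show ?case by simp
qed

lemma Ck_on_const: "open U \<Longrightarrow> Ck_on k U (\<lambda>x. c)"
  by (induction k arbitrary: c) auto

lemma Ck_on_bounded_linear: "open U \<Longrightarrow> bounded_linear L \<Longrightarrow> Ck_on k U L"
proof (cases k)
  case (Suc j)
  assume "open U" "bounded_linear L"
  then show ?thesis unfolding Suc
    by (intro Ck_on_SucI[where f'="\<lambda>x. L"] Ck_on_const bounded_linear_imp_has_derivative)
qed (simp add: linear_continuous_on)

lemma Ck_on_add:
  assumes "open U" "Ck_on k U f" "Ck_on k U g"
  shows "Ck_on k U (\<lambda>x. f x + g x)"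
  using assms(2,3)
proof (induction k arbitrary: f g)
  case (Suc k)
  show ?case
    by (rule Ck_on_SucI[OF assms(1),
          where f'="\<lambda>x v. frechet_derivative f (at x) v + frechet_derivative g (at x) v"])
      (use Suc in \<open>auto intro!: has_derivative_add frechet_derivative_has_derivative\<close>)
qed (auto intro: continuous_intros)

lemma Ck_on_bilinear:
  assumes "bounded_bilinear P" "open U" "Ck_on k U f" "Ck_on k U g"
  shows "Ck_on k U (\<lambda>x. P (f x) (g x))"
  using assms(3,4)
proof (induction k arbitrary: f g)
  case 0
  then show ?case by (auto intro: bounded_bilinear.continuous_on[OF assms(1)])
next
  case (Suc k)
  show ?case
  proof (rule Ck_on_SucI[OF assms(2)])
    show "((\<lambda>x. P (f x) (g x)) has_derivative (\<lambda>v. P (f x) (frechet_derivative g (at x) v)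
        + P (frechet_derivative f (at x) v) (g x))) (at x)" if "x \<in> U" for x
      using Suc.prems that
      by (intro bounded_bilinear.FDERIV[OF assms(1)] frechet_derivative_has_derivative) auto
    show "Ck_on k U (\<lambda>x. P (f x) (frechet_derivative g (at x) v)
        + P (frechet_derivative f (at x) v) (g x))" for v
      using Suc.prems by (intro Ck_on_add[OF assms(2)] Suc.IH)
       (use Ck_on_SucD[OF Suc.prems(1)] Ck_on_SucD[OF Suc.prems(2)] in auto)
  qed
qed

lemma Ck_on_sum:
  assumes "open U" "\<And>i. i \<in> I \<Longrightarrow> Ck_on k U (f i)"
  shows "Ck_on k U (\<lambda>x. \<Sum>i\<in>I. f i x)"
  using assms(2) by (induction I rule: infinite_finite_induct) (auto simp: Ck_on_const Ck_on_add assms(1))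

lemma Ck_on_compose:
  fixes f :: "'a::real_normed_vector \<Rightarrow> 'b::euclidean_space" and g :: "'b \<Rightarrow> 'c::real_normed_vector"
  assumes "open U" "open V" "f ` U \<subseteq> V" "Ck_on k U f" "Ck_on k V g"
  shows "Ck_on k U (\<lambda>x. g (f x))"
  using assms(4,5)
proof (induction k arbitrary: g)
  case 0
  then show ?case using continuous_on_compose2[of V g U f] assms(3) by simp
next
  case (Suc k)
  let ?f = "\<lambda>x. frechet_derivative f (at x)" and ?g = "\<lambda>x. frechet_derivative g (at x)"
  show ?case
  proof (rule Ck_on_SucI[OF assms(1)])
    fix x assume x: "x \<in> U"
    have f: "(f has_derivative ?f x) (at x)"
      using Suc.prems(1) x by (auto intro: frechet_derivative_has_derivative)
    have "f x \<in> V" using x assms(3) by auto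
    then have g: "(g has_derivative ?g (f x)) (at (f x))"
      using Suc.prems(2) by (auto intro: frechet_derivative_has_derivative)
    \<comment> \<open>The direction \<open>?f x v\<close> moves with \<open>x\<close>, whereas
      \<open>Ck_on\<close> controls derivatives in fixed directions only. Expanding over the basis
      leaves fixed directions with scalar coefficients.\<close>
    have "?g (f x) (?f x v) = (\<Sum>b\<in>Basis. (?f x v \<bullet> b) *\<^sub>R ?g (f x) b)" for v
    proof -
      have "?g (f x) (?f x v) = ?g (f x) (\<Sum>b\<in>Basis. (?f x v \<bullet> b) *\<^sub>R b)"
        by (simp add: euclidean_representation)
      also have "\<dots> = (\<Sum>b\<in>Basis. (?f x v \<bullet> b) *\<^sub>R ?g (f x) b)"
        using has_derivative_linear[OF g] by (simp add: linear_sum linear_scale)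
      finally show ?thesis .
    qed
    then show "((\<lambda>x. g (f x)) has_derivative (\<lambda>v. \<Sum>b\<in>Basis. (?f x v \<bullet> b) *\<^sub>R ?g (f x) b)) (at x)"
      using diff_chain_at[OF f g] by (simp add: o_def)
  next
    fix v
    show "Ck_on k U (\<lambda>x. \<Sum>b\<in>Basis. (?f x v \<bullet> b) *\<^sub>R ?g (f x) b)"
    proof (intro Ck_on_sum Ck_on_bilinear[OF bounded_bilinear_scaleR] Ck_on_bilinear[OF bounded_bilinear_inner]
          Ck_on_const assms(1))
      show "Ck_on k U (\<lambda>x. ?f x v)" using Suc.prems(1) by simp
      show "Ck_on k U (\<lambda>x. ?g (f x) b)" for b
        using Suc.IH[OF Ck_on_SucD[OF Suc.prems(1)], of "\<lambda>x. ?g x b"] Suc.prems(2) by simp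
    qed
  qed
qed

text \<open>The derivative of 1/f is -(1/f) Df (1/f). It involves only 1/f and Df, so each order of
  differentiability of 1/f yields the next.\<close>

lemma Ck_on_inverse:
  fixes f :: "'a::real_normed_vector \<Rightarrow> real"
  assumes "open U" "Ck_on k U f" "\<And>x. x \<in> U \<Longrightarrow> f x \<noteq> 0"
  shows "Ck_on k U (\<lambda>x. inverse (f x))"
  using assms(2)
proof (induction k)
  case 0
  then show ?case using assms(3) by (simp add: continuous_on_inverse)
next
  case (Suc k)
  then have k: "Ck_on k U (\<lambda>x. inverse (f x))" using Ck_on_SucD by blast
  have D: "((\<lambda>x. inverse (f x)) has_derivative
     (\<lambda>v. (-1) * (inverse (f x) * frechet_derivative f (at x) v * inverse (f x)))) (at x)"
    if "x \<in> U" for x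
    using Deriv.has_derivative_inverse[where f=f and x=x and S=UNIV, OF assms(3)[OF that]]
      frechet_derivative_has_derivative[of f x] that Suc.prems by simp
  show ?case
  proof (rule Ck_on_SucI[OF assms(1) D])
    have "Ck_on k U (\<lambda>x. frechet_derivative f (at x) v)" for v
      using Suc.prems by simp
    then show "Ck_on k U (\<lambda>x. (-1) * (inverse (f x) * frechet_derivative f (at x) v * inverse (f x)))" for v
      by (intro Ck_on_bilinear[OF bounded_bilinear_mult assms(1)] Ck_on_const assms(1) k)
  qed
qed

section \<open>Smooth maps: locality, algebra, composition, determinants\<close>

lemma smooth_on_subset: "smooth_on U f \<Longrightarrow> V \<subseteq> U \<Longrightarrow> smooth_on V f"
  by (auto simp: smooth_on_def intro: Ck_on_subset)

lemma smooth_on_cong: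
  assumes "open U" "\<And>x. x \<in> U \<Longrightarrow> f x = g x"
  shows "smooth_on U f \<longleftrightarrow> smooth_on U g"
  unfolding smooth_on_def using Ck_on_cong[OF assms] by simp

lemma smooth_on_local:
  assumes "\<And>x. x \<in> U \<Longrightarrow> \<exists>N. open N \<and> x \<in> N \<and> smooth_on N f"
  shows "smooth_on U f"
  unfolding smooth_on_def
proof (intro allI Ck_on_local)
  fix k x assume "x \<in> U"
  from assms[OF this] show "\<exists>N. open N \<and> x \<in> N \<and> Ck_on k N f"
    by (auto simp: smooth_on_def)
qed

lemma smooth_on_continuous_on: "smooth_on U f \<Longrightarrow> continuous_on U f"
  unfolding smooth_on_def by (drule spec[of _ 0]) simp

lemma smooth_on_differentiable: "smooth_on U f \<Longrightarrow> x \<in> U \<Longrightarrow> f differentiable (at x)"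
  unfolding smooth_on_def by (drule spec[of _ "Suc 0"]) simp

lemma smooth_on_has_derivative:
  "smooth_on U f \<Longrightarrow> x \<in> U \<Longrightarrow> (f has_derivative frechet_derivative f (at x)) (at x)"
  by (simp add: frechet_derivative_has_derivative smooth_on_differentiable)

lemma smooth_on_frechet_derivative:
  assumes "smooth_on U f" shows "smooth_on U (\<lambda>x. frechet_derivative f (at x) v)"
  unfolding smooth_on_def
proof
  fix k from assms have "Ck_on (Suc k) U f" by (simp add: smooth_on_def del: Ck_on.simps)
  then show "Ck_on k U (\<lambda>x. frechet_derivative f (at x) v)" by simp
qed

lemma smooth_on_const: "open U \<Longrightarrow> smooth_on U (\<lambda>x. c)"
  by (simp add: smooth_on_def Ck_on_const)

lemma smooth_on_bounded_linear: "open U \<Longrightarrow> bounded_linear L \<Longrightarrow> smooth_on U L"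
  by (simp add: smooth_on_def Ck_on_bounded_linear)

lemma smooth_on_ident: "open U \<Longrightarrow> smooth_on U (\<lambda>x. x)"
  by (simp add: smooth_on_bounded_linear)

lemma smooth_on_add: "open U \<Longrightarrow> smooth_on U f \<Longrightarrow> smooth_on U g \<Longrightarrow> smooth_on U (\<lambda>x. f x + g x)"
  by (simp add: smooth_on_def Ck_on_add)

lemma smooth_on_bilinear:
  "bounded_bilinear P \<Longrightarrow> open U \<Longrightarrow> smooth_on U f \<Longrightarrow> smooth_on U g \<Longrightarrow> smooth_on U (\<lambda>x. P (f x) (g x))"
  by (simp add: smooth_on_def Ck_on_bilinear)

lemma smooth_on_mult:
  fixes f g :: "'a::real_normed_vector \<Rightarrow> real"
  shows "open U \<Longrightarrow> smooth_on U f \<Longrightarrow> smooth_on U g \<Longrightarrow> smooth_on U (\<lambda>x. f x * g x)"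
  by (rule smooth_on_bilinear[OF bounded_bilinear_mult])

lemma smooth_on_inner:
  "open U \<Longrightarrow> smooth_on U f \<Longrightarrow> smooth_on U g \<Longrightarrow> smooth_on U (\<lambda>x. f x \<bullet> g x)"
  by (rule smooth_on_bilinear[OF bounded_bilinear_inner])

lemma smooth_on_scaleR:
  "open U \<Longrightarrow> smooth_on U f \<Longrightarrow> smooth_on U g \<Longrightarrow> smooth_on U (\<lambda>x. f x *\<^sub>R g x)"
  by (rule smooth_on_bilinear[OF bounded_bilinear_scaleR])

lemma smooth_on_minus: "open U \<Longrightarrow> smooth_on U f \<Longrightarrow> smooth_on U (\<lambda>x. - f x)"
  using smooth_on_scaleR[of U "\<lambda>x. -1" f] by (simp add: smooth_on_const)

lemma smooth_on_diff: "open U \<Longrightarrow> smooth_on U f \<Longrightarrow> smooth_on U g \<Longrightarrow> smooth_on U (\<lambda>x. f x - g x)"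
  using smooth_on_add[of U f "\<lambda>x. - g x"] by (simp add: smooth_on_minus)

lemma smooth_on_sum:
  "open U \<Longrightarrow> (\<And>i. i \<in> I \<Longrightarrow> smooth_on U (f i)) \<Longrightarrow> smooth_on U (\<lambda>x. \<Sum>i\<in>I. f i x)"
  by (simp add: smooth_on_def Ck_on_sum)

lemma smooth_on_prod:
  fixes f :: "'i \<Rightarrow> 'a::real_normed_vector \<Rightarrow> real"
  assumes "open U" "\<And>i. i \<in> I \<Longrightarrow> smooth_on U (f i)"
  shows "smooth_on U (\<lambda>x. \<Prod>i\<in>I. f i x)"
  using assms(2) by (induction I rule: infinite_finite_induct)
    (auto simp: smooth_on_const assms(1) intro!: smooth_on_mult)

lemma smooth_on_compose:
  fixes f :: "'a::real_normed_vector \<Rightarrow> 'b::euclidean_space" and g :: "'b \<Rightarrow> 'c::real_normed_vector"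
  shows "open U \<Longrightarrow> open V \<Longrightarrow> f ` U \<subseteq> V \<Longrightarrow> smooth_on U f \<Longrightarrow> smooth_on V g \<Longrightarrow> smooth_on U (\<lambda>x. g (f x))"
  by (auto simp: smooth_on_def intro: Ck_on_compose)

lemma smooth_on_inverse:
  fixes f :: "'a::real_normed_vector \<Rightarrow> real"
  shows "open U \<Longrightarrow> smooth_on U f \<Longrightarrow> (\<And>x. x \<in> U \<Longrightarrow> f x \<noteq> 0) \<Longrightarrow> smooth_on U (\<lambda>x. inverse (f x))"
  by (auto simp: smooth_on_def intro: Ck_on_inverse)

lemma smooth_on_divide:
  fixes f g :: "'a::real_normed_vector \<Rightarrow> real"
  shows "open U \<Longrightarrow> smooth_on U f \<Longrightarrow> smooth_on U g \<Longrightarrow> (\<And>x. x \<in> U \<Longrightarrow> g x \<noteq> 0) \<Longrightarrow>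
    smooth_on U (\<lambda>x. f x / g x)"
  unfolding divide_inverse by (intro smooth_on_mult smooth_on_inverse)

lemma smooth_on_component:
  fixes f :: "'a::real_normed_vector \<Rightarrow> real ^ 'n"
  assumes "open U" "smooth_on U f" shows "smooth_on U (\<lambda>x. f x $ i)"
  using smooth_on_inner[OF assms smooth_on_const[OF assms(1)], of "axis i 1"] by (simp add: inner_axis)

lemma smooth_on_vecI:
  fixes f :: "'a::real_normed_vector \<Rightarrow> real ^ 'n"
  assumes "open U" "\<And>i. smooth_on U (\<lambda>x. f x $ i)" shows "smooth_on U f"
proof -
  have f: "f x = (\<Sum>i\<in>UNIV. (f x $ i) *\<^sub>R axis i 1)" for x
    using basis_expansion[of "f x"] by (simp add: scalar_mult_eq_scaleR)
  have "smooth_on U (\<lambda>x. \<Sum>i\<in>UNIV. (f x $ i) *\<^sub>R axis i 1)"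
    by (intro smooth_on_sum smooth_on_scaleR smooth_on_const assms)
  then show ?thesis
    using smooth_on_cong[OF assms(1) f] by simp
qed

lemma smooth_on_det:
  fixes A :: "'a::real_normed_vector \<Rightarrow> real ^ 'n ^ 'n"
  assumes "open U" "\<And>i j. smooth_on U (\<lambda>x. A x $ i $ j)"
  shows "smooth_on U (\<lambda>x. det (A x))"
  unfolding det_def by (intro smooth_on_sum smooth_on_mult smooth_on_prod smooth_on_const assms)

text \<open>By Cramer's rule every component of the solution is a quotient of determinants.
  Smoothness thus follows from the equation alone, however \<open>z\<close> was obtained.\<close>

lemma smooth_on_linear_solve:
  fixes A :: "'a::real_normed_vector \<Rightarrow> real ^ 'n ^ 'n"
  assumes "open U" "\<And>i j. smooth_on U (\<lambda>x. A x $ i $ j)" "\<And>i. smooth_on U (\<lambda>x. b x $ i)"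
    "\<And>x. x \<in> U \<Longrightarrow> det (A x) \<noteq> 0" "\<And>x. x \<in> U \<Longrightarrow> A x *v z x = b x"
  shows "smooth_on U z"
proof (rule smooth_on_vecI[OF assms(1)])
  fix k
  have eq: "z x $ k = det (\<chi> i j. if j = k then b x $ i else A x $ i $ j) / det (A x)" if "x \<in> U" for x
    using cramer[OF assms(4)[OF that], of "z x" "b x"] assms(5)[OF that] by simp
  have "smooth_on U (\<lambda>x. det (\<chi> i j. if j = k then b x $ i else A x $ i $ j) / det (A x))"
  proof (intro smooth_on_divide smooth_on_det assms)
    fix i j show "smooth_on U (\<lambda>x. (\<chi> i j. if j = k then b x $ i else A x $ i $ j) $ i $ j)"
      using assms by (cases "j = k") auto
  qed auto
  then show "smooth_on U (\<lambda>x. z x $ k)"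
    by (simp only: smooth_on_cong[OF assms(1) eq])
qed

section \<open>Curves in level sets\<close>

text \<open>The map \<open>\<Psi> x = x + (F x - D (x - a)) / D u \<cdot> u\<close> straightens the level set: it has derivative
  the identity at \<open>a\<close> and satisfies \<open>D (\<Psi> x - a) = F x\<close>, so its local inverse sends the line
  through \<open>a\<close> in direction \<open>v \<in> ker D\<close> to a curve in the level set.\<close>

lemma smooth_level_curve:
  fixes F :: "'a::euclidean_space \<Rightarrow> real"
  assumes \<Omega>: "open \<Omega>" and F: "smooth_on \<Omega> F" and a: "a \<in> \<Omega>" "F a = 0"
    and u: "frechet_derivative F (at a) u \<noteq> 0" and v: "frechet_derivative F (at a) v = 0"
  obtains \<epsilon> \<sigma> where "\<epsilon> > 0" "smooth_on {-\<epsilon><..<\<epsilon>} \<sigma>" "\<sigma> 0 = a"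
    "\<And>t. t \<in> {-\<epsilon><..<\<epsilon>} \<Longrightarrow> \<sigma> t \<in> \<Omega> \<and> F (\<sigma> t) = 0" "(\<sigma> has_vector_derivative v) (at 0)"
proof -
  define D where "D = frechet_derivative F (at a)"
  define D' where "D' = (\<lambda>x. frechet_derivative F (at x))"
  define k where "k = D u"
  have k: "k \<noteq> 0" using u by (simp add: k_def D_def)
  have D': "(F has_derivative D' x) (at x)" if "x \<in> \<Omega>" for x
    using smooth_on_has_derivative[OF F that] by (simp add: D'_def)
  have D'lin: "bounded_linear (D' x)" if "x \<in> \<Omega>" for x
    using D'[OF that] by (rule has_derivative_bounded_linear)
  have D: "D = D' a" by (simp add: D_def D'_def)
  have Dlin: "bounded_linear D" using D'lin[OF a(1)] D by simp
  have D's: "smooth_on \<Omega> (\<lambda>x. D' x w)" for w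
    unfolding D'_def by (rule smooth_on_frechet_derivative[OF F])
  \<comment> \<open>The derivative \<open>E x\<close> of \<open>\<Psi>\<close> is a rank one
    perturbation of the identity with determinant \<open>D' x u / k\<close>, so \<open>U\<close> is
    where it is invertible.\<close>
  define U where "U = \<Omega> \<inter> (\<lambda>x. D' x u) -` (- {0})"
  have U: "open U"
    unfolding U_def by (rule continuous_open_preimage[OF smooth_on_continuous_on[OF D's] \<Omega>]) auto
  have U\<Omega>: "U \<subseteq> \<Omega>" by (auto simp: U_def)
  have aU: "a \<in> U" using a k by (simp add: U_def k_def D)
  define \<Psi> where "\<Psi> = (\<lambda>x. x + ((F x - D (x - a)) / k) *\<^sub>R u)"
  define E where "E = (\<lambda>x w. w + ((D' x w - D w) / k) *\<^sub>R u)"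
  have Elin: "bounded_linear (E x)" if "x \<in> \<Omega>" for x
    unfolding E_def
    by (intro bounded_linear_add bounded_linear_ident bounded_linear_scaleR_const
        bounded_linear_compose[OF bounded_linear_divide] bounded_linear_sub D'lin that Dlin)
  define f' where "f' = (\<lambda>x. Blinfun (E x))"
  have f': "blinfun_apply (f' x) = E x" if "x \<in> U" for x
    using Elin that U\<Omega> by (auto simp: f'_def bounded_linear_Blinfun_apply)
  have der: "(\<Psi> has_derivative blinfun_apply (f' x)) (at x)" if "x \<in> U" for x
  proof -
    have "x \<in> \<Omega>" using that U\<Omega> by auto
    have "((\<lambda>x. D (x - a)) has_derivative D) (at x)"
      by (rule bounded_linear.has_derivative[OF Dlin]) (auto intro!: derivative_eq_intros)
    then have "(\<Psi> has_derivative E x) (at x)"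
      unfolding \<Psi>_def E_def using k
      by (auto intro!: derivative_eq_intros D'[OF \<open>x \<in> \<Omega>\<close>])
    then show ?thesis using f'[OF that] by simp
  qed
  have cont: "continuous_on U f'"
  proof (rule continuous_on_blinfun_componentwise)
    fix i :: 'a assume "i \<in> Basis"
    have "continuous_on U (\<lambda>x. E x i)"
      unfolding E_def using smooth_on_continuous_on[OF D's] U\<Omega> k
      by (intro continuous_intros) (auto intro: continuous_on_subset)
    then show "continuous_on U (\<lambda>x. blinfun_apply (f' x) i)"
      by (simp add: f' cong: continuous_on_cong)
  qed
  have "f' a = id_blinfun"
    by (rule blinfun_eqI) (simp add: f' aU E_def D)
  then have inv0: "id_blinfun o\<^sub>L f' a = id_blinfun"
    by (simp add: blinfun_eqI)
  obtain U' V g g' where U': "open U'" "U' \<subseteq> U" "a \<in> U'" and V: "open V" "\<Psi> a \<in> V"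
    and hom: "homeomorphism U' V \<Psi> g"
    and g': "\<And>y. y \<in> V \<Longrightarrow> (g has_derivative g' y) (at y)"
      "\<And>y. y \<in> V \<Longrightarrow> g' y = inv (blinfun_apply (f' (g y)))"
      "\<And>y. y \<in> V \<Longrightarrow> bij (blinfun_apply (f' (g y)))"
    using inverse_function_theorem[OF U der cont aU inv0] by metis
  have \<Psi>a: "\<Psi> a = a" using a linear_0[OF bounded_linear.linear[OF Dlin]] by (simp add: \<Psi>_def)
  have aV: "a \<in> V" using V \<Psi>a by simp
  have ga: "g a = a" using homeomorphism_apply1[OF hom U'(3)] \<Psi>a by simp
  have gU: "g y \<in> U" if "y \<in> V" for y
    using hom that U'(2) unfolding homeomorphism_def by blast
  have Fg: "F (g y) = D (y - a)" if "y \<in> V" for y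
  proof -
    have "\<Psi> (g y) = y" using homeomorphism_apply2[OF hom that] .
    then have "y - a = (g y - a) + ((F (g y) - D (g y - a)) / k) *\<^sub>R u"
      by (simp add: \<Psi>_def algebra_simps)
    from arg_cong[OF this, of D]
    have "D (y - a) = D (g y - a) + ((F (g y) - D (g y - a)) / k) * D u"
      unfolding linear_add[OF bounded_linear.linear[OF Dlin]] linear_scale[OF bounded_linear.linear[OF Dlin]]
      by simp
    then show ?thesis using k by (simp add: k_def)
  qed
  \<comment> \<open>The inverse of the rank one perturbation \<open>E (g y)\<close> in closed
    form.\<close>
  have g'eq: "g' y w = w - ((D' (g y) w - D w) / D' (g y) u) *\<^sub>R u" (is "_ = ?z") if "y \<in> V" for y w
  proof -
    define d where "d = D' (g y) u"
    have d: "d \<noteq> 0" using gU[OF that] by (auto simp: d_def U_def)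
    define c where "c = (D' (g y) w - D w) / d"
    have lin: "linear (D' (g y))" "linear D"
      using D'lin gU[OF that] U\<Omega> Dlin bounded_linear.linear by blast+
    have "D' (g y) (w - c *\<^sub>R u) - D (w - c *\<^sub>R u) = c * k"
      using d unfolding linear_diff[OF lin(1)] linear_diff[OF lin(2)]
        linear_scale[OF lin(1)] linear_scale[OF lin(2)]
      by (simp add: k_def d_def[symmetric] c_def field_simps)
    then have "blinfun_apply (f' (g y)) (w - c *\<^sub>R u) = w"
      using gU[OF that] k by (simp add: f' E_def)
    then show ?thesis
      using g'(2,3)[OF that] bij_inv_eq_iff by (metis c_def d_def)
  qed
  \<comment> \<open>The library theorem only gives differentiability of \<open>g\<close>. Higher
    orders come by bootstrapping: \<open>g'\<close> is an expression in \<open>D'\<close> at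
    \<open>g y\<close>, hence as regular as \<open>g\<close>.\<close>
  have "Ck_on j V g" for j
  proof (induction j)
    case 0
    then show ?case using hom by (simp add: homeomorphism_def)
  next
    case (Suc j)
    show ?case
    proof (rule Ck_on_SucI[OF V(1) g'(1)])
      fix w
      have 1: "Ck_on j V (\<lambda>y. D' (g y) w')" for w'
        by (rule Ck_on_compose[OF V(1) \<Omega> _ Suc])
          (use gU U\<Omega> D's[of w'] in \<open>auto simp: smooth_on_def\<close>)
      have "Ck_on j V (\<lambda>y. w + (-1) *\<^sub>R ((D' (g y) w + - D w) * inverse (D' (g y) u)) *\<^sub>R u)"
        by (intro Ck_on_add Ck_on_bilinear[OF bounded_bilinear_scaleR]
            Ck_on_bilinear[OF bounded_bilinear_mult] Ck_on_inverse V(1) Ck_on_const 1)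
          (use gU in \<open>auto simp: U_def\<close>)
      moreover have "g' y w = w + (-1) *\<^sub>R ((D' (g y) w + - D w) * inverse (D' (g y) u)) *\<^sub>R u"
        if "y \<in> V" for y
        using g'eq[OF that] by (simp add: divide_inverse)
      ultimately show "Ck_on j V (\<lambda>y. g' y w)"
        using Ck_on_cong[OF V(1), of "\<lambda>y. g' y w"] by simp
    qed
  qed
  then have gs: "smooth_on V g" by (simp add: smooth_on_def)
  have "isCont (\<lambda>t. a + t *\<^sub>R v) 0" by (intro continuous_intros)
  then obtain \<epsilon> where \<epsilon>: "\<epsilon> > 0" "\<And>t. \<bar>t\<bar> < \<epsilon> \<Longrightarrow> a + t *\<^sub>R v \<in> V"
    using V(1) aV unfolding continuous_at_open
    by (metis (no_types, lifting) V(1) \<open>isCont (\<lambda>t. a + t *\<^sub>R v) 0\<close> add.right_neutral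
        continuous_at_ball dist_commute dist_real_def image_subset_iff mem_ball open_contains_ball
        diff_zero scale_zero_left subset_iff)
  have sub: "(\<lambda>t. a + t *\<^sub>R v) ` {-\<epsilon><..<\<epsilon>} \<subseteq> V" using \<epsilon>(2) by auto
  show ?thesis
  proof (rule that[of \<epsilon> "\<lambda>t. g (a + t *\<^sub>R v)"])
    show "smooth_on {-\<epsilon><..<\<epsilon>} (\<lambda>t. g (a + t *\<^sub>R v))"
      by (rule smooth_on_compose[OF _ V(1) sub _ gs])
        (auto intro!: smooth_on_add smooth_on_scaleR smooth_on_const smooth_on_ident)
    show "g (a + t *\<^sub>R v) \<in> \<Omega> \<and> F (g (a + t *\<^sub>R v)) = 0" if "t \<in> {-\<epsilon><..<\<epsilon>}" for t
    proof -
      have V: "a + t *\<^sub>R v \<in> V" using that \<epsilon>(2) by auto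
      have "D (t *\<^sub>R v) = 0"
        using v linear_scale[OF bounded_linear.linear[OF Dlin]] by (simp add: D_def)
      then show ?thesis using Fg[OF V] gU[OF V] U\<Omega> by auto
    qed
    have "g' a v = v" using g'eq[OF aV, of v] v by (simp add: ga D D_def)
    have "((\<lambda>t. a + t *\<^sub>R v) has_derivative (\<lambda>t. t *\<^sub>R v)) (at 0)"
      by (auto intro!: derivative_eq_intros)
    moreover have "(g has_derivative g' a) (at (a + 0 *\<^sub>R v))" using g'(1)[OF aV] by simp
    ultimately have "((\<lambda>t. g (a + t *\<^sub>R v)) has_derivative (\<lambda>t. g' a (t *\<^sub>R v))) (at 0)"
      using diff_chain_at[of "\<lambda>t. a + t *\<^sub>R v" "\<lambda>t. t *\<^sub>R v" 0 g "g' a"] by (simp add: o_def)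
    moreover have "g' a (t *\<^sub>R v) = t *\<^sub>R v" for t
      using linear_scale[OF has_derivative_linear[OF g'(1)[OF aV]]] \<open>g' a v = v\<close> by simp
    ultimately show "((\<lambda>t. g (a + t *\<^sub>R v)) has_vector_derivative v) (at 0)"
      by (simp add: has_vector_derivative_def)
  qed (use \<epsilon> ga in auto)
qed

section \<open>Bump functions\<close>

text \<open>The case \<open>n = 0\<close> is the classical flat function. The power of 1/t is
  carried along because the whole family is closed under differentiation, which makes smoothness a
  single induction.\<close>

definition exp_flat :: "nat \<Rightarrow> real \<Rightarrow> real" where
  "exp_flat n t = (if t \<le> 0 then 0 else (inverse t) ^ n / exp (inverse t))"

lemma exp_flat_tendsto_0: "(exp_flat n \<longlongrightarrow> 0) (at 0)"
proof -
  have "((\<lambda>t. (inverse t) ^ n / exp (inverse t)) \<longlongrightarrow> (0::real)) (at_right 0)"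
    by (rule filterlim_compose[OF tendsto_power_div_exp_0 filterlim_inverse_at_top_right])
  then have r: "(exp_flat n \<longlongrightarrow> 0) (at_right 0)"
    by (rule Lim_transform_eventually) (auto simp: exp_flat_def eventually_at_filter)
  have "(exp_flat n \<longlongrightarrow> 0) (at_left 0)"
    by (rule Lim_transform_eventually[OF tendsto_const[of 0]])
      (auto simp: exp_flat_def eventually_at_filter)
  then show ?thesis using r by (simp add: filterlim_at_split)
qed

lemma exp_flat_has_derivative:
  "(exp_flat n has_real_derivative exp_flat (n + 2) t - n * exp_flat (n + 1) t) (at t)"
proof (cases t "0 :: real" rule: linorder_cases)
  case less
  have "((\<lambda>t. 0) has_real_derivative 0) (at t)" by simp
  then have "(exp_flat n has_real_derivative 0) (at t)"
    by (rule has_field_derivative_transform_within_open[of _ _ _ "{..<0}"])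
      (use less in \<open>auto simp: exp_flat_def\<close>)
  then show ?thesis using less by (simp add: exp_flat_def)
next
  case equal
  \<comment> \<open>The difference quotient at 0 is again a member of the family, with exponent
    \<open>Suc n\<close>.\<close>
  have "((\<lambda>h. (exp_flat n (0 + h) - exp_flat n 0) / h) \<longlongrightarrow> 0) (at 0)"
    by (rule Lim_transform_eventually[OF exp_flat_tendsto_0[of "Suc n"]])
      (auto simp: exp_flat_def eventually_at_filter field_simps)
  then show ?thesis using equal by (simp add: DERIV_def exp_flat_def)
next
  case greater
  define y where "y = inverse t"
  have "((\<lambda>y. y ^ n / exp y) has_real_derivative (n * y ^ (n - 1) - y ^ n) / exp y) (at y)"
    by (auto intro!: derivative_eq_intros simp: field_simps power2_eq_square)
  moreover have "(inverse has_real_derivative - (y\<^sup>2)) (at t)"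
    using greater by (auto intro!: derivative_eq_intros simp: y_def power2_eq_square)
  ultimately have "((\<lambda>t. (inverse t) ^ n / exp (inverse t)) has_real_derivative
      (n * y ^ (n - 1) - y ^ n) / exp y * - (y\<^sup>2)) (at t)"
    unfolding y_def by (rule DERIV_chain2)
  moreover have "(n * y ^ (n - 1) - y ^ n) / exp y * - (y\<^sup>2)
      = exp_flat (n + 2) t - n * exp_flat (n + 1) t"
  proof -
    have "exp_flat m t = y ^ m / exp y" for m using greater by (simp add: exp_flat_def y_def)
    then show ?thesis by (cases n) (auto simp: divide_simps power2_eq_square algebra_simps)
  qed
  ultimately have "((\<lambda>t. (inverse t) ^ n / exp (inverse t)) has_real_derivative
      exp_flat (n + 2) t - n * exp_flat (n + 1) t) (at t)" by simp
  then show ?thesis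
    by (rule has_field_derivative_transform_within_open[of _ _ _ "{0<..}"])
      (use greater in \<open>auto simp: exp_flat_def\<close>)
qed

lemma Ck_on_exp_flat: "Ck_on k UNIV (exp_flat n)"
proof (induction k arbitrary: n)
  case 0
  show ?case
    using exp_flat_has_derivative by (auto intro!: continuous_at_imp_continuous_on DERIV_isCont)
next
  case (Suc k)
  show ?case
  proof (rule Ck_on_SucI)
    show "(exp_flat n has_derivative (\<lambda>v. v * (exp_flat (n + 2) x + (- real n) * exp_flat (n + 1) x))) (at x)" for x
      using exp_flat_has_derivative[of n x] unfolding has_field_derivative_def
      by (rule has_derivative_eq_rhs) (auto simp: algebra_simps)
    show "Ck_on k UNIV (\<lambda>x. v * (exp_flat (n + 2) x + (- real n) * exp_flat (n + 1) x))" for v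
      by (intro Ck_on_add Ck_on_bilinear[OF bounded_bilinear_mult] Ck_on_const Suc open_UNIV)
  qed simp
qed

lemma smooth_step_exists:
  obtains h :: "real \<Rightarrow> real" where "smooth_on UNIV h" "\<And>t. t \<le> 0 \<Longrightarrow> h t = 0"
    "\<And>t. t \<ge> 1 \<Longrightarrow> h t = 1" "\<And>t. 0 \<le> h t" "\<And>t. h t \<le> 1"
proof -
  let ?e = "exp_flat 0"
  have e: "?e t \<ge> 0" "t > 0 \<Longrightarrow> ?e t > 0" for t by (auto simp: exp_flat_def)
  have pos: "?e t + ?e (1 - t) > 0" for t
    using e(1)[of t] e(1)[of "1 - t"] e(2)[of t] e(2)[of "1 - t"] by (cases "t > 0") auto
  have s: "smooth_on UNIV ?e" by (simp add: smooth_on_def Ck_on_exp_flat)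
  have s': "smooth_on UNIV (\<lambda>t. ?e (1 - t))"
    by (rule smooth_on_compose[OF _ _ _ _ s])
      (simp, simp, simp, intro smooth_on_diff smooth_on_const smooth_on_ident open_UNIV)
  show ?thesis
  proof (rule that[of "\<lambda>t. ?e t / (?e t + ?e (1 - t))"])
    show "smooth_on UNIV (\<lambda>t. ?e t / (?e t + ?e (1 - t)))"
      by (intro smooth_on_divide smooth_on_add s s') (use pos less_irrefl in \<open>auto, metis\<close>)
    show "?e t / (?e t + ?e (1 - t)) = 1" if "t \<ge> 1" for t
      using that e(2)[of t] by (simp add: exp_flat_def)
  qed (use e pos in \<open>auto simp: exp_flat_def divide_simps\<close>)
qed

lemma smooth_bump_exists:
  fixes a :: "'a::euclidean_space"
  assumes "r > 0"
  obtains \<phi> :: "'a \<Rightarrow> real" where "smooth_on UNIV \<phi>" "\<And>x. dist x a < r / 2 \<Longrightarrow> \<phi> x = 1"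
    "\<And>x. dist x a \<ge> 3 / 4 * r \<Longrightarrow> \<phi> x = 0" "\<And>x. 0 \<le> \<phi> x" "\<And>x. \<phi> x \<le> 1"
proof -
  obtain h :: "real \<Rightarrow> real" where h: "smooth_on UNIV h" "\<And>t. t \<le> 0 \<Longrightarrow> h t = 0"
    "\<And>t. t \<ge> 1 \<Longrightarrow> h t = 1" "\<And>t. 0 \<le> h t" "\<And>t. h t \<le> 1"
    using smooth_step_exists by metis
  \<comment> \<open>The squared distance is smooth also at \<open>a\<close>. The constants give
    \<open>q = 1\<close> at distance r/2 and \<open>q = -1/4\<close> at distance 3r/4.\<close>
  define q where "q = (\<lambda>x. 2 - 4 / r\<^sup>2 * ((x - a) \<bullet> (x - a)))"
  have q: "q x = 2 - 4 / r\<^sup>2 * (dist x a)\<^sup>2" for x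
    by (simp add: q_def dist_norm power2_norm_eq_inner)
  show ?thesis
  proof (rule that[of "\<lambda>x. h (q x)"])
    show "smooth_on UNIV (\<lambda>x. h (q x))"
      unfolding q_def
      by (rule smooth_on_compose[OF _ _ _ _ h(1)])
        (simp, simp, simp, intro smooth_on_diff smooth_on_mult smooth_on_inner smooth_on_const
          smooth_on_ident open_UNIV)
    show "h (q x) = 1" if "dist x a < r / 2" for x
    proof (rule h(3))
      have "(dist x a)\<^sup>2 \<le> (r / 2)\<^sup>2" using that by (intro power_mono) auto
      then show "q x \<ge> 1" using assms by (simp add: q divide_simps power_divide)
    qed
    show "h (q x) = 0" if "dist x a \<ge> 3 / 4 * r" for x
    proof (rule h(2))
      have "(3 / 4 * r)\<^sup>2 \<le> (dist x a)\<^sup>2" using that assms by (intro power_mono) auto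
      moreover have "(3 / 4 * r)\<^sup>2 = 9 / 16 * r\<^sup>2" by (simp add: power2_eq_square)
      ultimately have "4 * (dist x a)\<^sup>2 \<ge> 2 * r\<^sup>2"
        using zero_le_power2[of r] by linarith
      then show "q x \<le> 0" using assms by (simp add: q divide_simps)
    qed
  qed (use h in auto)
qed

section \<open>Linear algebra of symmetric forms\<close>

definition orthonormal_on :: "('v \<Rightarrow> 'v \<Rightarrow> real) \<Rightarrow> 'v set \<Rightarrow> bool" where
  "orthonormal_on h E \<longleftrightarrow> (\<forall>e\<in>E. \<forall>e'\<in>E. h e e' = (if e = e' then 1 else 0))"

locale sym_form =
  fixes T :: "'v::real_vector set" and h :: "'v \<Rightarrow> 'v \<Rightarrow> real"
  assumes T: "subspace T" and h: "sym_bilinear_on T h"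
begin

lemma sym: "u \<in> T \<Longrightarrow> v \<in> T \<Longrightarrow> h u v = h v u"
  using h by (auto simp: sym_bilinear_on_def)

lemma add_left: "u \<in> T \<Longrightarrow> v \<in> T \<Longrightarrow> w \<in> T \<Longrightarrow> h (u + v) w = h u w + h v w"
  using h by (auto simp: sym_bilinear_on_def)

lemma scale_left: "u \<in> T \<Longrightarrow> v \<in> T \<Longrightarrow> h (a *\<^sub>R u) v = a * h u v"
  using h by (auto simp: sym_bilinear_on_def)

lemma add_right: "u \<in> T \<Longrightarrow> v \<in> T \<Longrightarrow> w \<in> T \<Longrightarrow> h w (u + v) = h w u + h w v"
  using add_left sym T by (metis subspace_add)

lemma scale_right: "u \<in> T \<Longrightarrow> v \<in> T \<Longrightarrow> h u (a *\<^sub>R v) = a * h u v"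
  using scale_left sym T by (metis subspace_scale)

lemma zero_left: "v \<in> T \<Longrightarrow> h 0 v = 0"
  using scale_left[of v v 0] by simp

lemma zero_right: "v \<in> T \<Longrightarrow> h v 0 = 0"
  using zero_left sym T by (metis subspace_0)

lemma sum_left: "(\<And>i. i \<in> I \<Longrightarrow> f i \<in> T) \<Longrightarrow> v \<in> T \<Longrightarrow> h (\<Sum>i\<in>I. f i) v = (\<Sum>i\<in>I. h (f i) v)"
  by (induction I rule: infinite_finite_induct) (auto simp: zero_left add_left subspace_sum[OF T])

lemma sum_right: "(\<And>i. i \<in> I \<Longrightarrow> f i \<in> T) \<Longrightarrow> v \<in> T \<Longrightarrow> h v (\<Sum>i\<in>I. f i) = (\<Sum>i\<in>I. h v (f i))"
  by (induction I rule: infinite_finite_induct) (auto simp: zero_right add_right subspace_sum[OF T])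

lemma minus_left: "u \<in> T \<Longrightarrow> v \<in> T \<Longrightarrow> h (- u) v = - h u v"
  using scale_left[of u v "-1"] by simp

lemma minus_right: "u \<in> T \<Longrightarrow> v \<in> T \<Longrightarrow> h u (- v) = - h u v"
  using scale_right[of u v "-1"] by simp

lemma orthonormal_sum_coeff:
  assumes "finite E" "E \<subseteq> T" "orthonormal_on h E" "e \<in> E"
  shows "h (\<Sum>x\<in>E. c x *\<^sub>R x) e = c e"
proof -
  have "h (\<Sum>x\<in>E. c x *\<^sub>R x) e = (\<Sum>x\<in>E. h (c x *\<^sub>R x) e)"
    using assms subspace_scale[OF T] by (intro sum_left) auto
  also have "\<dots> = (\<Sum>x\<in>E. if x = e then c e else 0)"
    using assms by (intro sum.cong refl) (auto simp: scale_left orthonormal_on_def subset_iff)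
  finally show ?thesis using assms by simp
qed

lemma orthonormal_independent:
  assumes "finite E" "E \<subseteq> T" "orthonormal_on h E"
  shows "independent E"
proof -
  have "c e = 0" if "(\<Sum>x\<in>E. c x *\<^sub>R x) = 0" "e \<in> E" for c e
    using orthonormal_sum_coeff[OF assms that(2), of c] that zero_left assms by auto
  then show ?thesis using assms(1) by (metis dependent_finite)
qed

text \<open>Gram-Schmidt by induction over \<open>F\<close>, keeping the given \<open>E\<close>. It
  is started from \<open>{V p}\<close> when a basis adapted to the dual vector is wanted.\<close>

lemma orthonormal_extend:
  assumes "positive_definite_on T h" "finite F" "F \<subseteq> T" "finite E" "E \<subseteq> T" "orthonormal_on h E"
  shows "\<exists>E'. finite E' \<and> E \<subseteq> E' \<and> E' \<subseteq> T \<and> orthonormal_on h E' \<and> span E' = span (E \<union> F)"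
  using assms(2,3)
proof (induction F)
  case empty
  then show ?case using assms by auto
next
  case (insert a F)
  then obtain E' where E': "finite E'" "E \<subseteq> E'" "E' \<subseteq> T" "orthonormal_on h E'" "span E' = span (E \<union> F)"
    by auto
  have aT: "a \<in> T" using insert by simp
  define p where "p = (\<Sum>e\<in>E'. h a e *\<^sub>R e)"
  have p: "p \<in> T" "p \<in> span E'"
    unfolding p_def using E'(3)
    by (auto intro!: subspace_sum[OF T] subspace_scale[OF T]) (intro span_sum span_scale span_base)
  have span_ins: "span (E \<union> insert a F) = span (insert a E')"
  proof -
    have "span (E \<union> insert a F) = span (insert a (E \<union> F))" by simp
    also have "\<dots> = span (insert a E')" using E'(5) by (simp add: span_insert)
    finally show ?thesis .
  qed
  show ?case
  proof (cases "a = p")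
    case True
    then have "span (insert a E') = span E'" using p by (simp add: span_redundant)
    then show ?thesis using E' span_ins by auto
  next
    case False
    define d where "d = a - p"
    have d: "d \<in> T" "d \<noteq> 0" using False p aT subspace_diff[OF T] by (auto simp: d_def)
    have hd: "h d d > 0" using assms(1) d by (auto simp: positive_definite_on_def)
    have dE: "h d e = 0" if "e \<in> E'" for e
    proof -
      have e: "e \<in> T" using that E' by auto
      have "h d e = h (a + - p) e" by (simp add: d_def)
      also have "\<dots> = h a e - h p e"
        using add_left[OF aT subspace_neg[OF T p(1)] e] minus_left[OF p(1) e] by linarith
      also have "h p e = h a e" unfolding p_def by (rule orthonormal_sum_coeff[OF E'(1,3,4) that])
      finally show ?thesis by simp
    qed
    define n where "n = (1 / sqrt (h d d)) *\<^sub>R d"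
    have n: "n \<in> T" using d subspace_scale[OF T] by (simp add: n_def)
    have nn: "h n n = 1"
      using hd d n by (simp add: n_def scale_left scale_right subspace_scale[OF T])
    have nE: "h n e = 0" if "e \<in> E'" for e
      using dE[OF that] d that E' by (auto simp: n_def scale_left)
    have nE': "h e n = 0" if "e \<in> E'" for e
      using nE[OF that] sym[of e n] n that E' by auto
    have "orthonormal_on h (insert n E')"
      using E'(4) nn nE nE' by (auto simp: orthonormal_on_def)
    moreover have "span (insert n E') = span (insert a E')"
    proof (rule span_eq[THEN iffD2], intro conjI)
      have "n \<in> span (insert a E')"
      proof -
        have "p \<in> span (insert a E')" using p(2) span_mono[of E' "insert a E'"] by auto
        then show ?thesis
          unfolding n_def d_def by (intro span_scale span_diff) (auto intro: span_base)
      qed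
      then show "insert n E' \<subseteq> span (insert a E')" by (auto intro: span_base)
      have "a = sqrt (h d d) *\<^sub>R n + p" using hd by (simp add: n_def d_def)
      moreover have "p \<in> span (insert n E')" using p(2) span_mono[of E' "insert n E'"] by auto
      ultimately have "a \<in> span (insert n E')"
        by (metis insertI1 span_add span_base span_scale)
      then show "insert a E' \<subseteq> span (insert n E')" by (auto intro: span_base)
    qed
    ultimately show ?thesis
      using E' n span_ins by (intro exI[of _ "insert n E'"]) auto
  qed
qed

end

text \<open>The form is concave along the line \<open>x + \<tau> w\<close>, so it cannot be non-negative both at the
  zero of \<open>b\<close> and at the zero of \<open>b'\<close> if these lie on different sides of \<open>\<tau> = 0\<close>.\<close>

lemma causal_sign_agree:
  fixes G :: "real ^ 'n ^ 'n" and b b' :: "real ^ 'n"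
  defines "q \<equiv> \<lambda>v. v \<bullet> (G *v v)"
  assumes sym: "transpose G = G"
    and b: "\<And>v. v \<noteq> 0 \<Longrightarrow> b \<bullet> v = 0 \<Longrightarrow> q v > 0"
    and b': "\<And>v. v \<noteq> 0 \<Longrightarrow> b' \<bullet> v = 0 \<Longrightarrow> q v > 0"
    and w: "q w < 0" "(b \<bullet> w) * (b' \<bullet> w) > 0"
    and x: "x \<noteq> 0" "q x \<le> 0"
  shows "(b \<bullet> x) * (b' \<bullet> x) > 0"
proof (rule ccontr)
  assume neg: "\<not> (b \<bullet> x) * (b' \<bullet> x) > 0"
  have ne: "b \<bullet> x \<noteq> 0" "b' \<bullet> x \<noteq> 0" using b[of x] b'[of x] x by fastforce+
  have wne: "b \<bullet> w \<noteq> 0" "b' \<bullet> w \<noteq> 0" using w by auto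
  define m where "m = x \<bullet> (G *v w)"
  have m': "w \<bullet> (G *v x) = m"
    unfolding m_def using sym by (metis dot_lmul_matrix inner_commute transpose_matrix_vector)
  have q: "q (x + t *\<^sub>R w) = q x + 2 * t * m + t\<^sup>2 * q w" for t
  proof -
    have "q (x + t *\<^sub>R w) = q x + t * (x \<bullet> (G *v w)) + t * (w \<bullet> (G *v x)) + t * t * q w"
      unfolding q_def by (simp add: matrix_vector_right_distrib matrix_vector_mult_scaleR
          inner_add_left inner_add_right algebra_simps)
    then show ?thesis using m' by (simp add: m_def power2_eq_square)
  qed
  define t t' where "t = - (b \<bullet> x) / (b \<bullet> w)" and "t' = - (b' \<bullet> x) / (b' \<bullet> w)"
  have q0: "q 0 = 0" by (simp add: q_def)
  have "b \<bullet> (x + t *\<^sub>R w) = 0" "b' \<bullet> (x + t' *\<^sub>R w) = 0"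
    using wne by (simp_all add: t_def t'_def inner_add_right inner_diff_right)
  then have "q (x + t *\<^sub>R w) \<ge> 0" "q (x + t' *\<^sub>R w) \<ge> 0"
    using b b' q0 by (metis less_eq_real_def)+
  moreover have "t \<noteq> 0" "t' \<noteq> 0" using ne wne by (auto simp: t_def t'_def)
  then have "t\<^sup>2 * q w < 0" "t'\<^sup>2 * q w < 0" using w by (simp_all add: mult_less_0_iff)
  \<comment> \<open>At the two zeros the form is non-negative although \<open>q x\<close> is not
    positive and the quadratic term is negative, so the linear term must be positive at both. Hence
    \<open>t\<close> and \<open>t'\<close> have the sign of \<open>m\<close>.\<close>
  ultimately have "t * m > 0" "t' * m > 0" using x(2) unfolding q by linarith+
  then have "(t * m) * (t' * m) > 0" by simp
  then have "(t * t') * m\<^sup>2 > 0" by (simp add: power2_eq_square ac_simps)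
  then have "t * t' > 0" by (simp add: zero_less_mult_iff)
  moreover have "t * t' = ((b \<bullet> x) * (b' \<bullet> x)) / ((b \<bullet> w) * (b' \<bullet> w))"
    by (simp add: t_def t'_def)
  ultimately show False using w(2) neg by (simp add: zero_less_divide_iff)
qed

text \<open>Homogeneity reduces the implication to unit vectors, where it says that
  \<open>p1\<close> or \<open>p2\<close> is positive. This is an open condition on a product with
  the compact sphere, so the tube lemma applies.\<close>

lemma homogeneous_fibre_open:
  fixes p1 p2 :: "'x::topological_space \<times> 'v::euclidean_space \<Rightarrow> real"
  assumes \<Omega>: "open \<Omega>" "a \<in> \<Omega>"
    and cont: "continuous_on (\<Omega> \<times> UNIV) p1" "continuous_on (\<Omega> \<times> UNIV) p2"
    and hom: "\<And>x v t. p1 (x, t *\<^sub>R v) = t\<^sup>2 * p1 (x, v)" "\<And>x v t. p2 (x, t *\<^sub>R v) = t\<^sup>2 * p2 (x, v)"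
    and a: "\<And>v. v \<noteq> 0 \<Longrightarrow> p1 (a, v) \<le> 0 \<Longrightarrow> p2 (a, v) > 0"
  obtains N where "open N" "a \<in> N" "N \<subseteq> \<Omega>"
    "\<And>x v. x \<in> N \<Longrightarrow> v \<noteq> 0 \<Longrightarrow> p1 (x, v) \<le> 0 \<Longrightarrow> p2 (x, v) > 0"
proof -
  define W where "W = (\<Omega> \<times> UNIV) \<inter> p1 -` {0<..} \<union> (\<Omega> \<times> UNIV) \<inter> p2 -` {0<..}"
  have "open (\<Omega> \<times> (UNIV :: 'v set))" using \<Omega> by (intro open_Times) auto
  then have W: "open W"
    unfolding W_def by (intro open_Un continuous_open_preimage cont) auto
  have "{a} \<times> sphere 0 1 \<subseteq> W"
  proof clarify
    fix v :: 'v assume "v \<in> sphere 0 1"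
    then have "v \<noteq> 0" by auto
    then show "(a, v) \<in> W" using a[of v] \<Omega> by (cases "p1 (a, v) \<le> 0") (auto simp: W_def)
  qed
  from Elementary_Topology.tube_lemma[OF compact_sphere W this]
  obtain X where X: "a \<in> X" "open X" "X \<times> sphere 0 1 \<subseteq> W" by metis
  show ?thesis
  proof (rule that[of "X \<inter> \<Omega>"])
    fix x v assume x: "x \<in> X \<inter> \<Omega>" and v: "(v::'v) \<noteq> 0" "p1 (x, v) \<le> 0"
    define u where "u = (1 / norm v) *\<^sub>R v"
    have u: "norm u = 1" "v = norm v *\<^sub>R u" using v by (simp_all add: u_def)
    then have "(x, u) \<in> W" using x X(3) by auto
    moreover have "\<not> p1 (x, u) > 0"
      using hom(1)[of x "norm v" u] v u(2) by (auto simp: mult_le_0_iff)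
    ultimately have "p2 (x, u) > 0" by (auto simp: W_def)
    then show "p2 (x, v) > 0"
      using hom(2)[of x "norm v" u] v u(2) by simp
  qed (use X \<Omega> in auto)
qed

section \<open>The vector field dual to a covector with spacelike kernel\<close>

text \<open>The conditions \<open>G V = s b\<close>, \<open>b \<bullet> V = 1\<close> form a linear system for \<open>(V, -s)\<close> whose bordered
  matrix is invertible also where \<open>G\<close> is degenerate.\<close>

definition bordered :: "real ^ 'n ^ 'n \<Rightarrow> real ^ 'n \<Rightarrow> real ^ ('n option) ^ ('n option)" where
  "bordered G b = (\<chi> i j. case i of None \<Rightarrow> (case j of None \<Rightarrow> 0 | Some l \<Rightarrow> b $ l)
     | Some k \<Rightarrow> (case j of None \<Rightarrow> b $ k | Some l \<Rightarrow> G $ k $ l))"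

lemma sum_option: "(\<Sum>i\<in>(UNIV :: 'n::finite option set). f i) = f None + (\<Sum>i\<in>UNIV. f (Some i))"
  unfolding UNIV_option_conv by (subst sum.insert) (auto simp: sum.reindex)

lemma bordered_mult:
  fixes G :: "real ^ 'n ^ 'n" and z :: "real ^ ('n option)"
  shows "(bordered G b *v z) $ None = b \<bullet> (\<chi> i. z $ Some i)"
    "(bordered G b *v z) $ Some k = b $ k * z $ None + (G *v (\<chi> i. z $ Some i)) $ k"
  by (simp_all add: bordered_def matrix_vector_mult_def sum_option inner_vec_def)

text \<open>A kernel vector with parts \<open>v\<close> and \<open>r\<close> satisfies b \<bullet> v
  = 0 and G v = - r b, whence v \<bullet> G v = 0. Positivity on the kernel of \<open>b\<close>
  forces v = 0, and then r b = 0.\<close>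

lemma det_bordered_nonzero:
  fixes G :: "real ^ 'n ^ 'n"
  assumes "b \<noteq> 0" and pos: "\<And>v. v \<noteq> 0 \<Longrightarrow> b \<bullet> v = 0 \<Longrightarrow> v \<bullet> (G *v v) > 0"
  shows "det (bordered G b) \<noteq> 0"
proof -
  have "z = 0" if z: "bordered G b *v z = 0" for z :: "real ^ ('n option)"
  proof -
    define v where "v = (\<chi> i. z $ Some i)"
    have bv: "b \<bullet> v = 0" using z bordered_mult(1)[of G b z] by (simp add: v_def)
    have Gv: "G *v v = - (z $ None) *\<^sub>R b"
    proof (rule vec_eq_iff[THEN iffD2], rule allI)
      fix k show "(G *v v) $ k = (- (z $ None) *\<^sub>R b) $ k"
        using z bordered_mult(2)[of G b z k] by (simp add: v_def algebra_simps)
    qed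
    have "v \<bullet> (G *v v) = 0" unfolding Gv using bv by (simp add: inner_commute)
    then have v: "v = 0" using pos[OF _ bv] by force
    then have "z $ None = 0" using Gv \<open>b \<noteq> 0\<close> by simp
    moreover have "z $ Some k = 0" for k using v by (simp add: v_def vec_eq_iff)
    ultimately show ?thesis by (simp add: vec_eq_iff) (metis option.exhaust)
  qed
  then show ?thesis
    by (metis invertible_det_nz invertible_left_inverse matrix_left_invertible_ker)
qed

lemma dual_vector_exists:
  fixes G :: "real ^ 'n ^ 'n"
  assumes "b \<noteq> 0" and pos: "\<And>v. v \<noteq> 0 \<Longrightarrow> b \<bullet> v = 0 \<Longrightarrow> v \<bullet> (G *v v) > 0"
  obtains V s where "G *v V = s *\<^sub>R b" "b \<bullet> V = 1"
proof -
  obtain z where z: "bordered G b *v z = axis None 1"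
    using det_bordered_nonzero[OF assms] cramer by blast
  show ?thesis
  proof (rule that)
    show "b \<bullet> (\<chi> i. z $ Some i) = 1" using z bordered_mult(1)[of G b z] by simp
    show "G *v (\<chi> i. z $ Some i) = (- z $ None) *\<^sub>R b"
      using z bordered_mult(2)[of G b z]
      by (auto simp: vec_eq_iff axis_def mult.commute eq_neg_iff_add_eq_0 add.commute)
  qed
qed

text \<open>\<open>V\<close> and \<open>s\<close> are only assumed to solve the equations pointwise.
  The bordered system has a unique solution, so values picked by a choice operator at each point are
  automatically smooth.\<close>

lemma dual_vector_smooth:
  fixes G :: "'a::real_normed_vector \<Rightarrow> real ^ 'n ^ 'n"
  assumes U: "open U" and G: "\<And>i j. smooth_on U (\<lambda>x. G x $ i $ j)" and b: "smooth_on U b"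
    and nz: "\<And>x. x \<in> U \<Longrightarrow> b x \<noteq> 0"
    and pos: "\<And>x v. x \<in> U \<Longrightarrow> v \<noteq> 0 \<Longrightarrow> b x \<bullet> v = 0 \<Longrightarrow> v \<bullet> (G x *v v) > 0"
    and V: "\<And>x. x \<in> U \<Longrightarrow> G x *v V x = s x *\<^sub>R b x" "\<And>x. x \<in> U \<Longrightarrow> b x \<bullet> V x = 1"
  shows "smooth_on U V" "smooth_on U s"
proof -
  define z where "z = (\<lambda>x. \<chi> i. case i of None \<Rightarrow> - s x | Some k \<Rightarrow> V x $ k)"
  have zV: "(\<chi> i. z x $ Some i) = V x" for x by (simp add: z_def vec_eq_iff)
  have z: "smooth_on U z"
  proof (rule smooth_on_linear_solve[OF U])
    show "smooth_on U (\<lambda>x. bordered (G x) (b x) $ i $ j)" for i j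
      unfolding bordered_def using G smooth_on_component[OF U b] smooth_on_const[OF U]
      by (cases i; cases j) auto
    show "smooth_on U (\<lambda>x. axis None 1 $ i)" for i by (rule smooth_on_const[OF U])
    show "det (bordered (G x) (b x)) \<noteq> 0" if "x \<in> U" for x
      using det_bordered_nonzero nz pos that by blast
    show "bordered (G x) (b x) *v z x = axis None 1" if "x \<in> U" for x
    proof (rule vec_eq_iff[THEN iffD2], rule allI)
      fix i show "(bordered (G x) (b x) *v z x) $ i = axis None 1 $ i"
        using V[OF that] by (cases i) (simp_all add: bordered_mult zV, simp_all add: z_def axis_def)
    qed
  qed
  show "smooth_on U V"
  proof (rule smooth_on_vecI[OF U])
    fix k show "smooth_on U (\<lambda>x. V x $ k)"
      using smooth_on_component[OF U z, of "Some k"] by (simp add: z_def)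
  qed
  show "smooth_on U s"
    using smooth_on_minus[OF U smooth_on_component[OF U z, of None]] by (simp add: z_def)
qed

section \<open>Charts and tangent spaces\<close>

definition covector_on :: "'v::real_vector set \<Rightarrow> ('v \<Rightarrow> real) \<Rightarrow> bool" where
  "covector_on T B \<longleftrightarrow> (\<forall>u\<in>T. \<forall>v\<in>T. B (u + v) = B u + B v) \<and> (\<forall>a. \<forall>u\<in>T. B (a *\<^sub>R u) = a * B u)"

definition covec_comp ::
    "('m, 'n::finite) chart set \<Rightarrow> ('m, 'n) chart \<Rightarrow> 'm \<Rightarrow> (('m, 'n) tvec \<Rightarrow> real) \<Rightarrow> real ^ 'n" where
  "covec_comp S c p B = (\<chi> \<mu>. B (coord_vec S c p (axis \<mu> 1)))"

definition smooth_covector ::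
    "('m, 'n::finite) chart set \<Rightarrow> 'm set \<Rightarrow> ('m \<Rightarrow> ('m, 'n) tvec \<Rightarrow> real) \<Rightarrow> bool" where
  "smooth_covector S U W \<longleftrightarrow> (\<forall>p\<in>U. covector_on (tangent_space S p) (W p)) \<and>
     (\<forall>c\<in>S. smooth_on (app_chart c ` (dom_chart c \<inter> U))
        (\<lambda>x. covec_comp S c (inv_chart c x) (W (inv_chart c x))))"

locale smooth_mfd =
  fixes S :: "('m::{t2_space, second_countable_topology}, 'n::finite) chart set"
  assumes S: "smooth_manifold S"
begin

abbreviation "T \<equiv> tangent_space S"

definition jac :: "('m, 'n) chart \<Rightarrow> ('m, 'n) chart \<Rightarrow> 'm \<Rightarrow> real ^ 'n \<Rightarrow> real ^ 'n" where
  "jac c d p = frechet_derivative (app_chart d \<circ> inv_chart c) (at (app_chart c p))"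

lemma is_chart: "c \<in> S \<Longrightarrow> is_chart c"
  using S by (simp add: smooth_manifold_def smooth_structure_def)

lemma open_dom: "c \<in> S \<Longrightarrow> open (dom_chart c)"
  using is_chart by (simp add: is_chart_def)

lemma open_img: "c \<in> S \<Longrightarrow> open (app_chart c ` dom_chart c)"
  using is_chart by (simp add: is_chart_def)

lemma chart_homeo:
  "c \<in> S \<Longrightarrow> homeomorphism (dom_chart c) (app_chart c ` dom_chart c) (app_chart c) (inv_chart c)"
  using is_chart by (simp add: is_chart_def)

lemma inv_app [simp]: "c \<in> S \<Longrightarrow> p \<in> dom_chart c \<Longrightarrow> inv_chart c (app_chart c p) = p"
  using chart_homeo homeomorphism_apply1 by metis

lemma app_inv: "c \<in> S \<Longrightarrow> x \<in> app_chart c ` dom_chart c \<Longrightarrow> app_chart c (inv_chart c x) = x"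
  using chart_homeo homeomorphism_apply2 by metis

lemma cont_app: "c \<in> S \<Longrightarrow> continuous_on (dom_chart c) (app_chart c)"
  using chart_homeo by (simp add: homeomorphism_def)

lemma cont_inv: "c \<in> S \<Longrightarrow> continuous_on (app_chart c ` dom_chart c) (inv_chart c)"
  using chart_homeo by (simp add: homeomorphism_def)

lemma chart_around: obtains c where "c \<in> S" "p \<in> dom_chart c"
proof -
  have "p \<in> (\<Union>c\<in>S. dom_chart c)" using S by (simp add: smooth_manifold_def smooth_structure_def)
  then show ?thesis using that by auto
qed

lemma transition_smooth:
  "c \<in> S \<Longrightarrow> d \<in> S \<Longrightarrow> smooth_on (app_chart c ` (dom_chart c \<inter> dom_chart d)) (app_chart d \<circ> inv_chart c)"
  using S by (auto simp: smooth_manifold_def smooth_structure_def smooth_transition_def)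

lemma open_app_image:
  assumes "c \<in> S" "open U" shows "open (app_chart c ` (dom_chart c \<inter> U))"
proof -
  have "app_chart c ` (dom_chart c \<inter> U) = app_chart c ` dom_chart c \<inter> inv_chart c -` U"
    using assms by auto
  then show ?thesis
    using continuous_open_preimage[OF cont_inv open_img] assms by simp
qed

lemma open_app_vimage:
  "c \<in> S \<Longrightarrow> open N \<Longrightarrow> open (dom_chart c \<inter> app_chart c -` N)"
  by (rule continuous_open_preimage[OF cont_app open_dom])

lemma jac_has_derivative:
  assumes "c \<in> S" "d \<in> S" "p \<in> dom_chart c" "p \<in> dom_chart d"
  shows "((app_chart d \<circ> inv_chart c) has_derivative jac c d p) (at (app_chart c p))"
  unfolding jac_def by (rule smooth_on_has_derivative[OF transition_smooth]) (use assms in auto)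

lemma jac_linear: "c \<in> S \<Longrightarrow> d \<in> S \<Longrightarrow> p \<in> dom_chart c \<Longrightarrow> p \<in> dom_chart d \<Longrightarrow> linear (jac c d p)"
  using has_derivative_linear[OF jac_has_derivative] .

lemma change_chart_has_derivative:
  assumes "c \<in> S" "d \<in> S" "p \<in> dom_chart c" "p \<in> dom_chart d"
    and "((f \<circ> inv_chart d) has_derivative f') (at (app_chart d p))"
  shows "((f \<circ> inv_chart c) has_derivative (f' \<circ> jac c d p)) (at (app_chart c p))"
proof -
  have "((f \<circ> inv_chart d) has_derivative f') (at ((app_chart d \<circ> inv_chart c) (app_chart c p)))"
    using assms by simp
  from diff_chain_at[OF jac_has_derivative[OF assms(1-4)] this]
  have "((f \<circ> inv_chart d \<circ> (app_chart d \<circ> inv_chart c)) has_derivative (f' \<circ> jac c d p)) (at (app_chart c p))" .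
  then show ?thesis
    by (rule has_derivative_transform_within_open[of _ _ _ _ "app_chart c ` (dom_chart c \<inter> dom_chart d)"])
      (use assms open_app_image[OF assms(1) open_dom[OF assms(2)]] in auto)
qed

text \<open>The cocycle identity of the Jacobians; it is what makes the families
  \<open>coord_vec S c p x\<close> tangent vectors.\<close>

lemma jac_comp:
  assumes "c \<in> S" "d \<in> S" "e \<in> S" "p \<in> dom_chart c" "p \<in> dom_chart d" "p \<in> dom_chart e"
  shows "jac d e p (jac c d p x) = jac c e p x"
proof -
  have "((app_chart e \<circ> inv_chart c) has_derivative (jac d e p \<circ> jac c d p)) (at (app_chart c p))"
    by (rule change_chart_has_derivative) (use assms jac_has_derivative in auto)
  then have "jac d e p \<circ> jac c d p = jac c e p"
    using jac_has_derivative[OF assms(1,3,4,6)] has_derivative_unique by blast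
  then show ?thesis by (metis comp_apply)
qed

lemma jac_self: assumes "c \<in> S" "p \<in> dom_chart c" shows "jac c c p x = x"
proof -
  have "((\<lambda>x. x) has_derivative (\<lambda>x. x)) (at (app_chart c p))" by simp
  then have "((app_chart c \<circ> inv_chart c) has_derivative (\<lambda>x. x)) (at (app_chart c p))"
    by (rule has_derivative_transform_within_open[of _ _ _ _ "app_chart c ` dom_chart c"])
      (use assms open_img app_inv in auto)
  then show ?thesis
    using jac_has_derivative[OF assms(1,1,2,2)] has_derivative_unique by metis
qed

lemma tangent_space_alt:
  "T p = {w. (\<forall>c\<in>S. \<forall>d\<in>S. p \<in> dom_chart c \<longrightarrow> p \<in> dom_chart d \<longrightarrow> w d = jac c d p (w c)) \<and>
     (\<forall>d. \<not> (d \<in> S \<and> p \<in> dom_chart d) \<longrightarrow> w d = 0)}"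
  by (simp add: tangent_space_def jac_def)

lemma coord_vec_alt:
  "coord_vec S c p x = (\<lambda>d. if d \<in> S \<and> p \<in> dom_chart d then jac c d p x else 0)"
  by (simp add: coord_vec_def jac_def cong: if_cong)

lemma tangent_spaceI:
  assumes "\<And>c d. c \<in> S \<Longrightarrow> d \<in> S \<Longrightarrow> p \<in> dom_chart c \<Longrightarrow> p \<in> dom_chart d \<Longrightarrow> w d = jac c d p (w c)"
    and "\<And>d. \<not> (d \<in> S \<and> p \<in> dom_chart d) \<Longrightarrow> w d = 0"
  shows "w \<in> T p"
  using assms unfolding tangent_space_alt by blast

lemma tangent_spaceD:
  assumes "w \<in> T p"
  shows "c \<in> S \<Longrightarrow> d \<in> S \<Longrightarrow> p \<in> dom_chart c \<Longrightarrow> p \<in> dom_chart d \<Longrightarrow> w d = jac c d p (w c)"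
    and "\<not> (d \<in> S \<and> p \<in> dom_chart d) \<Longrightarrow> w d = 0"
  using assms unfolding tangent_space_alt by blast+

lemma subspace_T: "subspace (T p)"
proof (rule subspaceI)
  show "0 \<in> T p"
    by (rule tangent_spaceI) (simp_all add: linear_0[OF jac_linear])
  show "x + y \<in> T p" if x: "x \<in> T p" and y: "y \<in> T p" for x y
  proof (rule tangent_spaceI)
    fix c d assume cd: "c \<in> S" "d \<in> S" "p \<in> dom_chart c" "p \<in> dom_chart d"
    show "(x + y) d = jac c d p ((x + y) c)"
      using tangent_spaceD(1)[OF x cd] tangent_spaceD(1)[OF y cd] linear_add[OF jac_linear[OF cd]] by simp
  qed (simp add: tangent_spaceD(2)[OF x] tangent_spaceD(2)[OF y])
  show "a *\<^sub>R x \<in> T p" if x: "x \<in> T p" for a x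
  proof (rule tangent_spaceI)
    fix c d assume cd: "c \<in> S" "d \<in> S" "p \<in> dom_chart c" "p \<in> dom_chart d"
    show "(a *\<^sub>R x) d = jac c d p ((a *\<^sub>R x) c)"
      using tangent_spaceD(1)[OF x cd] linear_scale[OF jac_linear[OF cd]] by (simp add: scaleR_fun_def)
  qed (simp add: tangent_spaceD(2)[OF x] scaleR_fun_def)
qed

lemma coord_vec_T: "c \<in> S \<Longrightarrow> p \<in> dom_chart c \<Longrightarrow> coord_vec S c p x \<in> T p"
  by (rule tangent_spaceI) (auto simp: coord_vec_alt jac_comp)

lemma coord_vec_app [simp]: "c \<in> S \<Longrightarrow> p \<in> dom_chart c \<Longrightarrow> coord_vec S c p x c = x"
  by (simp add: coord_vec_alt jac_self)

lemma coord_vec_of_T: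
  assumes "c \<in> S" "p \<in> dom_chart c" "v \<in> T p"
  shows "coord_vec S c p (v c) = v"
proof
  fix d
  show "coord_vec S c p (v c) d = v d"
    using tangent_spaceD(1)[OF assms(3,1) _ assms(2), of d] tangent_spaceD(2)[OF assms(3), of d]
    by (cases "d \<in> S \<and> p \<in> dom_chart d") (auto simp: coord_vec_alt)
qed

lemma coord_vec_add:
  assumes "c \<in> S" "p \<in> dom_chart c"
  shows "coord_vec S c p (x + y) = coord_vec S c p x + coord_vec S c p y"
proof
  fix d show "coord_vec S c p (x + y) d = (coord_vec S c p x + coord_vec S c p y) d"
    using linear_add[OF jac_linear[OF assms(1) _ assms(2)], of d] by (simp add: coord_vec_alt)
qed

lemma coord_vec_scale:
  assumes "c \<in> S" "p \<in> dom_chart c"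
  shows "coord_vec S c p (a *\<^sub>R x) = a *\<^sub>R coord_vec S c p x"
proof
  fix d show "coord_vec S c p (a *\<^sub>R x) d = (a *\<^sub>R coord_vec S c p x) d"
    using linear_scale[OF jac_linear[OF assms(1) _ assms(2)], of d] by (simp add: coord_vec_alt scaleR_fun_def)
qed

lemma coord_vec_linear: "c \<in> S \<Longrightarrow> p \<in> dom_chart c \<Longrightarrow> linear (coord_vec S c p)"
  by (rule linearI) (auto simp: coord_vec_add coord_vec_scale)

lemma T_eq_0_iff: "c \<in> S \<Longrightarrow> p \<in> dom_chart c \<Longrightarrow> v \<in> T p \<Longrightarrow> v = 0 \<longleftrightarrow> v c = 0"
  by (metis coord_vec_of_T coord_vec_linear linear_0 zero_fun_apply)

lemma T_basis_expansion:
  assumes "c \<in> S" "p \<in> dom_chart c" "v \<in> T p"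
  shows "v = (\<Sum>\<mu>\<in>UNIV. (v c $ \<mu>) *\<^sub>R coord_vec S c p (axis \<mu> 1))"
proof -
  have "v = coord_vec S c p (\<Sum>\<mu>\<in>UNIV. (v c $ \<mu>) *\<^sub>R axis \<mu> 1)"
    using basis_expansion[of "v c"] coord_vec_of_T[OF assms] by (simp add: scalar_mult_eq_scaleR)
  then show ?thesis
    using assms by (simp add: linear_sum[OF coord_vec_linear] coord_vec_scale)
qed

lemma T_span:
  assumes "c \<in> S" "p \<in> dom_chart c"
  shows "span (range (\<lambda>\<mu>. coord_vec S c p (axis \<mu> 1))) = T p"
proof (rule equalityI)
  show "span (range (\<lambda>\<mu>. coord_vec S c p (axis \<mu> 1))) \<subseteq> T p"
    using coord_vec_T[OF assms] by (intro span_minimal[OF _ subspace_T] image_subsetI)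
  show "T p \<subseteq> span (range (\<lambda>\<mu>. coord_vec S c p (axis \<mu> 1)))"
    using T_basis_expansion[OF assms]
    by (metis (no_types, lifting) rangeI span_base span_scale span_sum subsetI)
qed

lemma covector_comp:
  assumes "covector_on (T p) B" "c \<in> S" "p \<in> dom_chart c" "v \<in> T p"
  shows "B v = covec_comp S c p B \<bullet> v c"
proof -
  have s: "B (\<Sum>i\<in>I. f i) = (\<Sum>i\<in>I. B (f i))" if "finite I" "\<And>i. i \<in> I \<Longrightarrow> f i \<in> T p" for I :: "'n set" and f
    using that
  proof (induction I)
    case empty
    then show ?case using assms(1) subspace_0[OF subspace_T] unfolding covector_on_def
      by (metis add_cancel_right_right add_0 sum.empty)
  next
    case (insert i I)
    then have "f i \<in> T p" "(\<Sum>i\<in>I. f i) \<in> T p" by (auto intro: subspace_sum[OF subspace_T])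
    then have "B (f i + (\<Sum>i\<in>I. f i)) = B (f i) + B (\<Sum>i\<in>I. f i)"
      using assms(1) unfolding covector_on_def by blast
    moreover have "B (\<Sum>i\<in>I. f i) = (\<Sum>i\<in>I. B (f i))" using insert by simp
    ultimately show ?case by (simp only: sum.insert[OF insert.hyps])
  qed
  have t: "coord_vec S c p (axis \<mu> 1) \<in> T p" for \<mu> using assms coord_vec_T by blast
  have "B v = B (\<Sum>\<mu>\<in>UNIV. (v c $ \<mu>) *\<^sub>R coord_vec S c p (axis \<mu> 1))"
    using T_basis_expansion[OF assms(2-4)] by simp
  also have "\<dots> = (\<Sum>\<mu>\<in>UNIV. B ((v c $ \<mu>) *\<^sub>R coord_vec S c p (axis \<mu> 1)))"
    by (rule s) (auto intro: subspace_scale[OF subspace_T] t)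
  also have "\<dots> = (\<Sum>\<mu>\<in>UNIV. (v c $ \<mu>) * B (coord_vec S c p (axis \<mu> 1)))"
    using assms(1) t by (intro sum.cong refl) (auto simp: covector_on_def)
  finally show ?thesis by (simp add: covec_comp_def inner_vec_def mult.commute)
qed

lemma covector_minus: "covector_on (T p) B \<Longrightarrow> v \<in> T p \<Longrightarrow> B (- v) = - B v"
  unfolding covector_on_def by (metis scaleR_minus1_left mult_minus1)

lemma tensor_comp_form:
  assumes "sym_bilinear_on (T p) (g p)" "c \<in> S" "p \<in> dom_chart c" "u \<in> T p" "v \<in> T p"
  shows "g p u v = u c \<bullet> (tensor_comp S g c p *v v c)"
proof -
  interpret sym_form "T p" "g p" using assms(1) subspace_T by unfold_locales
  let ?e = "\<lambda>\<mu>. coord_vec S c p (axis \<mu> 1)"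
  have t: "?e \<mu> \<in> T p" "a *\<^sub>R ?e \<mu> \<in> T p" for \<mu> a
    using assms coord_vec_T subspace_scale[OF subspace_T] by blast+
  have "g p u v = g p (\<Sum>\<mu>\<in>UNIV. (u c $ \<mu>) *\<^sub>R ?e \<mu>) v"
    using T_basis_expansion[OF assms(2-4)] by simp
  also have "\<dots> = (\<Sum>\<mu>\<in>UNIV. (u c $ \<mu>) * g p (?e \<mu>) v)"
    using t assms(5) by (simp add: sum_left scale_left)
  finally have 1: "g p u v = (\<Sum>\<mu>\<in>UNIV. (u c $ \<mu>) * g p (?e \<mu>) v)" .
  have "g p (?e \<mu>) v = (\<Sum>\<nu>\<in>UNIV. (v c $ \<nu>) * g p (?e \<mu>) (?e \<nu>))" for \<mu>
  proof -
    have "g p (?e \<mu>) v = g p (?e \<mu>) (\<Sum>\<nu>\<in>UNIV. (v c $ \<nu>) *\<^sub>R ?e \<nu>)"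
      using T_basis_expansion[OF assms(2,3,5)] by simp
    then show ?thesis using t by (simp add: sum_right scale_right)
  qed
  with 1 show ?thesis
    by (simp add: inner_vec_def matrix_vector_mult_def tensor_comp_def mult.commute)
qed

lemma tensor_comp_sym:
  assumes "sym_bilinear_on (T p) (g p)" "c \<in> S" "p \<in> dom_chart c"
  shows "transpose (tensor_comp S g c p) = tensor_comp S g c p"
  using assms coord_vec_T[OF assms(2,3)]
  by (auto simp: vec_eq_iff transpose_def tensor_comp_def sym_bilinear_on_def)

lemma differential_chart:
  assumes "c \<in> S" "p \<in> dom_chart c" "(f \<circ> inv_chart c) differentiable (at (app_chart c p))" "v \<in> T p"
  shows "differential S f p v = frechet_derivative (f \<circ> inv_chart c) (at (app_chart c p)) (v c)"
proof -
  define d where "d = (SOME c. c \<in> S \<and> p \<in> dom_chart c)"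
  have d: "d \<in> S" "p \<in> dom_chart d"
    using someI[of "\<lambda>c. c \<in> S \<and> p \<in> dom_chart c" c] assms by (auto simp: d_def)
  have "((f \<circ> inv_chart d) has_derivative
      (frechet_derivative (f \<circ> inv_chart c) (at (app_chart c p)) \<circ> jac d c p)) (at (app_chart d p))"
    by (rule change_chart_has_derivative[OF d(1) assms(1) d(2) assms(2)])
      (rule frechet_derivative_has_derivative[OF assms(3)])
  from frechet_derivative_at[OF this]
  have "frechet_derivative (f \<circ> inv_chart d) (at (app_chart d p)) (v d)
      = frechet_derivative (f \<circ> inv_chart c) (at (app_chart c p)) (jac d c p (v d))"
    by (metis comp_apply)
  also have "jac d c p (v d) = v c"
    using tangent_spaceD(1)[OF assms(4) d(1) assms(1) d(2) assms(2)] by simp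
  finally show ?thesis unfolding differential_def d_def Let_def .
qed

lemma differential_covector:
  assumes "c \<in> S" "p \<in> dom_chart c" "(f \<circ> inv_chart c) differentiable (at (app_chart c p))"
  shows "covector_on (T p) (differential S f p)"
  unfolding covector_on_def
  using differential_chart[OF assms] subspace_add[OF subspace_T] subspace_scale[OF subspace_T]
    linear_add[OF linear_frechet_derivative[OF assms(3)]] linear_scale[OF linear_frechet_derivative[OF assms(3)]]
  by (auto simp: scaleR_fun_def)

section \<open>Smoothness on the manifold\<close>

lemma smooth_functionD: "smooth_function S f \<Longrightarrow> c \<in> S \<Longrightarrow> smooth_on (app_chart c ` dom_chart c) (f \<circ> inv_chart c)"
  by (simp add: smooth_function_def)

lemma smooth_function_local:
  assumes "\<And>p c. c \<in> S \<Longrightarrow> p \<in> dom_chart c \<Longrightarrow> \<exists>N h. open N \<and> p \<in> N \<and>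
     smooth_on (app_chart c ` (dom_chart c \<inter> N)) h \<and> (\<forall>q\<in>dom_chart c \<inter> N. f q = h (app_chart c q))"
  shows "smooth_function S f"
  unfolding smooth_function_def
proof (intro ballI smooth_on_local)
  fix c x assume c: "c \<in> S" and "x \<in> app_chart c ` dom_chart c"
  then obtain p where p: "p \<in> dom_chart c" "x = app_chart c p" by auto
  obtain N h where N: "open N" "p \<in> N" "smooth_on (app_chart c ` (dom_chart c \<inter> N)) h"
    "\<And>q. q \<in> dom_chart c \<inter> N \<Longrightarrow> f q = h (app_chart c q)"
    using assms[OF c p(1)] by blast
  have o: "open (app_chart c ` (dom_chart c \<inter> N))" by (rule open_app_image[OF c N(1)])
  have e: "(f \<circ> inv_chart c) y = h y" if "y \<in> app_chart c ` (dom_chart c \<inter> N)" for y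
    using that N(4) c by auto
  have "smooth_on (app_chart c ` (dom_chart c \<inter> N)) (f \<circ> inv_chart c)"
    using N(3) by (simp only: smooth_on_cong[OF o e])
  then show "\<exists>N. open N \<and> x \<in> N \<and> smooth_on N (f \<circ> inv_chart c)" using o p N(2) by blast
qed

text \<open>Extension by zero: the open sets \<open>dom_chart c\<close> and \<open>- K\<close> cover
  the manifold, and on the second the function is zero. \<open>K\<close> has to be closed in the
  whole manifold, not just in the chart domain.\<close>

lemma smooth_function_comp_chart:
  assumes "c \<in> S" "smooth_on UNIV \<phi>" "K \<subseteq> dom_chart c" "closed K" "\<And>q. q \<in> dom_chart c - K \<Longrightarrow> \<phi> (app_chart c q) = 0"
  shows "smooth_function S (\<lambda>q. if q \<in> dom_chart c then \<phi> (app_chart c q) else 0)"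
proof (rule smooth_function_local)
  fix p d assume d: "d \<in> S" "p \<in> dom_chart d"
  let ?f = "\<lambda>q. if q \<in> dom_chart c then \<phi> (app_chart c q) else 0"
  show "\<exists>N h. open N \<and> p \<in> N \<and> smooth_on (app_chart d ` (dom_chart d \<inter> N)) h \<and>
      (\<forall>q\<in>dom_chart d \<inter> N. ?f q = h (app_chart d q))"
  proof (cases "p \<in> dom_chart c")
    case True
    show ?thesis
    proof (intro exI conjI)
      show "open (dom_chart c)" using assms open_dom by blast
      show "smooth_on (app_chart d ` (dom_chart d \<inter> dom_chart c)) (\<lambda>x. \<phi> ((app_chart c \<circ> inv_chart d) x))"
        by (rule smooth_on_compose[OF _ open_UNIV _ transition_smooth[OF d(1) assms(1)] assms(2)])
          (use open_app_image[OF d(1) open_dom[OF assms(1)]] in auto)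
    qed (use True d in auto)
  next
    case False
    show ?thesis
    proof (intro exI conjI)
      show "open (- K)" using assms by auto
      show "smooth_on (app_chart d ` (dom_chart d \<inter> - K)) (\<lambda>x. 0)"
        by (rule smooth_on_const) (use open_app_image[OF d(1)] assms in auto)
    qed (use False assms in auto)
  qed
qed

lemma bump_at:
  assumes "open U" "p \<in> U"
  obtains \<phi> N K where "smooth_function S \<phi>" "open N" "p \<in> N" "closed K" "K \<subseteq> U"
    "\<And>q. q \<in> N \<Longrightarrow> \<phi> q = 1" "\<And>q. q \<notin> K \<Longrightarrow> \<phi> q = 0" "\<And>q. 0 \<le> \<phi> q" "\<And>q. \<phi> q \<le> 1"
proof -
  obtain c where c: "c \<in> S" "p \<in> dom_chart c" by (rule chart_around)
  let ?a = "app_chart c p"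
  have "open (app_chart c ` (dom_chart c \<inter> U))" by (rule open_app_image[OF c(1) assms(1)])
  moreover have "?a \<in> app_chart c ` (dom_chart c \<inter> U)" using c assms by auto
  ultimately obtain r where r: "r > 0" "cball ?a r \<subseteq> app_chart c ` (dom_chart c \<inter> U)"
    unfolding open_contains_cball by blast
  obtain \<phi> :: "real ^ 'n \<Rightarrow> real" where \<phi>: "smooth_on UNIV \<phi>" "\<And>x. dist x ?a < r / 2 \<Longrightarrow> \<phi> x = 1"
    "\<And>x. dist x ?a \<ge> 3 / 4 * r \<Longrightarrow> \<phi> x = 0" "\<And>x. 0 \<le> \<phi> x" "\<And>x. \<phi> x \<le> 1"
    using smooth_bump_exists[OF r(1), of ?a] by metis
  define K where "K = inv_chart c ` cball ?a (3 / 4 * r)"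
  have sub: "cball ?a (3 / 4 * r) \<subseteq> app_chart c ` (dom_chart c \<inter> U)"
    using r subset_cball[of "3 / 4 * r" r ?a] by auto
  \<comment> \<open>Compactness matters because it gives closedness in the whole manifold, which is
    Hausdorff.\<close>
  then have "compact K"
    unfolding K_def using c
    by (intro compact_continuous_image[OF continuous_on_subset[OF cont_inv]]) auto
  then have K: "closed K" by (rule compact_imp_closed)
  have KU: "K \<subseteq> dom_chart c \<inter> U"
  proof
    fix q assume "q \<in> K"
    then obtain x where "x \<in> cball ?a (3 / 4 * r)" "q = inv_chart c x" by (auto simp: K_def)
    then show "q \<in> dom_chart c \<inter> U" using sub c by auto
  qed
  have off: "\<phi> (app_chart c q) = 0" if "q \<in> dom_chart c - K" for q
  proof (rule \<phi>(3), rule ccontr)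
    assume "\<not> 3 / 4 * r \<le> dist (app_chart c q) ?a"
    then have "app_chart c q \<in> cball ?a (3 / 4 * r)" by (simp add: dist_commute)
    then have "inv_chart c (app_chart c q) \<in> K" unfolding K_def by (rule imageI)
    then show False using that c by simp
  qed
  show ?thesis
  proof (rule that[of "\<lambda>q. if q \<in> dom_chart c then \<phi> (app_chart c q) else 0"
        "dom_chart c \<inter> app_chart c -` ball ?a (r / 2)" K])
    show "smooth_function S (\<lambda>q. if q \<in> dom_chart c then \<phi> (app_chart c q) else 0)"
      by (rule smooth_function_comp_chart[OF c(1) \<phi>(1) _ K off]) (use KU in auto)
    show "open (dom_chart c \<inter> app_chart c -` ball ?a (r / 2))"
      by (rule open_app_vimage[OF c(1) open_ball])
  qed (use c r K KU off \<phi> in \<open>auto simp: dist_commute\<close>)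
qed

lemma smooth_function_mult: "smooth_function S f \<Longrightarrow> smooth_function S g \<Longrightarrow> smooth_function S (\<lambda>p. f p * g p)"
  unfolding smooth_function_def o_def by (intro ballI smooth_on_mult open_img) auto

lemma smooth_function_one_minus: "smooth_function S f \<Longrightarrow> smooth_function S (\<lambda>p. 1 - f p)"
  unfolding smooth_function_def o_def by (intro ballI smooth_on_diff open_img smooth_on_const) auto

lemma smooth_function_prod:
  "finite I \<Longrightarrow> (\<And>i. i \<in> I \<Longrightarrow> smooth_function S (f i)) \<Longrightarrow> smooth_function S (\<lambda>p. \<Prod>i\<in>I. f i p)"
  unfolding smooth_function_def o_def by (intro ballI smooth_on_prod open_img) auto

text \<open>A partition of unity up to normalisation. Since the sets \<open>\<phi>\<^sub>i = 1\<close> already cover, the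
  functions \<open>\<phi>\<^sub>i \<cdot> \<Prod>j<i. (1 - \<phi>\<^sub>j)\<close> are locally finite without any refinement of the cover.\<close>

lemma bump_family:
  assumes U: "\<And>p. open (U p)" "\<And>p. p \<in> U p"
  obtains \<psi> :: "nat \<Rightarrow> 'm \<Rightarrow> real" and K and a :: "nat \<Rightarrow> 'm" where
    "\<And>i. smooth_function S (\<psi> i)" "\<And>i p. 0 \<le> \<psi> i p" "\<And>i. closed (K i)" "\<And>i. K i \<subseteq> U (a i)"
    "\<And>i p. p \<notin> K i \<Longrightarrow> \<psi> i p = 0" "\<And>p. \<exists>i. \<psi> i p > 0"
    "\<And>p. \<exists>N k. open N \<and> p \<in> N \<and> (\<forall>j\<ge>k. \<forall>q\<in>N. \<psi> j q = 0)"
proof -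
  have "\<forall>p. \<exists>\<phi> N K. smooth_function S \<phi> \<and> open N \<and> p \<in> N \<and> closed K \<and> K \<subseteq> U p \<and>
    (\<forall>q\<in>N. \<phi> q = 1) \<and> (\<forall>q. q \<notin> K \<longrightarrow> \<phi> q = 0) \<and> (\<forall>q. 0 \<le> \<phi> q) \<and> (\<forall>q. \<phi> q \<le> 1)"
  proof
    fix p
    show "\<exists>\<phi> N K. smooth_function S \<phi> \<and> open N \<and> p \<in> N \<and> closed K \<and> K \<subseteq> U p \<and>
      (\<forall>q\<in>N. \<phi> q = 1) \<and> (\<forall>q. q \<notin> K \<longrightarrow> \<phi> q = 0) \<and> (\<forall>q. 0 \<le> \<phi> q) \<and> (\<forall>q. \<phi> q \<le> 1)"
      by (rule bump_at[OF U(1)[of p] U(2)]) blast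
  qed
  then obtain \<phi> N K where \<phi>: "\<And>p. smooth_function S (\<phi> p)" "\<And>p. open (N p)" "\<And>p. p \<in> N p"
    "\<And>p. closed (K p)" "\<And>p. K p \<subseteq> U p" "\<And>p q. q \<in> N p \<Longrightarrow> \<phi> p q = 1"
    "\<And>p q. q \<notin> K p \<Longrightarrow> \<phi> p q = 0" "\<And>p q. 0 \<le> \<phi> p q" "\<And>p q. \<phi> p q \<le> 1"
    unfolding choice_iff by blast
  obtain \<F> where \<F>: "\<F> \<subseteq> range N" "countable \<F>" "\<Union>\<F> = \<Union>(range N)"
    using Lindelof[of "range N"] \<phi>(2) by blast
  obtain P where P: "countable P" "\<F> = N ` P"
    using \<F>(1,2) countable_subset_image[of \<F> N UNIV] by auto
  have cov: "\<exists>p\<in>P. q \<in> N p" for q using \<F>(3) P(2) \<phi>(3) by blast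
  then have "P \<noteq> {}" by blast
  define a where "a = from_nat_into P"
  have ra: "range a = P" unfolding a_def by (rule range_from_nat_into[OF \<open>P \<noteq> {}\<close> P(1)])
  have cov': "\<exists>i. q \<in> N (a i)" for q using cov[of q] ra by (metis imageE)
  define \<psi> where "\<psi> = (\<lambda>i p. \<phi> (a i) p * (\<Prod>j<i. 1 - \<phi> (a j) p))"
  show ?thesis
  proof (rule that[of \<psi> "\<lambda>i. K (a i)" a])
    show "smooth_function S (\<psi> i)" for i
      unfolding \<psi>_def by (intro smooth_function_mult smooth_function_prod smooth_function_one_minus \<phi>(1)) auto
    show "0 \<le> \<psi> i p" for i p
      unfolding \<psi>_def by (intro mult_nonneg_nonneg prod_nonneg) (auto simp: \<phi>)
    show "\<exists>i. \<psi> i p > 0" for p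
    proof -
      \<comment> \<open>For the least index with value 1 all earlier factors
        \<open>1 - \<phi> (a j) p\<close> are still positive.\<close>
      define i where "i = (LEAST i. \<phi> (a i) p = 1)"
      have ex: "\<exists>i. \<phi> (a i) p = 1" using cov'[of p] \<phi>(6) by blast
      then have i: "\<phi> (a i) p = 1" unfolding i_def by (rule LeastI_ex)
      have "\<phi> (a j) p < 1" if "j < i" for j
        using not_less_Least[of j "\<lambda>i. \<phi> (a i) p = 1"] that \<phi>(9)[of "a j" p] unfolding i_def
        by linarith
      then have "(\<Prod>j<i. 1 - \<phi> (a j) p) > 0" by (intro prod_pos) auto
      then show ?thesis using i by (auto simp: \<psi>_def intro!: exI[of _ i])
    qed
    show "\<exists>N k. open N \<and> p \<in> N \<and> (\<forall>j\<ge>k. \<forall>q\<in>N. \<psi> j q = 0)" for p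
    proof -
      obtain i where i: "p \<in> N (a i)" using cov' by blast
      have "\<psi> j q = 0" if "j \<ge> Suc i" "q \<in> N (a i)" for j q
        unfolding \<psi>_def using that \<phi>(6)[of q "a i"] by (auto intro!: prod_zero bexI[of _ i])
      then show ?thesis using i \<phi>(2) by blast
    qed
  qed (use \<phi> in \<open>auto simp: \<psi>_def\<close>)
qed

section \<open>Smooth covector fields\<close>

lemma smooth_covectorD:
  "smooth_covector S U W \<Longrightarrow> p \<in> U \<Longrightarrow> covector_on (T p) (W p)"
  by (simp add: smooth_covector_def)

lemma smooth_covector_comp:
  "smooth_covector S U W \<Longrightarrow> c \<in> S \<Longrightarrow> smooth_on (app_chart c ` (dom_chart c \<inter> U))
        (\<lambda>x. covec_comp S c (inv_chart c x) (W (inv_chart c x)))"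
  by (simp add: smooth_covector_def)

lemma smooth_covector_subset: "smooth_covector S U W \<Longrightarrow> V \<subseteq> U \<Longrightarrow> smooth_covector S V W"
  unfolding smooth_covector_def
proof (intro conjI ballI, goal_cases)
  case (2 c)
  then have "smooth_on (app_chart c ` (dom_chart c \<inter> U)) (\<lambda>x. covec_comp S c (inv_chart c x) (W (inv_chart c x)))"
    by blast
  then show ?case by (rule smooth_on_subset) (use 2 in blast)
qed blast

lemma smooth_covector_sum:
  assumes "open U" "finite I" "\<And>i. i \<in> I \<Longrightarrow> smooth_function S (f i)" "\<And>i. i \<in> I \<Longrightarrow> smooth_covector S U (W i)"
  shows "smooth_covector S U (\<lambda>q v. \<Sum>i\<in>I. f i q * W i q v)"
  unfolding smooth_covector_def
proof (intro conjI ballI)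
  fix p assume "p \<in> U"
  then have "covector_on (T p) (W i p)" if "i \<in> I" for i using assms(4) that smooth_covectorD by blast
  then show "covector_on (T p) (\<lambda>v. \<Sum>i\<in>I. f i p * W i p v)"
    by (auto simp: covector_on_def sum.distrib sum_distrib_left algebra_simps cong: sum.cong)
next
  fix c assume c: "c \<in> S"
  let ?O = "app_chart c ` (dom_chart c \<inter> U)"
  have o: "open ?O" by (rule open_app_image[OF c assms(1)])
  have "smooth_on ?O (\<lambda>x. \<Sum>i\<in>I. (f i \<circ> inv_chart c) x *\<^sub>R covec_comp S c (inv_chart c x) (W i (inv_chart c x)))"
    by (intro smooth_on_sum smooth_on_scaleR o smooth_on_subset[OF smooth_functionD[OF assms(3) c]]
        smooth_covector_comp[OF assms(4) c]) auto
  then show "smooth_on ?O (\<lambda>x. covec_comp S c (inv_chart c x) (\<lambda>v. \<Sum>i\<in>I. f i (inv_chart c x) * W i (inv_chart c x) v))"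
  proof (rule iffD1[OF smooth_on_cong[OF o], rotated])
    fix x
    show "(\<Sum>i\<in>I. (f i \<circ> inv_chart c) x *\<^sub>R covec_comp S c (inv_chart c x) (W i (inv_chart c x)))
       = covec_comp S c (inv_chart c x) (\<lambda>v. \<Sum>i\<in>I. f i (inv_chart c x) * W i (inv_chart c x) v)"
      by (simp add: vec_eq_iff covec_comp_def)
  qed
qed

text \<open>A covector field may be prescribed by its components in one chart: in another chart they
  are multiplied by the Jacobian of the transition map, whose columns are derivatives of a smooth
  map in fixed directions.\<close>

lemma smooth_covector_chart:
  assumes c: "c \<in> S" and U: "open U" "U \<subseteq> dom_chart c" and \<phi>: "smooth_on (app_chart c ` U) \<phi>"
  shows "smooth_covector S U (\<lambda>p v. \<phi> (app_chart c p) \<bullet> v c)"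
  unfolding smooth_covector_def
proof (intro conjI ballI)
  show "covector_on (T p) (\<lambda>v. \<phi> (app_chart c p) \<bullet> v c)" for p
    by (auto simp: covector_on_def inner_add_right scaleR_fun_def)
next
  fix d assume d: "d \<in> S"
  let ?O = "app_chart d ` (dom_chart d \<inter> U)" and ?t = "app_chart c \<circ> inv_chart d"
  have o: "open ?O" by (rule open_app_image[OF d U(1)])
  have ocU: "open (app_chart c ` U)" using open_app_image[OF c U(1)] U(2) by (simp add: Int_absorb1)
  have t: "smooth_on ?O ?t" by (rule smooth_on_subset[OF transition_smooth[OF d c]]) (use U in auto)
  have im: "?t ` ?O \<subseteq> app_chart c ` U" using d by auto
  have "smooth_on ?O (\<lambda>x. covec_comp S d (inv_chart d x) (\<lambda>v. \<phi> (app_chart c (inv_chart d x)) \<bullet> v c) $ \<mu>)" for \<mu>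
  proof -
    have "smooth_on ?O (\<lambda>x. \<phi> (?t x) \<bullet> frechet_derivative ?t (at x) (axis \<mu> 1))"
      by (intro smooth_on_inner o smooth_on_compose[OF o ocU im t \<phi>] smooth_on_frechet_derivative t)
    then show ?thesis
    proof (rule iffD1[OF smooth_on_cong[OF o], rotated])
      fix x assume "x \<in> ?O"
      then have "inv_chart d x \<in> dom_chart d \<inter> U" "app_chart d (inv_chart d x) = x" using d by auto
      then show "\<phi> (?t x) \<bullet> frechet_derivative ?t (at x) (axis \<mu> 1)
        = covec_comp S d (inv_chart d x) (\<lambda>v. \<phi> (app_chart c (inv_chart d x)) \<bullet> v c) $ \<mu>"
        using U c by (auto simp: covec_comp_def coord_vec_def)
    qed
  qed
  then show "smooth_on ?O (\<lambda>x. covec_comp S d (inv_chart d x) (\<lambda>v. \<phi> (app_chart c (inv_chart d x)) \<bullet> v c))"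
    by (intro smooth_on_vecI o)
qed

lemma smooth_covector_scale:
  assumes "open U" "smooth_covector S U W"
  shows "smooth_covector S U (\<lambda>q v. a * W q v)"
proof -
  have "smooth_function S (\<lambda>q. a)"
    unfolding smooth_function_def o_def by (intro ballI smooth_on_const open_img)
  then show ?thesis
    using smooth_covector_sum[OF assms(1), of "{()}" "\<lambda>_ q. a" "\<lambda>_. W"] assms(2) by simp
qed

section \<open>Gluing covector fields up to sign\<close>

text \<open>Two admissible covectors agree or disagree in sign on all of \<open>Z\<close>. After a choice of signs at
  each point, admissible covectors therefore form a convex cone, and the choice is locally constant.\<close>

lemma glue_covectors:
  fixes Z Y :: "'m \<Rightarrow> ('m, 'n) tvec set"
  defines "adm \<equiv> \<lambda>p B. covector_on (T p) B \<and> (\<forall>v\<in>Z p. B v \<noteq> 0) \<and> (\<forall>v\<in>Y p. B v = 0)"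
  assumes ne: "\<And>p. Z p \<noteq> {}"
    and loc: "\<And>p. \<exists>U W. open U \<and> p \<in> U \<and> smooth_covector S U W \<and> (\<forall>q\<in>U. adm q (W q))"
    and dich: "\<And>p B B'. adm p B \<Longrightarrow> adm p B' \<Longrightarrow>
       (\<forall>v\<in>Z p. B v * B' v > 0) \<or> (\<forall>v\<in>Z p. B v * B' v < 0)"
    and opn: "\<And>p U W W'. open U \<Longrightarrow> p \<in> U \<Longrightarrow> smooth_covector S U W \<Longrightarrow> smooth_covector S U W' \<Longrightarrow>
       (\<forall>v\<in>Z p. W p v * W' p v > 0) \<Longrightarrow>
       \<exists>N. open N \<and> p \<in> N \<and> N \<subseteq> U \<and> (\<forall>q\<in>N. \<forall>v\<in>Z q. W q v * W' q v > 0)"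
  obtains B where "\<And>p. \<exists>U W. open U \<and> p \<in> U \<and> smooth_covector S U W \<and>
     (\<forall>q\<in>U. adm q (W q) \<and> (B q = W q \<or> B q = (\<lambda>v. - W q v)))"
proof -
  from loc obtain U W where U: "\<And>p. open (U p)" "\<And>p. p \<in> U p"
    and W: "\<And>p. smooth_covector S (U p) (W p)" "\<And>p q. q \<in> U p \<Longrightarrow> adm q (W p q)"
    by metis
  obtain \<psi> :: "nat \<Rightarrow> 'm \<Rightarrow> real" and K and a :: "nat \<Rightarrow> 'm" where
    \<psi>: "\<And>i. smooth_function S (\<psi> i)" "\<And>i p. 0 \<le> \<psi> i p" "\<And>i. closed (K i)" "\<And>i. K i \<subseteq> U (a i)"
    "\<And>i p. p \<notin> K i \<Longrightarrow> \<psi> i p = 0" "\<And>p. \<exists>i. \<psi> i p > 0"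
    "\<And>p. \<exists>N k. open N \<and> p \<in> N \<and> (\<forall>j\<ge>k. \<forall>q\<in>N. \<psi> j q = 0)"
    by (rule bump_family[OF U]) (rule that)
  \<comment> \<open>The index \<open>r p\<close> serves as sign reference at \<open>p\<close>. It
    may jump from point to point, which is why the result is smooth only up to sign.\<close>
  from \<psi>(6) obtain r where r: "\<And>p. \<psi> (r p) p > 0" by metis
  define w where "w = (\<lambda>i. W (a i))"
  have inU: "q \<in> U (a i)" if "\<psi> i q \<noteq> 0" for i q using \<psi>(4,5) that by blast
  have wadm: "adm q (w i q)" if "q \<in> U (a i)" for i q using W(2) that by (simp add: w_def)
  \<comment> \<open>By \<open>dich\<close> the default -1 means, for admissible covectors, that the
    product is negative on all of \<open>Z q\<close>.\<close>
  define sgn' where "sgn' = (\<lambda>q B B'. if \<forall>v\<in>Z q. (B::('m,'n) tvec \<Rightarrow> real) v * B' v > 0 then 1 else - 1 :: real)"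
  have sgn'_pm: "sgn' q B B' = 1 \<or> sgn' q B B' = -1" for q B B' by (simp add: sgn'_def)
  have sgn'_pos: "sgn' q B B' * (B v * B' v) > 0" if "adm q B" "adm q B'" "v \<in> Z q" for q B B' v
    using dich[OF that(1,2)] that(3) by (auto simp: sgn'_def)
  \<comment> \<open>Each local covector is turned to the sign of the reference before the weighted
    sum is taken. Local finiteness makes the index set finite.\<close>
  define B where "B = (\<lambda>q v. \<Sum>i\<in>{i. \<psi> i q \<noteq> 0}. \<psi> i q * (sgn' q (w i q) (w (r q) q) * w i q v))"
  show ?thesis
  proof (rule that)
    fix p
    obtain N0 k where N0: "open N0" "p \<in> N0" "\<And>j q. j \<ge> k \<Longrightarrow> q \<in> N0 \<Longrightarrow> \<psi> j q = 0"
      using \<psi>(7)[of p] by auto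
    define I where "I = {i. i < k \<and> p \<in> U (a i)}"
    have finI: "finite I" by (simp add: I_def)
    define l where "l = r p"
    have l: "l \<in> I" "p \<in> U (a l)"
      using r[of p] N0(2) N0(3)[of l p] inU[of l p] by (auto simp: I_def l_def not_less[symmetric])
    \<comment> \<open>Near \<open>p\<close> the signs are frozen at their values at
      \<open>p\<close>, relative to the fixed index \<open>l\<close>. This replaces the jumping
      reference by a constant one.\<close>
    define \<eta> where "\<eta> = (\<lambda>i. sgn' p (w i p) (w l p))"
    have \<eta>: "\<eta> i = 1 \<or> \<eta> i = -1" for i using sgn'_pm by (simp add: \<eta>_def)
    have "\<forall>i\<in>I. \<exists>N. open N \<and> p \<in> N \<and> N \<subseteq> U (a i) \<inter> U (a l) \<and>
        (\<forall>q\<in>N. \<forall>v\<in>Z q. (\<eta> i * w i q v) * w l q v > 0)"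
    proof
      fix i assume i: "i \<in> I"
      let ?U = "U (a i) \<inter> U (a l)"
      have o: "open ?U" "p \<in> ?U" using U l i by (auto simp: I_def)
      show "\<exists>N. open N \<and> p \<in> N \<and> N \<subseteq> ?U \<and> (\<forall>q\<in>N. \<forall>v\<in>Z q. (\<eta> i * w i q v) * w l q v > 0)"
      proof (rule opn[OF o])
        show "smooth_covector S ?U (\<lambda>q v. \<eta> i * w i q v)" "smooth_covector S ?U (w l)"
          unfolding w_def
          by (intro smooth_covector_scale o(1) smooth_covector_subset[OF W(1)]; blast)+
        show "\<forall>v\<in>Z p. \<eta> i * w i p v * w l p v > 0"
          using sgn'_pos[OF wadm wadm, of p i l] i l by (auto simp: \<eta>_def I_def mult.assoc)
      qed
    qed
    then obtain N where N: "\<And>i. i \<in> I \<Longrightarrow> open (N i)" "\<And>i. i \<in> I \<Longrightarrow> p \<in> N i"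
      "\<And>i. i \<in> I \<Longrightarrow> N i \<subseteq> U (a i) \<inter> U (a l)"
      "\<And>i q v. i \<in> I \<Longrightarrow> q \<in> N i \<Longrightarrow> v \<in> Z q \<Longrightarrow> (\<eta> i * w i q v) * w l q v > 0"
      by metis
    define N' where "N' = N0 \<inter> (\<Inter>i\<in>I. N i) \<inter> (\<Inter>i\<in>{..<k} - I. - K i)"
    have N'o: "open N'"
      unfolding N'_def using N0 N(1) \<psi>(3) finI by (intro open_Int open_INT) auto
    have pN': "p \<in> N'"
    proof (unfold N'_def, intro IntI INT_I ComplI)
      fix i assume "i \<in> {..<k} - I" "p \<in> K i"
      then show False using \<psi>(4)[of i] by (auto simp: I_def)
    qed (use N0 N(2) in auto)
    have N'U: "N' \<subseteq> U (a i)" if "i \<in> I" for i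
      using N(3)[OF that] that by (auto simp: N'_def)
    have inI: "i \<in> I" if "q \<in> N'" "\<psi> i q \<noteq> 0" for i q
    proof (rule ccontr)
      assume "i \<notin> I"
      moreover have "i < k" using N0(3)[of i q] that by (auto simp: N'_def not_less[symmetric])
      ultimately have "q \<notin> K i" using that by (auto simp: N'_def)
      then show False using that \<psi>(5) by blast
    qed
    define X where "X = (\<lambda>q v. \<Sum>i\<in>I. \<psi> i q * (\<eta> i * w i q v))"
    have X: "smooth_covector S N' X"
      unfolding X_def
    proof (rule smooth_covector_sum[OF N'o finI \<psi>(1)])
      fix i assume i: "i \<in> I"
      show "smooth_covector S N' (\<lambda>q v. \<eta> i * w i q v)"
        unfolding w_def by (intro smooth_covector_scale N'o smooth_covector_subset[OF W(1) N'U[OF i]])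
    qed
    \<comment> \<open>Every signed summand agrees in sign with \<open>w l q\<close> on
      \<open>Z q\<close>, and the one with index \<open>r q\<close> has positive weight.\<close>
    have Xpos: "X q v * w l q v > 0" if "q \<in> N'" "v \<in> Z q" for q v
    proof -
      have p: "(\<eta> i * w i q v) * w l q v > 0" if "i \<in> I" for i
        using N(4)[OF that _ \<open>v \<in> Z q\<close>] \<open>q \<in> N'\<close> that by (auto simp: N'_def)
      have "X q v * w l q v = (\<Sum>i\<in>I. \<psi> i q * ((\<eta> i * w i q v) * w l q v))"
        by (simp add: X_def sum_distrib_right mult.assoc)
      moreover have "\<dots> > 0"
      proof (rule sum_pos2[OF finI, of "r q"])
        show "r q \<in> I" using inI[OF that(1), of "r q"] r[of q] by simp
        then show "0 < \<psi> (r q) q * ((\<eta> (r q) * w (r q) q v) * w l q v)"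
          using p r[of q] by (meson mult_pos_pos)
        show "0 \<le> \<psi> i q * ((\<eta> i * w i q v) * w l q v)" if "i \<in> I" for i
          using p[OF that] \<psi>(2)[of i q] by (meson less_imp_le mult_nonneg_nonneg)
      qed
      ultimately show ?thesis by simp
    qed
    have "adm q (X q) \<and> (B q = X q \<or> B q = (\<lambda>v. - X q v))" if q: "q \<in> N'" for q
    proof
      have "X q v = 0" if "v \<in> Y q" for v
        unfolding X_def using wadm N'U q that by (intro sum.neutral) (auto simp: adm_def)
      then show "adm q (X q)"
        using Xpos[OF q] smooth_covectorD[OF X q] by (fastforce simp: adm_def)
      obtain z where z: "z \<in> Z q" using ne by blast
      let ?m = "r q"
      have m: "?m \<in> I" using inI[OF q, of ?m] r[of q] by simp
      \<comment> \<open>The sign of \<open>i\<close> relative to the moving reference is the product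
        of both signs relative to \<open>l\<close>; hence \<open>B q\<close> and \<open>X q\<close>
        differ by the factor \<open>\<eta> ?m\<close> only.\<close>
      have sg: "sgn' q (w i q) (w ?m q) = \<eta> i * \<eta> ?m" if i: "i \<in> I" for i
      proof -
        have qi: "q \<in> U (a i)" "q \<in> U (a ?m)" using N'U i m q by blast+
        have "sgn' q (w i q) (w ?m q) * (w i q z * w ?m q z) > 0"
          using sgn'_pos[OF wadm wadm z] qi by blast
        moreover have "(\<eta> i * w i q z) * w l q z > 0" "(\<eta> ?m * w ?m q z) * w l q z > 0"
          using N(4)[OF i _ z] N(4)[OF m _ z] i m q by (auto simp: N'_def)
        then have "((\<eta> i * w i q z) * w l q z) * ((\<eta> ?m * w ?m q z) * w l q z) > 0" by simp
        then have "(\<eta> i * \<eta> ?m * (w i q z * w ?m q z)) * (w l q z)\<^sup>2 > 0"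
          by (simp add: power2_eq_square ac_simps)
        then have "\<eta> i * \<eta> ?m * (w i q z * w ?m q z) > 0"
          by (simp add: zero_less_mult_iff)
        ultimately show ?thesis
          using \<eta>[of i] \<eta>[of ?m] sgn'_pm[of q "w i q" "w ?m q"] by auto
      qed
      have "B q v = \<eta> ?m * X q v" for v
      proof -
        have "B q v = (\<Sum>i\<in>I. \<psi> i q * (sgn' q (w i q) (w ?m q) * w i q v))"
          unfolding B_def using inI[OF q] finI by (intro sum.mono_neutral_left) auto
        also have "\<dots> = (\<Sum>i\<in>I. \<eta> ?m * (\<psi> i q * (\<eta> i * w i q v)))"
          by (intro sum.cong refl) (simp add: sg)
        finally show ?thesis by (simp add: X_def sum_distrib_left)
      qed
      then show "B q = X q \<or> B q = (\<lambda>v. - X q v)"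
        using \<eta>[of ?m] by auto
    qed
    then show "\<exists>U W. open U \<and> p \<in> U \<and> smooth_covector S U W \<and>
     (\<forall>q\<in>U. adm q (W q) \<and> (B q = W q \<or> B q = (\<lambda>v. - W q v)))"
      using N'o pN' X by blast
  qed
qed

section \<open>The tangent space of a level set\<close>

text \<open>Along a curve in \<open>N\<close> the function \<open>F\<close> is constant near time 0,
  so the chain rule makes its derivative along the velocity vanish.\<close>

lemma tangent_sub_level_zero:
  assumes c: "c \<in> S" "q \<in> dom_chart c" and F: "(F \<circ> inv_chart c) differentiable (at (app_chart c q))"
    and N: "\<And>p. p \<in> N \<Longrightarrow> p \<in> dom_chart c \<Longrightarrow> F p = k"
    and v: "v \<in> tangent_space_sub S N q"
  shows "differential S F q v = 0"
proof -
  from v obtain \<epsilon> \<gamma> where vT: "v \<in> T q" and \<epsilon>: "\<epsilon> > 0" and \<gamma>: "smooth_curve S {-\<epsilon><..<\<epsilon>} \<gamma>"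
    "\<gamma> ` {-\<epsilon><..<\<epsilon>} \<subseteq> N" "\<gamma> 0 = q"
    "\<And>c. c \<in> S \<Longrightarrow> q \<in> dom_chart c \<Longrightarrow> ((app_chart c \<circ> \<gamma>) has_vector_derivative v c) (at 0)"
    unfolding tangent_space_sub_def by blast
  let ?F = "F \<circ> inv_chart c" and ?O = "{-\<epsilon><..<\<epsilon>} \<inter> \<gamma> -` dom_chart c"
  let ?D = "frechet_derivative ?F (at (app_chart c q))"
  have o: "open ?O"
    using \<gamma>(1) open_dom[OF c(1)] unfolding smooth_curve_def
    by (intro continuous_open_preimage) auto
  have d1: "((app_chart c \<circ> \<gamma>) has_derivative (\<lambda>t. t *\<^sub>R v c)) (at 0)"
    using \<gamma>(4)[OF c] by (simp add: has_vector_derivative_def)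
  have "(?F has_derivative ?D) (at ((app_chart c \<circ> \<gamma>) 0))"
    using frechet_derivative_has_derivative[OF F] \<gamma>(3) by simp
  from diff_chain_at[OF d1 this]
  have "((?F \<circ> (app_chart c \<circ> \<gamma>)) has_derivative (?D \<circ> (\<lambda>t. t *\<^sub>R v c))) (at 0)" .
  then have "((\<lambda>t. k) has_derivative (?D \<circ> (\<lambda>t. t *\<^sub>R v c))) (at 0)"
  proof (rule has_derivative_transform_within_open[OF _ o])
    show "0 \<in> ?O" using \<epsilon> \<gamma>(3) c by simp
    show "(?F \<circ> (app_chart c \<circ> \<gamma>)) t = k" if "t \<in> ?O" for t
      using that c N[of "\<gamma> t"] \<gamma>(2) image_subset_iff[of \<gamma>] by auto
  qed
  then have "?D \<circ> (\<lambda>t. t *\<^sub>R v c) = (\<lambda>t. 0)"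
    using has_derivative_unique has_derivative_const by blast
  from fun_cong[OF this, of 1] have "?D (v c) = 0" by simp
  then show ?thesis using differential_chart[OF c F vT] by simp
qed

text \<open>The vector \<open>u\<close> witnesses that the level is regular at \<open>q\<close>. The
  curve in the coordinate level set given by \<open>smooth_level_curve\<close> is pulled back to the
  manifold and realises \<open>v\<close> as a velocity.\<close>

lemma tangent_sub_levelI:
  assumes c: "c \<in> S" "q \<in> dom_chart c" and F: "smooth_on (app_chart c ` dom_chart c) (F \<circ> inv_chart c)"
    and N: "\<And>p. p \<in> dom_chart c \<Longrightarrow> F p = k \<Longrightarrow> p \<in> N" and q: "F q = k"
    and u: "u \<in> T q" "differential S F q u \<noteq> 0" and v: "v \<in> T q" "differential S F q v = 0"
  shows "v \<in> tangent_space_sub S N q"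
proof -
  let ?a = "app_chart c q" and ?\<Omega> = "app_chart c ` dom_chart c"
  define G where "G = (\<lambda>x. (F \<circ> inv_chart c) x - k)"
  have G: "smooth_on ?\<Omega> G"
    unfolding G_def by (intro smooth_on_diff open_img c F smooth_on_const)
  have a: "?a \<in> ?\<Omega>" "G ?a = 0" using c q by (auto simp: G_def)
  have dF: "(F \<circ> inv_chart c) differentiable (at ?a)" by (rule smooth_on_differentiable[OF F a(1)])
  have "(G has_derivative (\<lambda>w. frechet_derivative (F \<circ> inv_chart c) (at ?a) w - 0)) (at ?a)"
    unfolding G_def
    by (intro has_derivative_diff frechet_derivative_has_derivative dF has_derivative_const)
  from frechet_derivative_at[OF this]
  have DG: "frechet_derivative G (at ?a) w = frechet_derivative (F \<circ> inv_chart c) (at ?a) w" for w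
    by (metis diff_zero)
  have u': "frechet_derivative G (at ?a) (u c) \<noteq> 0" and v': "frechet_derivative G (at ?a) (v c) = 0"
    using u v differential_chart[OF c dF] DG by auto
  obtain \<epsilon> \<sigma> where \<epsilon>: "\<epsilon> > 0" and \<sigma>: "smooth_on {-\<epsilon><..<\<epsilon>} \<sigma>" "\<sigma> 0 = ?a"
    "\<And>t. t \<in> {-\<epsilon><..<\<epsilon>} \<Longrightarrow> \<sigma> t \<in> ?\<Omega> \<and> G (\<sigma> t) = 0" "(\<sigma> has_vector_derivative v c) (at 0)"
    using smooth_level_curve[OF open_img[OF c(1)] G a u' v'] by metis
  define \<gamma> where "\<gamma> = inv_chart c \<circ> \<sigma>"
  have cont: "continuous_on {-\<epsilon><..<\<epsilon>} \<gamma>"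
    unfolding \<gamma>_def o_def
    by (rule continuous_on_compose2[OF cont_inv[OF c(1)] smooth_on_continuous_on[OF \<sigma>(1)]]) (use \<sigma>(3) in blast)
  have \<gamma>dom: "\<gamma> t \<in> dom_chart c" "app_chart c (\<gamma> t) = \<sigma> t" if "t \<in> {-\<epsilon><..<\<epsilon>}" for t
    using \<sigma>(3)[OF that] c by (auto simp: \<gamma>_def app_inv)
  have sm: "smooth_on {t \<in> {-\<epsilon><..<\<epsilon>}. \<gamma> t \<in> dom_chart d} (app_chart d \<circ> \<gamma>)" if d: "d \<in> S" for d
  proof -
    have e: "{t \<in> {-\<epsilon><..<\<epsilon>}. \<gamma> t \<in> dom_chart d} = {-\<epsilon><..<\<epsilon>} \<inter> \<gamma> -` dom_chart d" by auto
    have o: "open {t \<in> {-\<epsilon><..<\<epsilon>}. \<gamma> t \<in> dom_chart d}"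
      unfolding e by (rule continuous_open_preimage[OF cont _ open_dom[OF d]]) simp
    have "smooth_on {t \<in> {-\<epsilon><..<\<epsilon>}. \<gamma> t \<in> dom_chart d} (\<lambda>t. (app_chart d \<circ> inv_chart c) (\<sigma> t))"
    proof (rule smooth_on_compose[OF o open_app_image[OF c(1) open_dom[OF d]] _ _ transition_smooth[OF c(1) d]])
      show "smooth_on {t \<in> {-\<epsilon><..<\<epsilon>}. \<gamma> t \<in> dom_chart d} \<sigma>"
        by (rule smooth_on_subset[OF \<sigma>(1)]) auto
      show "\<sigma> ` {t \<in> {-\<epsilon><..<\<epsilon>}. \<gamma> t \<in> dom_chart d} \<subseteq> app_chart c ` (dom_chart c \<inter> dom_chart d)"
      proof
        fix x assume "x \<in> \<sigma> ` {t \<in> {-\<epsilon><..<\<epsilon>}. \<gamma> t \<in> dom_chart d}"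
        then obtain t where "t \<in> {-\<epsilon><..<\<epsilon>}" "\<gamma> t \<in> dom_chart d" "x = \<sigma> t" by blast
        then show "x \<in> app_chart c ` (dom_chart c \<inter> dom_chart d)"
          using \<gamma>dom[of t] by (metis IntI imageI)
      qed
    qed
    then show ?thesis by (simp add: \<gamma>_def o_def)
  qed
  have der: "((app_chart d \<circ> \<gamma>) has_vector_derivative v d) (at 0)" if d: "d \<in> S" "q \<in> dom_chart d" for d
  proof -
    have "((app_chart d \<circ> inv_chart c) has_derivative jac c d q) (at (\<sigma> 0))"
      using jac_has_derivative[OF c(1) d(1) c(2) d(2)] \<sigma>(2) by simp
    from diff_chain_at[OF \<sigma>(4)[unfolded has_vector_derivative_def] this]
    have "((app_chart d \<circ> inv_chart c \<circ> \<sigma>) has_derivative (jac c d q \<circ> (\<lambda>t. t *\<^sub>R v c))) (at 0)" .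
    moreover have "jac c d q \<circ> (\<lambda>t. t *\<^sub>R v c) = (\<lambda>t. t *\<^sub>R v d)"
      using tangent_spaceD(1)[OF v(1) c(1) d(1) c(2) d(2)] linear_scale[OF jac_linear[OF c(1) d(1) c(2) d(2)]]
      by (auto simp: fun_eq_iff)
    ultimately show ?thesis by (simp add: has_vector_derivative_def \<gamma>_def o_assoc)
  qed
  have "\<gamma> ` {-\<epsilon><..<\<epsilon>} \<subseteq> N"
  proof
    fix p assume "p \<in> \<gamma> ` {-\<epsilon><..<\<epsilon>}"
    then obtain t where t: "t \<in> {-\<epsilon><..<\<epsilon>}" "p = \<gamma> t" by blast
    have "F (\<gamma> t) = k" using \<sigma>(3)[OF t(1)] by (simp add: G_def \<gamma>_def)
    then show "p \<in> N" using N \<gamma>dom(1)[OF t(1)] t(2) by blast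
  qed
  moreover have "\<gamma> 0 = q" using c \<sigma>(2) by (simp add: \<gamma>_def)
  moreover have "smooth_curve S {-\<epsilon><..<\<epsilon>} \<gamma>" using cont sm by (simp add: smooth_curve_def)
  ultimately show ?thesis
    unfolding tangent_space_sub_def using v(1) \<epsilon> der by blast
qed

end

section \<open>Transverse type-changing metrics\<close>

lemma lorentzian_onE:
  assumes "lorentzian_on T b"
  obtains E t where "independent E" "span E = T" "t \<in> E" "b t t = -1"
    "\<And>e. e \<in> E - {t} \<Longrightarrow> b e e = 1" "\<And>e e'. e \<in> E \<Longrightarrow> e' \<in> E \<Longrightarrow> e \<noteq> e' \<Longrightarrow> b e e' = 0"
proof -
  from assms obtain E t where "independent E \<and> span E = T \<and> t \<in> E \<and> b t t = -1 \<and>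
     (\<forall>e\<in>E - {t}. b e e = 1) \<and> (\<forall>e\<in>E. \<forall>e'\<in>E. e \<noteq> e' \<longrightarrow> b e e' = 0)"
    unfolding lorentzian_on_def by (elim exE)
  then show ?thesis by (intro that[of E t]) auto
qed

locale type_changing = smooth_mfd S
  for S :: "('m::{t2_space, second_countable_topology}, 'n::finite) chart set" +
  fixes gt :: "('m, 'n) tensor02" and MR :: "'m set"
  assumes ttc: "transverse_type_changing S gt MR"
begin

definition "H = degeneracy_locus S gt"
definition "A = MR \<union> H"
definition "G c p = tensor_comp S gt c p"
definition "detG c p = det (G c p)"

lemma gt_sym: "sym_bilinear_on (T p) (gt p)"
  using ttc by (simp add: transverse_type_changing_def signature_type_changing_def smooth_sym_tensor_def)

sublocale gt: sym_form "T p" "gt p" for p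
  using gt_sym subspace_T by unfold_locales

lemma G_smooth: "c \<in> S \<Longrightarrow> smooth_on (app_chart c ` dom_chart c) (\<lambda>x. G c (inv_chart c x) $ \<mu> $ \<nu>)"
  using ttc by (simp add: G_def transverse_type_changing_def signature_type_changing_def smooth_sym_tensor_def)

lemma gt_G: "c \<in> S \<Longrightarrow> p \<in> dom_chart c \<Longrightarrow> u \<in> T p \<Longrightarrow> v \<in> T p \<Longrightarrow> gt p u v = u c \<bullet> (G c p *v v c)"
  unfolding G_def by (rule tensor_comp_form[where g = gt, OF gt_sym])

lemma G_sym: "c \<in> S \<Longrightarrow> p \<in> dom_chart c \<Longrightarrow> transpose (G c p) = G c p"
  unfolding G_def by (rule tensor_comp_sym[where g = gt, OF gt_sym])

lemma radical_iff: "w \<in> radical_on (T p) (gt p) \<longleftrightarrow> w \<in> T p \<and> (\<forall>v\<in>T p. gt p w v = 0)"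
  by (simp add: radical_on_def)

lemma in_H_radical:
  assumes "q \<in> H" obtains r where "r \<in> radical_on (T q) (gt q)" "r \<in> T q" "r \<noteq> 0"
proof -
  have "0 \<in> radical_on (T q) (gt q)" by (simp add: radical_iff gt.zero_left subspace_0[OF subspace_T])
  moreover have "radical_on (T q) (gt q) \<noteq> {0}"
    using assms by (simp add: H_def degeneracy_locus_def degenerate_on_def)
  ultimately show ?thesis using that radical_iff by blast
qed

lemma H_I: "r \<in> T q \<Longrightarrow> r \<noteq> 0 \<Longrightarrow> (\<And>v. v \<in> T q \<Longrightarrow> gt q r v = 0) \<Longrightarrow> q \<in> H"
  unfolding H_def degeneracy_locus_def degenerate_on_def radical_on_def by blast

lemma H_iff_det:
  assumes c: "c \<in> S" "p \<in> dom_chart c" shows "p \<in> H \<longleftrightarrow> detG c p = 0"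
proof -
  have det: "detG c p = 0 \<longleftrightarrow> (\<exists>x. x \<noteq> 0 \<and> G c p *v x = 0)"
    unfolding detG_def by (metis invertible_det_nz invertible_left_inverse matrix_left_invertible_ker)
  show ?thesis
  proof
    assume "p \<in> H"
    then obtain r where r: "r \<in> T p" "r \<noteq> 0" "\<And>v. v \<in> T p \<Longrightarrow> gt p r v = 0"
      using in_H_radical radical_iff by metis
    have "y \<bullet> (G c p *v r c) = 0" for y
      using gt_G[OF c coord_vec_T[OF c] r(1), of y] r(3)[OF coord_vec_T[OF c], of y]
        gt.sym[OF coord_vec_T[OF c] r(1), of y] c by simp
    then have "G c p *v r c = 0" using inner_eq_zero_iff by blast
    moreover have "r c \<noteq> 0" using T_eq_0_iff[OF c r(1)] r(2) by simp
    ultimately show "detG c p = 0" using det by blast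
  next
    assume "detG c p = 0"
    then obtain x where x: "x \<noteq> 0" "G c p *v x = 0" using det by blast
    let ?r = "coord_vec S c p x"
    have r: "?r \<in> T p" "?r c = x" using coord_vec_T[OF c] coord_vec_app[OF c] by auto
    show "p \<in> H"
    proof (rule H_I[OF r(1)])
      show "?r \<noteq> 0" using T_eq_0_iff[OF c r(1)] r(2) x(1) by simp
      show "gt p ?r v = 0" if "v \<in> T p" for v
        using gt_G[OF c that r(1)] r(2) x(2) gt.sym[OF that r(1)] by simp
    qed
  qed
qed

lemma detG_smooth: "c \<in> S \<Longrightarrow> smooth_on (app_chart c ` dom_chart c) (detG c \<circ> inv_chart c)"
  unfolding detG_def o_def by (intro smooth_on_det open_img G_smooth)

lemma detG_differentiable:
  "c \<in> S \<Longrightarrow> p \<in> dom_chart c \<Longrightarrow> (detG c \<circ> inv_chart c) differentiable (at (app_chart c p))"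
  by (rule smooth_on_differentiable[OF detG_smooth]) auto

lemma detG_transverse:
  assumes "q \<in> H" "c \<in> S" "q \<in> dom_chart c"
  obtains v where "v \<in> T q" "differential S (detG c) q v \<noteq> 0"
proof -
  have "(\<lambda>p. det (tensor_comp S gt c p)) = detG c" by (simp add: fun_eq_iff detG_def G_def)
  then show ?thesis
    using ttc assms that unfolding transverse_type_changing_def H_def by fastforce
qed

lemma continuous_on_transfer:
  assumes "c \<in> S" "smooth_on (app_chart c ` U) f" "U \<subseteq> dom_chart c" "\<And>p. p \<in> U \<Longrightarrow> f (app_chart c p) = g p"
  shows "continuous_on U g"
proof -
  have "continuous_on U (\<lambda>p. f (app_chart c p))"
    by (rule continuous_on_compose2[OF smooth_on_continuous_on[OF assms(2)] continuous_on_subset[OF cont_app[OF assms(1)] assms(3)]])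
      simp
  then show ?thesis using assms(4) continuous_on_eq by blast
qed

lemma G_cont: "c \<in> S \<Longrightarrow> continuous_on (dom_chart c) (\<lambda>p. G c p $ \<mu> $ \<nu>)"
  by (rule continuous_on_transfer[OF _ G_smooth]) auto

lemma detG_cont: "c \<in> S \<Longrightarrow> continuous_on (dom_chart c) (detG c)"
  by (rule continuous_on_transfer[OF _ detG_smooth]) auto

text \<open>Transversality makes \<open>H\<close> a regular zero set of the determinant in every
  chart. From here on tangency to \<open>H\<close> is tested by the differential of
  \<open>detG c\<close>.\<close>

lemma tangent_H_iff:
  assumes q: "q \<in> H" and c: "c \<in> S" "q \<in> dom_chart c" and v: "v \<in> T q"
  shows "v \<in> tangent_space_sub S H q \<longleftrightarrow> differential S (detG c) q v = 0"
proof
  assume "v \<in> tangent_space_sub S H q"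
  then show "differential S (detG c) q v = 0"
    by (rule tangent_sub_level_zero[OF c detG_differentiable[OF c], of H 0, rotated])
      (use H_iff_det[OF c(1)] in auto)
next
  obtain u where u: "u \<in> T q" "differential S (detG c) q u \<noteq> 0" by (rule detG_transverse[OF q c])
  assume d: "differential S (detG c) q v = 0"
  show "v \<in> tangent_space_sub S H q"
    by (rule tangent_sub_levelI[OF c detG_smooth[OF c(1)] _ _ u v d])
      (use H_iff_det[OF c(1)] q c in auto)
qed

text \<open>In a Lorentzian basis the matrix is diag(-1,1,...,1), with determinant -1, and a change
  of basis multiplies the determinant by a square.\<close>

lemma lorentzian_det:
  assumes "lorentzian_on (T p) (gt p)" and c: "c \<in> S" "p \<in> dom_chart c"
  shows "detG c p < 0"
proof -
  obtain E t where E: "independent E" "span E = T p" "t \<in> E" "gt p t t = -1"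
    "\<And>e. e \<in> E - {t} \<Longrightarrow> gt p e e = 1" "\<And>e e'. e \<in> E \<Longrightarrow> e' \<in> E \<Longrightarrow> e \<noteq> e' \<Longrightarrow> gt p e e' = 0"
    by (rule lorentzian_onE[OF assms(1)]) (rule that)
  have ET: "E \<subseteq> T p" using E(2) span_superset by blast
  \<comment> \<open>Evaluation in the chart identifies \<open>T p\<close> with the model space, so
    \<open>E\<close> has \<open>CARD('n)\<close> elements and its coordinates form a square matrix
    \<open>P\<close>.\<close>
  let ?f = "\<lambda>w :: ('m, 'n) tvec. w c"
  have lin: "linear ?f" by (rule linearI) (auto simp: scaleR_fun_def)
  have inj: "inj_on ?f (span E)"
    unfolding E(2) by (rule inj_onI) (metis coord_vec_of_T[OF c])
  have ind: "independent (?f ` E)" using linear_independent_injective_image[OF lin E(1) inj] .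
  have "x \<in> ?f ` T p" for x
    by (rule image_eqI[of _ _ "coord_vec S c p x"]) (simp_all add: coord_vec_T[OF c] coord_vec_app[OF c])
  then have "?f ` T p = UNIV" by blast
  then have sp: "span (?f ` E) = UNIV" using linear_span_image[OF lin, of E] E(2) by simp
  have "card (?f ` E) = CARD('n)"
    using dim_eq_card_independent[OF ind] dim_span[of "?f ` E"] sp by simp
  moreover have injE: "inj_on ?f E" using inj span_superset inj_on_subset by blast
  ultimately have cardE: "card E = CARD('n)" by (simp add: card_image)
  then have finE: "finite E" using card_ge_0_finite by force
  obtain \<phi> where \<phi>: "bij_betw \<phi> (UNIV :: 'n set) E"
    using finite_same_card_bij[OF finite_class.finite_UNIV finE] cardE by auto
  have \<phi>E: "\<phi> i \<in> E" for i using \<phi> by (auto simp: bij_betw_def)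
  have \<phi>inj: "\<phi> i = \<phi> j \<longleftrightarrow> i = j" for i j using \<phi> by (auto simp: bij_betw_def inj_eq)
  define P where "P = (\<chi> i j. \<phi> j c $ i)"
  define M where "M = transpose P ** G c p ** P"
  have M: "M $ i $ j = gt p (\<phi> i) (\<phi> j)" for i j
  proof -
    have "gt p (\<phi> i) (\<phi> j) = \<phi> i c \<bullet> (G c p *v \<phi> j c)"
      using ET \<phi>E by (intro gt_G[OF c]) auto
    also have "\<dots> = (\<Sum>k\<in>UNIV. \<Sum>l\<in>UNIV. \<phi> i c $ k * G c p $ k $ l * \<phi> j c $ l)"
      by (simp add: inner_vec_def matrix_vector_mult_def sum_distrib_left mult.assoc)
    also have "\<dots> = (\<Sum>l\<in>UNIV. \<Sum>k\<in>UNIV. \<phi> i c $ k * G c p $ k $ l * \<phi> j c $ l)"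
      by (rule sum.swap)
    also have "\<dots> = M $ i $ j"
      by (simp add: M_def P_def matrix_matrix_mult_def transpose_def sum_distrib_right)
    finally show ?thesis by simp
  qed
  have "det M = (\<Prod>i\<in>UNIV. M $ i $ i)"
    by (rule det_diagonal) (use M E(6) \<phi>E \<phi>inj in auto)
  also have "\<dots> = (\<Prod>i\<in>UNIV. gt p (\<phi> i) (\<phi> i))" by (simp add: M)
  also have "\<dots> = (\<Prod>e\<in>E. gt p e e)"
    by (rule prod.reindex_bij_betw[OF \<phi>])
  also have "\<dots> = gt p t t * (\<Prod>e\<in>E - {t}. gt p e e)"
    by (rule prod.remove[OF finE E(3)])
  also have "(\<Prod>e\<in>E - {t}. gt p e e) = 1" by (rule prod.neutral) (use E(5) in auto)
  finally have "det M = -1" using E(4) by simp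
  then have "(det P)\<^sup>2 * detG c p = -1"
    by (simp add: M_def det_mul detG_def power2_eq_square ac_simps)
  then show ?thesis
    by (metis mult_nonneg_nonneg not_less zero_le_power2 neg_0_le_iff_le not_one_le_zero)
qed

text \<open>For the negative basis vector \<open>t\<close>, orthogonality to \<open>t\<close> kills
  the coefficient of \<open>t\<close>; what remains of \<open>gt p v v\<close> is a sum of
  squares.\<close>

lemma lorentzian_timelike:
  assumes "lorentzian_on (T p) (gt p)"
  obtains t where "t \<in> T p" "gt p t t < 0" "\<And>v. v \<in> T p \<Longrightarrow> v \<noteq> 0 \<Longrightarrow> gt p t v = 0 \<Longrightarrow> gt p v v > 0"
proof -
  obtain E t where E: "independent E" "span E = T p" "t \<in> E" "gt p t t = -1"
    "\<And>e. e \<in> E - {t} \<Longrightarrow> gt p e e = 1" "\<And>e e'. e \<in> E \<Longrightarrow> e' \<in> E \<Longrightarrow> e \<noteq> e' \<Longrightarrow> gt p e e' = 0"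
    by (rule lorentzian_onE[OF assms(1)]) (rule that)
  have ET: "E \<subseteq> T p" using E(2) span_superset by blast
  show ?thesis
  proof (rule that[of t])
    show "t \<in> T p" "gt p t t < 0" using E ET by auto
    fix v assume v: "v \<in> T p" "v \<noteq> 0" "gt p t v = 0"
    obtain F r where F: "finite F" "F \<subseteq> E" "v = (\<Sum>e\<in>F. r e *\<^sub>R e)"
      using v(1) E(2) unfolding span_explicit by blast
    have rT: "r e *\<^sub>R e \<in> T p" if "e \<in> F" for e using that F ET subspace_scale[OF subspace_T] by blast
    have coeff: "gt p e v = r e * gt p e e" if e: "e \<in> F" for e
    proof -
      have eT: "e \<in> T p" using e F ET by blast
      have "gt p e v = (\<Sum>x\<in>F. r x * gt p e x)"
        unfolding F(3) using rT F ET eT by (subst gt.sum_right) (auto simp: gt.scale_right intro!: sum.cong)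
      also have "\<dots> = (\<Sum>x\<in>F. if x = e then r e * gt p e e else 0)"
        using E(6) F e by (intro sum.cong refl) auto
      finally show ?thesis using e F(1) by simp
    qed
    have vv: "gt p v v = (\<Sum>e\<in>F. (r e)\<^sup>2 * gt p e e)"
    proof -
      have "gt p v v = (\<Sum>e\<in>F. gt p (r e *\<^sub>R e) v)"
        by (subst F(3), rule gt.sum_left[OF rT v(1)])
      also have "\<dots> = (\<Sum>e\<in>F. (r e)\<^sup>2 * gt p e e)"
      proof (rule sum.cong[OF refl])
        fix e assume e: "e \<in> F"
        then have "e \<in> T p" using F ET by blast
        then show "gt p (r e *\<^sub>R e) v = (r e)\<^sup>2 * gt p e e"
          using gt.scale_left[OF _ v(1)] coeff[OF e] by (simp add: power2_eq_square)
      qed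
      finally show ?thesis .
    qed
    have rt: "r t = 0" if "t \<in> F" using coeff[OF that] v(3) E(4) by simp
    have nonneg: "(r e)\<^sup>2 * gt p e e \<ge> 0" if "e \<in> F" for e
      using rt that E(5)[of e] F by (cases "e = t") auto
    have "\<exists>e\<in>F. r e \<noteq> 0"
    proof (rule ccontr)
      assume "\<not> (\<exists>e\<in>F. r e \<noteq> 0)"
      then have "v = 0" unfolding F(3) by (intro sum.neutral) auto
      then show False using v(2) by simp
    qed
    then obtain e where e: "e \<in> F" "r e \<noteq> 0" by blast
    have "e \<noteq> t" using e rt by auto
    then have "(r e)\<^sup>2 * gt p e e > 0" using E(5)[of e] F e by auto
    then show "gt p v v > 0"
      unfolding vv using nonneg F(1) e(1) by (intro sum_pos2) auto
  qed
qed

section \<open>Semidefiniteness on the degeneracy locus and the region outside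
  \<open>A\<close>\<close>

lemma MR_positive: "p \<in> MR \<Longrightarrow> v \<in> T p \<Longrightarrow> v \<noteq> 0 \<Longrightarrow> gt p v v > 0"
  using ttc by (auto simp: transverse_type_changing_def signature_type_changing_def positive_definite_on_def)

lemma outside_lorentzian:
  assumes "p \<notin> A" shows "lorentzian_on (T p) (gt p)"
proof -
  have "p \<in> - degeneracy_locus S gt" using assms by (simp add: A_def H_def)
  then obtain C where C: "C \<in> components (- degeneracy_locus S gt)" "p \<in> C"
    using Union_components by blast
  moreover have "C \<noteq> MR" using C assms by (auto simp: A_def)
  ultimately show ?thesis
    using ttc unfolding transverse_type_changing_def signature_type_changing_def by blast
qed

text \<open>The vector is moved to nearby points with constant chart coordinates, and the matrix
  \<open>G c\<close> is continuous.\<close>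

lemma timelike_nearby:
  assumes "v \<in> T p" "gt p v v < 0"
  obtains N where "open N" "p \<in> N" "\<And>x. x \<in> N \<Longrightarrow> \<exists>u\<in>T x. gt x u u < 0"
proof -
  obtain c where c: "c \<in> S" "p \<in> dom_chart c" by (rule chart_around)
  define h where "h = (\<lambda>x. v c \<bullet> (G c x *v v c))"
  have cont: "continuous_on (dom_chart c) h"
    unfolding h_def inner_vec_def matrix_vector_mult_def
    by (auto intro!: continuous_intros G_cont c)
  show ?thesis
  proof (rule that[of "dom_chart c \<inter> h -` {..<0}"])
    show "open (dom_chart c \<inter> h -` {..<0})"
      by (rule continuous_open_preimage[OF cont open_dom[OF c(1)]]) simp
    show "p \<in> dom_chart c \<inter> h -` {..<0}"
      using c assms gt_G[OF c assms(1,1)] by (simp add: h_def)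
    fix x assume "x \<in> dom_chart c \<inter> h -` {..<0}"
    then have x: "x \<in> dom_chart c" "h x < 0" by auto
    show "\<exists>u\<in>T x. gt x u u < 0"
      using gt_G[OF c(1) x(1) coord_vec_T[OF c(1) x(1)] coord_vec_T[OF c(1) x(1)], of "v c" "v c"]
        x c coord_vec_T[OF c(1) x(1)] by (intro bexI[of _ "coord_vec S c x (v c)"]) (auto simp: h_def)
  qed
qed

text \<open>Otherwise no point near \<open>q\<close> is Riemannian, so \<open>det\<close> has a local maximum at \<open>q\<close>.\<close>

lemma H_nonneg:
  assumes q: "q \<in> H" and v: "v \<in> T q" shows "gt q v v \<ge> 0"
proof (rule ccontr)
  assume "\<not> gt q v v \<ge> 0"
  then obtain N where N: "open N" "q \<in> N" "\<And>x. x \<in> N \<Longrightarrow> \<exists>u\<in>T x. gt x u u < 0"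
    using timelike_nearby[OF v] by (metis not_le)
  obtain c where c: "c \<in> S" "q \<in> dom_chart c" by (rule chart_around)
  let ?O = "app_chart c ` (dom_chart c \<inter> N)" and ?F = "detG c \<circ> inv_chart c"
  have F: "(?F has_derivative frechet_derivative ?F (at (app_chart c q))) (at (app_chart c q))"
    by (rule frechet_derivative_has_derivative[OF detG_differentiable[OF c]])
  have le: "detG c x \<le> 0" if x: "x \<in> dom_chart c" "x \<in> N" for x
  proof (cases "x \<in> H")
    case True
    then show ?thesis using H_iff_det[OF c(1) x(1)] by simp
  next
    case False
    obtain u where "u \<in> T x" "gt x u u < 0" using N(3)[OF x(2)] by blast
    then have "x \<notin> MR"
      using MR_positive[of x u] gt.zero_left[OF \<open>u \<in> T x\<close>] by fastforce
    then show ?thesis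
      using lorentzian_det[OF outside_lorentzian c(1) x(1)] False by (auto simp: A_def)
  qed
  have "?F (app_chart c q) = 0" using q H_iff_det[OF c] c by simp
  then have "\<forall>y\<in>?O. ?F y \<le> ?F (app_chart c q)" using le c by auto
  then have "frechet_derivative ?F (at (app_chart c q)) = (\<lambda>v. 0)"
    using differential_zero_maxmin[OF _ open_app_image[OF c(1) N(1)] F] c N(2) by blast
  then have "differential S (detG c) q v = 0" if "v \<in> T q" for v
    using differential_chart[OF c detG_differentiable[OF c] that] by simp
  then show False using detG_transverse[OF q c] by metis
qed

text \<open>By \<open>H_nonneg\<close> the form is positive semidefinite at \<open>q\<close>, and a
  null vector of such a form is radical: otherwise the form would be negative somewhere on a line
  through \<open>v\<close>. So the causal vectors at \<open>H\<close> are exactly the radical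
  ones.\<close>

lemma H_null_radical:
  assumes q: "q \<in> H" and v: "v \<in> T q" "gt q v v \<le> 0"
  shows "v \<in> radical_on (T q) (gt q)"
proof -
  have "gt q v w = 0" if w: "w \<in> T q" for w
  proof -
    define m k where "m = gt q v w" and "k = gt q w w"
    have k: "k \<ge> 0" using H_nonneg[OF q w] by (simp add: k_def)
    have vv: "gt q v v = 0" using v H_nonneg[OF q v(1)] by simp
    \<comment> \<open>Near the minimiser - m / k; the summand 1 avoids the division by zero when
      \<open>k = 0\<close>, and the value of the form is still negative unless
      \<open>m = 0\<close>.\<close>
    define t where "t = - m / (k + 1)"
    have tw: "t *\<^sub>R w \<in> T q" "v + t *\<^sub>R w \<in> T q"
      using w v(1) subspace_T by (auto intro: subspace_add subspace_scale)
    have "gt q (v + t *\<^sub>R w) (v + t *\<^sub>R w) = gt q v v + t * gt q v w + (t * gt q w v + t * (t * gt q w w))"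
      using gt.add_left[OF v(1) tw] gt.add_right[OF v(1) tw(1) v(1)] gt.add_right[OF v(1) tw(1) tw(1)]
        gt.scale_left[OF w v(1)] gt.scale_right[OF v(1) w] gt.scale_left[OF w tw(1)] gt.scale_right[OF w w]
      by simp
    moreover have "gt q w v = m" using gt.sym[OF w v(1)] by (simp add: m_def)
    ultimately have "0 \<le> 2 * (t * m) + t * t * k"
      using H_nonneg[OF q tw(2)] vv by (simp add: m_def[symmetric] k_def[symmetric] ac_simps)
    also have "\<dots> = - (m\<^sup>2 * (k + 2)) / (k + 1)\<^sup>2"
      using k by (simp add: t_def divide_simps power2_eq_square) (simp add: algebra_simps)
    finally have "m\<^sup>2 * (k + 2) \<le> 0" using k by (simp add: divide_simps)
    then show ?thesis using k by (simp add: mult_le_0_iff m_def)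
  qed
  then show ?thesis using v(1) radical_iff by blast
qed

text \<open>The complement consists of the points that admit a timelike vector, since the form is
  positive definite on \<open>MR\<close> and semidefinite on \<open>H\<close>; this is an open
  condition. It ensures that a point outside \<open>A\<close> has a neighbourhood without
  constraints from the line.\<close>

lemma closed_A: "closed A"
proof -
  have "\<exists>N. open N \<and> p \<in> N \<and> N \<subseteq> - A" if p: "p \<in> - A" for p
  proof -
    obtain t where t: "t \<in> T p" "gt p t t < 0"
      using lorentzian_timelike[OF outside_lorentzian] p by (metis ComplD)
    obtain N where N: "open N" "p \<in> N" "\<And>x. x \<in> N \<Longrightarrow> \<exists>u\<in>T x. gt x u u < 0"
      using timelike_nearby[OF t] by blast
    have "x \<notin> A" if "x \<in> N" for x
    proof -
      from N(3)[OF that] obtain u where u: "u \<in> T x" "gt x u u < 0" by auto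
      then have "u \<noteq> 0" using gt.zero_left[OF u(1)] by auto
      then show ?thesis using MR_positive[OF _ u(1)] H_nonneg[OF _ u(1)] u(2) by (force simp: A_def)
    qed
    then show ?thesis using N(1,2) by blast
  qed
  then have "open (- A)" by (subst open_subopen) simp
  then show ?thesis by (simp add: closed_def)
qed

end

section \<open>Existence of the covector field\<close>

locale transverse_radical_metric = type_changing S gt MR
  for S :: "('m::{t2_space, second_countable_topology}, 'n::finite) chart set"
    and gt :: "('m, 'n) tensor02" and MR :: "'m set" +
  assumes radical: "transverse_radical S gt"
begin

lemma radical_tangent:
  assumes "q \<in> H" "v \<in> radical_on (T q) (gt q)" "v \<in> tangent_space_sub S H q"
  shows "v = 0"
  using radical assms unfolding transverse_radical_def Let_def H_def by blast

end

locale transverse_radical_line = transverse_radical_metric S gt MR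
  for S :: "('m::{t2_space, second_countable_topology}, 'n::finite) chart set"
    and gt :: "('m, 'n) tensor02" and MR :: "'m set" +
  fixes L :: "'m \<Rightarrow> ('m, 'n) tvec set"
  assumes L: "line_element_field S A L"
    and L_transverse: "transverse_line_field S H L"
begin

text \<open>At a point of \<open>H\<close>, vanishing on \<open>Y\<close> means being a multiple of the differential of \<open>det\<close>.
  This rigidity makes the causal vectors and the given line impose compatible signs there.\<close>

definition Z :: "'m \<Rightarrow> ('m, 'n) tvec set" where
  "Z p = {v \<in> T p. v \<noteq> 0 \<and> gt p v v \<le> 0} \<union> (if p \<in> A then L p else {})"

definition Y :: "'m \<Rightarrow> ('m, 'n) tvec set" where
  "Y p = (if p \<in> H then tangent_space_sub S H p else {})"

text \<open>Not vanishing on the non-zero causal vectors is the same as \<open>gt\<close> being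
  positive on the non-zero vectors of the kernel. The formulation by non-vanishing turns
  admissibility into a condition on signs, as the gluing requires.\<close>

definition adm :: "'m \<Rightarrow> (('m, 'n) tvec \<Rightarrow> real) \<Rightarrow> bool" where
  "adm p B \<longleftrightarrow> covector_on (T p) B \<and> (\<forall>v\<in>Z p. B v \<noteq> 0) \<and> (\<forall>v\<in>Y p. B v = 0)"

lemma L_local:
  assumes "p \<in> A"
  obtains U V where "open U" "p \<in> U" "smooth_vector_field S U V"
    "\<And>q. q \<in> U \<Longrightarrow> q \<in> A \<Longrightarrow> V q \<in> T q" "\<And>q. q \<in> U \<Longrightarrow> q \<in> A \<Longrightarrow> V q \<noteq> 0"
    "\<And>q. q \<in> U \<Longrightarrow> q \<in> A \<Longrightarrow> L q = {V q, - V q}"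
proof -
  obtain U V where U: "open U" "p \<in> U" "smooth_vector_field S U V"
    "\<forall>q\<in>U \<inter> A. V q \<noteq> 0 \<and> L q = {V q, - V q}"
    using L assms unfolding line_element_field_def by meson
  moreover have "V q \<in> T q" if "q \<in> U" for q
    using U(3) that by (simp add: smooth_vector_field_def)
  ultimately show ?thesis by (intro that[of U V]) auto
qed

lemma L_T: assumes "p \<in> A" obtains V where "V \<in> T p" "V \<noteq> 0" "L p = {V, - V}"
  by (rule L_local[OF assms]) (use assms that in blast)

lemma Z_T: "v \<in> Z p \<Longrightarrow> v \<in> T p"
proof (cases "p \<in> A")
  case True
  assume "v \<in> Z p"
  moreover obtain V where "V \<in> T p" "L p = {V, - V}" by (rule L_T[OF True])
  ultimately show ?thesis using subspace_neg[OF subspace_T, of V p] True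
    by (auto simp: Z_def)
qed (simp add: Z_def)

lemma timelike_Z:
  assumes "p \<notin> A"
  obtains t where "t \<in> Z p" "gt p t t < 0" "\<And>v. v \<in> T p \<Longrightarrow> v \<noteq> 0 \<Longrightarrow> gt p t v = 0 \<Longrightarrow> gt p v v > 0"
proof -
  obtain t where t: "t \<in> T p" "gt p t t < 0" "\<And>v. v \<in> T p \<Longrightarrow> v \<noteq> 0 \<Longrightarrow> gt p t v = 0 \<Longrightarrow> gt p v v > 0"
    by (rule lorentzian_timelike[OF outside_lorentzian[OF assms]]) (rule that)
  moreover have "t \<noteq> 0" using t gt.zero_left[OF t(1)] by auto
  ultimately show ?thesis by (intro that[of t]) (auto simp: Z_def)
qed

lemma Z_nonempty: "Z p \<noteq> {}"
proof (cases "p \<in> A")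
  case True
  obtain V where "L p = {V, - V}" by (rule L_T[OF True])
  then have "V \<in> Z p" using True by (simp add: Z_def)
  then show ?thesis by blast
next
  case False
  show ?thesis by (rule timelike_Z[OF False]) blast
qed

text \<open>Each region has its own reason. On \<open>H\<close> both covectors are multiples of the
  differential of the determinant. On \<open>MR\<close> there are no causal vectors and
  \<open>Z p\<close> is a single pair of opposite vectors. Outside \<open>A\<close> the concavity
  argument of \<open>causal_sign_agree\<close> compares every causal vector with one timelike
  vector.\<close>

lemma adm_dichotomy:
  assumes B: "adm p B" "adm p B'"
  shows "(\<forall>v\<in>Z p. B v * B' v > 0) \<or> (\<forall>v\<in>Z p. B v * B' v < 0)"
proof -
  have cov: "covector_on (T p) B" "covector_on (T p) B'" using B by (auto simp: adm_def)
  have nz: "B v \<noteq> 0" "B' v \<noteq> 0" if "v \<in> Z p" for v using B that by (auto simp: adm_def)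
  consider "p \<in> H" | "p \<in> MR" | "p \<notin> A" by (auto simp: A_def)
  then show ?thesis
  proof cases
    case 1
    obtain c where c: "c \<in> S" "p \<in> dom_chart c" by (rule chart_around)
    let ?D = "differential S (detG c) p"
    have D: "covector_on (T p) ?D" by (rule differential_covector[OF c detG_differentiable[OF c]])
    obtain r where r: "r \<in> radical_on (T p) (gt p)" "r \<in> T p" "r \<noteq> 0" by (rule in_H_radical[OF 1])
    have Dr: "?D r \<noteq> 0" using radical_tangent[OF 1 r(1)] tangent_H_iff[OF 1 c r(2)] r(3) by blast
    have "r \<in> Z p" using r radical_iff by (auto simp: Z_def)
    then have Br: "B r * B' r \<noteq> 0" using nz by simp
    \<comment> \<open>Every vector is a multiple of the radical vector \<open>r\<close> plus a
      vector tangent to \<open>H\<close>, and \<open>C\<close> annihilates the latter. So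
      \<open>C\<close> is determined by its value at \<open>r\<close>.\<close>
    have eq: "C u = (?D u / ?D r) * C r" if u: "u \<in> T p" and C: "adm p C" for u C
    proof -
      let ?k = "?D u / ?D r"
      have s: "(- ?k) *\<^sub>R r \<in> T p" "u + (- ?k) *\<^sub>R r \<in> T p"
        by (intro subspace_add[OF subspace_T] subspace_scale[OF subspace_T] u r(2))+
      have "?D (u + (- ?k) *\<^sub>R r) = ?D u + (- ?k) * ?D r"
        using D u r(2) s(1) unfolding covector_on_def by metis
      then have "?D (u + (- ?k) *\<^sub>R r) = 0" using Dr by simp
      then have "u + (- ?k) *\<^sub>R r \<in> Y p" using tangent_H_iff[OF 1 c s(2)] 1 by (simp add: Y_def)
      then have "C (u + (- ?k) *\<^sub>R r) = 0" using C unfolding adm_def by blast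
      moreover have "C (u + (- ?k) *\<^sub>R r) = C u + (- ?k) * C r"
        using C u r(2) s(1) unfolding adm_def covector_on_def by metis
      ultimately show ?thesis by simp
    qed
    have prod: "B v * B' v = (?D v / ?D r)\<^sup>2 * (B r * B' r)" if "v \<in> Z p" for v
      using eq[OF Z_T[OF that] B(1)] eq[OF Z_T[OF that] B(2)] by (simp add: power2_eq_square)
    have Dv: "(?D v / ?D r)\<^sup>2 > 0" if "v \<in> Z p" for v
      using eq[OF Z_T[OF that] B(1)] nz[OF that] by auto
    show ?thesis
    proof (cases "B r * B' r > 0")
      case True
      then show ?thesis using prod Dv by (simp del: zero_less_power2)
    next
      case False
      then have "B r * B' r < 0" using Br by linarith
      then show ?thesis using prod Dv by (metis mult_pos_neg)
    qed
  next
    case 2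
    then have "p \<in> A" by (simp add: A_def)
    then obtain V where V: "V \<in> T p" "V \<noteq> 0" "L p = {V, - V}" by (rule L_T)
    have "Z p = {V, - V}"
      using MR_positive[OF 2] V \<open>p \<in> A\<close> by (force simp: Z_def)
    moreover have "B V * B' V \<noteq> 0" using nz calculation by simp
    moreover have "B (- V) * B' (- V) = B V * B' V"
      using covector_minus[OF cov(1) V(1)] covector_minus[OF cov(2) V(1)] by simp
    ultimately show ?thesis by (metis empty_iff insert_iff linorder_neqE)
  next
    case 3
    obtain c where c: "c \<in> S" "p \<in> dom_chart c" by (rule chart_around)
    obtain t where t: "t \<in> Z p" "gt p t t < 0" by (rule timelike_Z[OF 3]) (rule that)
    have tT: "t \<in> T p" using t(1) by (rule Z_T)
    have Z: "v \<in> Z p \<longleftrightarrow> v \<in> T p \<and> v \<noteq> 0 \<and> gt p v v \<le> 0" for v using 3 by (simp add: Z_def)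
    define b where "b = covec_comp S c p B"
    have b: "B v = b \<bullet> v c" if "v \<in> T p" for v unfolding b_def by (rule covector_comp[OF cov(1) c that])
    have pos: "x \<bullet> (G c p *v x) > 0"
      if C: "adm p C" and x: "x \<noteq> 0" "\<beta> \<bullet> x = 0" and \<beta>: "\<And>v. v \<in> T p \<Longrightarrow> (C v = 0) = (\<beta> \<bullet> v c = 0)" for C x \<beta>
    proof -
      let ?v = "coord_vec S c p x"
      have v: "?v \<in> T p" "?v c = x" using coord_vec_T[OF c] coord_vec_app[OF c] by auto
      have "C ?v = 0" using \<beta>[OF v(1)] v(2) x(2) by simp
      then have "?v \<notin> Z p" using C unfolding adm_def by blast
      moreover have "?v \<noteq> 0" using T_eq_0_iff[OF c v(1)] v(2) x(1) by simp
      ultimately have "gt p ?v ?v > 0" using Z v(1) by auto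
      then show ?thesis using gt_G[OF c v(1) v(1)] v(2) by simp
    qed
    \<comment> \<open>\<open>b'\<close> is left general so that it can be the components of
      \<open>B'\<close> or their negatives; the second choice reduces the case of opposite signs to
      that of equal signs.\<close>
    have key: "(b \<bullet> v c) * (b' \<bullet> v c) > 0"
      if v: "v \<in> Z p" and b': "(b \<bullet> t c) * (b' \<bullet> t c) > 0"
        "\<And>v. v \<in> T p \<Longrightarrow> (B' v = 0) = (b' \<bullet> v c = 0)" for v b'
    proof (rule causal_sign_agree[OF G_sym[OF c], of b b' "t c"])
      show "t c \<bullet> (G c p *v t c) < 0" using t gt_G[OF c tT tT] by simp
      show "v c \<bullet> (G c p *v v c) \<le> 0" "v c \<noteq> 0"
        using v Z gt_G[OF c, of v v] T_eq_0_iff[OF c, of v] by auto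
      show "x \<bullet> (G c p *v x) > 0" if "x \<noteq> 0" "b \<bullet> x = 0" for x
        using pos[OF B(1) that] b by simp
      show "x \<bullet> (G c p *v x) > 0" if "x \<noteq> 0" "b' \<bullet> x = 0" for x
        using pos[OF B(2) that b'(2)] .
    qed (rule b'(1))
    define b' where "b' = covec_comp S c p B'"
    have b': "B' v = b' \<bullet> v c" if "v \<in> T p" for v unfolding b'_def by (rule covector_comp[OF cov(2) c that])
    show ?thesis
    proof (cases "(b \<bullet> t c) * (b' \<bullet> t c) > 0")
      case True
      then have "B v * B' v > 0" if "v \<in> Z p" for v
        using key[OF that True] b b' Z_T[OF that] by simp
      then show ?thesis by blast
    next
      case False
      moreover have "(b \<bullet> t c) * (b' \<bullet> t c) \<noteq> 0" using nz[OF t(1)] b[OF tT] b'[OF tT] by simp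
      ultimately have "(b \<bullet> t c) * (b' \<bullet> t c) < 0" by linarith
      then have neg: "(b \<bullet> t c) * (- b' \<bullet> t c) > 0" by (simp add: inner_minus_left)
      have "B v * B' v < 0" if "v \<in> Z p" for v
        using key[OF that neg] b b' Z_T[OF that] by (simp add: inner_minus_left)
      then show ?thesis by blast
    qed
  qed
qed

lemma covec_comp_cont:
  assumes "c \<in> S" "open U" "smooth_covector S U W"
  shows "continuous_on (dom_chart c \<inter> U) (\<lambda>x. covec_comp S c x (W x))"
  by (rule continuous_on_transfer[OF assms(1) smooth_covector_comp[OF assms(3,1)]]) (use assms in auto)

text \<open>The two parts of \<open>Z\<close> are treated separately. For the causal vectors the
  condition is homogeneous in the fibre, so \<open>homogeneous_fibre_open\<close> applies. For the
  line it suffices to follow a local vector field \<open>V\<close> by continuity; the product is the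
  same for \<open>V\<close> and \<open>- V\<close>. Outside \<open>A\<close> the line part is empty
  on a whole neighbourhood because \<open>A\<close> is closed.\<close>

lemma same_sign_open:
  assumes U: "open U" "p \<in> U" and W: "smooth_covector S U W" "smooth_covector S U W'"
    and pos: "\<forall>v\<in>Z p. W p v * W' p v > 0"
  shows "\<exists>N. open N \<and> p \<in> N \<and> N \<subseteq> U \<and> (\<forall>q\<in>N. \<forall>v\<in>Z q. W q v * W' q v > 0)"
proof -
  obtain c where c: "c \<in> S" "p \<in> dom_chart c" by (rule chart_around)
  define w w' where "w = (\<lambda>x. covec_comp S c x (W x))" and "w' = (\<lambda>x. covec_comp S c x (W' x))"
  have cont: "continuous_on (dom_chart c \<inter> U) w" "continuous_on (dom_chart c \<inter> U) w'"
    unfolding w_def w'_def by (rule covec_comp_cont[OF c(1) U(1)]; rule W)+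
  have w: "W x v = w x \<bullet> v c" "W' x v = w' x \<bullet> v c" if "x \<in> dom_chart c \<inter> U" "v \<in> T x" for x v
    unfolding w_def w'_def using covector_comp[OF smooth_covectorD[OF W(1)] c(1)]
      covector_comp[OF smooth_covectorD[OF W(2)] c(1)] that by auto
  let ?\<Omega> = "dom_chart c \<inter> U"
  define p1 where "p1 = (\<lambda>(x, v). v \<bullet> (G c x *v v))"
  define p2 where "p2 = (\<lambda>(x, v). (w x \<bullet> v) * (w' x \<bullet> v))"
  have fst: "continuous_on (?\<Omega> \<times> (UNIV :: (real ^ 'n) set)) (\<lambda>z. f (fst z))" if "continuous_on ?\<Omega> f"
    for f :: "'m \<Rightarrow> 'z::topological_space"
    by (rule continuous_on_compose2[OF that continuous_on_fst]) auto
  have "open ?\<Omega>" "p \<in> ?\<Omega>" using U c open_dom[OF c(1)] by auto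
  then obtain N1 where N1: "open N1" "p \<in> N1" "N1 \<subseteq> ?\<Omega>"
    "\<And>x v. x \<in> N1 \<Longrightarrow> v \<noteq> 0 \<Longrightarrow> p1 (x, v) \<le> 0 \<Longrightarrow> p2 (x, v) > 0"
  proof (rule homogeneous_fibre_open[of ?\<Omega> p p1 p2])
    have Gc: "continuous_on (?\<Omega> \<times> (UNIV :: (real ^ 'n) set)) (\<lambda>z. G c (fst z) $ i $ j)" for i j
      by (rule fst[of "\<lambda>x. G c x $ i $ j"], rule continuous_on_subset[OF G_cont[OF c(1)]]) auto
    have sc: "continuous_on (?\<Omega> \<times> (UNIV :: (real ^ 'n) set)) (\<lambda>z. snd z $ i)" for i
      by (intro continuous_intros)
    have "p1 = (\<lambda>z. \<Sum>i\<in>UNIV. snd z $ i * (\<Sum>j\<in>UNIV. G c (fst z) $ i $ j * snd z $ j))"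
      by (simp add: p1_def fun_eq_iff inner_vec_def matrix_vector_mult_def)
    then show "continuous_on (?\<Omega> \<times> UNIV) p1"
      by (simp only:) (intro continuous_on_sum continuous_on_mult Gc sc)
    show "continuous_on (?\<Omega> \<times> UNIV) p2"
      unfolding p2_def case_prod_beta by (intro continuous_intros fst[of w] fst[of w'] cont)
    show "p1 (x, t *\<^sub>R v) = t\<^sup>2 * p1 (x, v)" "p2 (x, t *\<^sub>R v) = t\<^sup>2 * p2 (x, v)" for x v t
      by (simp_all add: p1_def p2_def matrix_vector_mult_scaleR power2_eq_square)
    fix x :: "real ^ 'n" assume x: "x \<noteq> 0" "p1 (p, x) \<le> 0"
    let ?v = "coord_vec S c p x"
    have v: "?v \<in> T p" "?v c = x" using coord_vec_T[OF c] coord_vec_app[OF c] by auto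
    moreover have "?v \<noteq> 0" using T_eq_0_iff[OF c v(1)] v(2) x(1) by simp
    moreover have "gt p ?v ?v \<le> 0" using gt_G[OF c v(1) v(1)] v(2) x(2) by (simp add: p1_def)
    ultimately have "?v \<in> Z p" by (simp add: Z_def)
    then have "W p ?v * W' p ?v > 0" using pos by blast
    then show "p2 (p, x) > 0"
      using w[of p ?v] v U(2) c(2) by (simp add: p2_def)
  qed (rule that)
  have "\<exists>N2. open N2 \<and> p \<in> N2 \<and> N2 \<subseteq> ?\<Omega> \<and> (\<forall>x\<in>N2 \<inter> A. \<forall>v\<in>L x. W x v * W' x v > 0)"
  proof (cases "p \<in> A")
    case False
    then show ?thesis
      using closed_A U c open_dom[OF c(1)] by (intro exI[of _ "?\<Omega> \<inter> - A"]) auto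
  next
    case True
    obtain U2 V where V: "open U2" "p \<in> U2" "smooth_vector_field S U2 V"
      "\<And>q. q \<in> U2 \<Longrightarrow> q \<in> A \<Longrightarrow> V q \<in> T q" "\<And>q. q \<in> U2 \<Longrightarrow> q \<in> A \<Longrightarrow> V q \<noteq> 0"
      "\<And>q. q \<in> U2 \<Longrightarrow> q \<in> A \<Longrightarrow> L q = {V q, - V q}"
      by (rule L_local[OF True]) (rule that)
    have Vc: "continuous_on (dom_chart c \<inter> U2) (\<lambda>x. V x c)"
    proof (rule continuous_on_transfer[OF c(1)])
      show "smooth_on (app_chart c ` (dom_chart c \<inter> U2)) (\<lambda>x. V (inv_chart c x) c)"
        using V(3) c(1) by (simp add: smooth_vector_field_def)
    qed (use c in auto)
    define k where "k = (\<lambda>x. (w x \<bullet> V x c) * (w' x \<bullet> V x c))"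
    have "continuous_on (?\<Omega> \<inter> U2) k"
      unfolding k_def
      by (intro continuous_intros continuous_on_subset[OF cont(1)] continuous_on_subset[OF cont(2)]
          continuous_on_subset[OF Vc]) auto
    then have "open (?\<Omega> \<inter> U2 \<inter> k -` {0<..})"
      by (rule continuous_open_preimage) (use U V open_dom[OF c(1)] in auto)
    moreover have "p \<in> ?\<Omega> \<inter> U2 \<inter> k -` {0<..}"
    proof -
      have "V p \<in> Z p" using V(6)[OF V(2) True] True by (simp add: Z_def)
      then have "W p (V p) * W' p (V p) > 0" using pos by blast
      then show ?thesis using w[of p "V p"] V(2,4) True U c by (simp add: k_def)
    qed
    moreover have "W x v * W' x v > 0" if x: "x \<in> ?\<Omega> \<inter> U2 \<inter> k -` {0<..}" "x \<in> A" and v: "v \<in> L x" for x v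
    proof -
      have xO: "x \<in> ?\<Omega>" "x \<in> U" "x \<in> U2" using x by auto
      have VT: "V x \<in> T x" using V(4) xO x by blast
      have "W x (V x) * W' x (V x) > 0"
        using x w[OF xO(1) VT] by (simp add: k_def)
      moreover have "v = V x \<or> v = - V x" using V(6)[OF xO(3) x(2)] v by simp
      ultimately show ?thesis
        using covector_minus[OF smooth_covectorD[OF W(1) xO(2)] VT]
          covector_minus[OF smooth_covectorD[OF W(2) xO(2)] VT] by auto
    qed
    ultimately show ?thesis by (intro exI[of _ "?\<Omega> \<inter> U2 \<inter> k -` {0<..}"]) auto
  qed
  then obtain N2 where N2: "open N2" "p \<in> N2" "N2 \<subseteq> ?\<Omega>"
    "\<And>x v. x \<in> N2 \<Longrightarrow> x \<in> A \<Longrightarrow> v \<in> L x \<Longrightarrow> W x v * W' x v > 0" by blast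
  have "W x v * W' x v > 0" if x: "x \<in> N1 \<inter> N2" and v: "v \<in> Z x" for x v
  proof (cases "x \<in> A \<and> v \<in> L x")
    case True
    then show ?thesis using N2(4) x by blast
  next
    case False
    then have v': "v \<in> T x" "v \<noteq> 0" "gt x v v \<le> 0" using v by (auto simp: Z_def split: if_splits)
    have x': "x \<in> ?\<Omega>" "x \<in> dom_chart c" using x N1(3) by auto
    have "v c \<noteq> 0" using T_eq_0_iff[OF c(1) x'(2) v'(1)] v'(2) by simp
    moreover have "p1 (x, v c) \<le> 0" using gt_G[OF c(1) x'(2) v'(1,1)] v'(3) by (simp add: p1_def)
    ultimately have "p2 (x, v c) > 0" using N1(4) x by blast
    then show ?thesis using w[OF x'(1) v'(1)] by (simp add: p2_def)
  qed
  then show ?thesis using N1 N2 by (intro exI[of _ "N1 \<inter> N2"]) auto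
qed

text \<open>Comparing \<open>W\<close> with itself, positivity of W * W is non-vanishing, so
  \<open>same_sign_open\<close> spreads non-vanishing on \<open>Z\<close> from \<open>p\<close> to a
  neighbourhood.\<close>

lemma adm_local_from:
  assumes "open U" "p \<in> U" "smooth_covector S U W" "\<And>v. v \<in> Z p \<Longrightarrow> W p v \<noteq> 0"
    and "\<And>q v. q \<in> U \<Longrightarrow> v \<in> Y q \<Longrightarrow> W q v = 0"
  shows "\<exists>U W. open U \<and> p \<in> U \<and> smooth_covector S U W \<and> (\<forall>q\<in>U. adm q (W q))"
proof -
  have "\<forall>v\<in>Z p. W p v * W p v > 0" using assms(4) by (simp add: zero_less_mult_iff linorder_neq_iff disj_commute)
  from same_sign_open[OF assms(1-3,3) this]
  obtain N where N: "open N" "p \<in> N" "N \<subseteq> U" "\<And>q v. q \<in> N \<Longrightarrow> v \<in> Z q \<Longrightarrow> W q v * W q v > 0" by blast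
  have "adm q (W q)" if "q \<in> N" for q
  proof -
    have "W q v \<noteq> 0" if "v \<in> Z q" for v using N(4)[OF \<open>q \<in> N\<close> that] by auto
    then show ?thesis
      unfolding adm_def using smooth_covectorD[OF assms(3)] assms(5) N(3) \<open>q \<in> N\<close> by blast
  qed
  then show ?thesis using N(1,2) smooth_covector_subset[OF assms(3) N(3)] by blast
qed

text \<open>The set \<open>Y\<close> is empty off \<open>H\<close>, so there any covector that is
  admissible at \<open>p\<close> may be extended with constant coefficients in the chart.\<close>

lemma adm_local_const:
  assumes p: "p \<notin> H" and c: "c \<in> S" "p \<in> dom_chart c" and b: "\<And>v. v \<in> Z p \<Longrightarrow> b \<bullet> v c \<noteq> 0"
  shows "\<exists>U W. open U \<and> p \<in> U \<and> smooth_covector S U W \<and> (\<forall>q\<in>U. adm q (W q))"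
proof (rule adm_local_from[where W = "\<lambda>q v. b \<bullet> v c"])
  let ?U = "dom_chart c \<inter> detG c -` (- {0})"
  show U: "open ?U" by (rule continuous_open_preimage[OF detG_cont[OF c(1)] open_dom[OF c(1)]]) auto
  show "p \<in> ?U" using p c H_iff_det[OF c] by simp
  have "?U \<subseteq> dom_chart c" by blast
  have "smooth_on (app_chart c ` ?U) (\<lambda>x. b)"
    by (rule smooth_on_const) (use open_app_image[OF c(1) U] in \<open>simp add: Int_absorb1\<close>)
  from smooth_covector_chart[OF c(1) U _ this] show "smooth_covector S ?U (\<lambda>q v. b \<bullet> v c)" by blast
  show "b \<bullet> v c = 0" if "q \<in> ?U" "v \<in> Y q" for q v
    using that H_iff_det[OF c(1), of q] by (auto simp: Y_def)
qed (rule b)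

lemma adm_local: "\<exists>U W. open U \<and> p \<in> U \<and> smooth_covector S U W \<and> (\<forall>q\<in>U. adm q (W q))"
proof -
  obtain c where c: "c \<in> S" "p \<in> dom_chart c" by (rule chart_around)
  consider "p \<in> H" | "p \<in> MR" "p \<notin> H" "p \<in> A" | "p \<notin> A" "p \<notin> H" by (auto simp: A_def)
  then show ?thesis
  proof cases
    case 1
    let ?F = "detG c \<circ> inv_chart c"
    define \<phi> where "\<phi> = (\<lambda>x. \<chi> i. frechet_derivative ?F (at x) (axis i 1))"
    let ?W = "\<lambda>q v. \<phi> (app_chart c q) \<bullet> v c"
    have \<phi>: "smooth_on (app_chart c ` dom_chart c) \<phi>"
      by (rule smooth_on_vecI[OF open_img[OF c(1)]])
        (simp add: \<phi>_def smooth_on_frechet_derivative[OF detG_smooth[OF c(1)]])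
    have W: "?W q v = differential S (detG c) q v" if q: "q \<in> dom_chart c" "v \<in> T q" for q v
    proof -
      have lin: "linear (frechet_derivative ?F (at (app_chart c q)))"
        by (rule linear_frechet_derivative[OF detG_differentiable[OF c(1) q(1)]])
      have "frechet_derivative ?F (at (app_chart c q)) (v c)
          = frechet_derivative ?F (at (app_chart c q)) (\<Sum>i\<in>UNIV. (v c $ i) *\<^sub>R axis i 1)"
        using basis_expansion[of "v c"] by (simp add: scalar_mult_eq_scaleR)
      also have "\<dots> = ?W q v"
        by (simp add: linear_sum[OF lin] linear_scale[OF lin] \<phi>_def inner_vec_def mult.commute)
      finally show ?thesis
        using differential_chart[OF c(1) q(1) detG_differentiable[OF c(1) q(1)] q(2)] by simp
    qed
    show ?thesis
    proof (rule adm_local_from[where W = ?W])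
      show "open (dom_chart c)" "p \<in> dom_chart c" using open_dom c by auto
      show "smooth_covector S (dom_chart c) ?W"
        by (rule smooth_covector_chart[OF c(1) open_dom[OF c(1)] order_refl \<phi>])
      show "?W q v = 0" if "q \<in> dom_chart c" "v \<in> Y q" for q v
      proof -
        have q: "q \<in> H" "v \<in> tangent_space_sub S H q" using that by (auto simp: Y_def split: if_splits)
        then have "v \<in> T q" by (simp add: tangent_space_sub_def)
        then show ?thesis using W[OF that(1)] tangent_H_iff[OF q(1) c(1) that(1)] q(2) by simp
      qed
      \<comment> \<open>A vector of \<open>Z p\<close> annihilated by the differential would be
        tangent to \<open>H\<close>. The given line is transverse to \<open>H\<close> by assumption,
        and causal vectors are radical, hence transverse as well.\<close>
      show "?W p v \<noteq> 0" if v: "v \<in> Z p" for v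
      proof
        assume "?W p v = 0"
        then have t: "v \<in> tangent_space_sub S H p"
          using W[OF c(2) Z_T[OF v]] tangent_H_iff[OF 1 c Z_T[OF v]] by simp
        show False
        proof (cases "v \<in> L p")
          case True
          then show ?thesis using L_transverse 1 t unfolding transverse_line_field_def by blast
        next
          case False
          then have "v \<in> T p" "v \<noteq> 0" "gt p v v \<le> 0" using v by (auto simp: Z_def split: if_splits)
          then show ?thesis using H_null_radical[OF 1] radical_tangent[OF 1 _ t] by blast
        qed
      qed
    qed
  next
    case 2
    obtain V where V: "V \<in> T p" "V \<noteq> 0" "L p = {V, - V}" by (rule L_T[OF 2(3)])
    have Z: "Z p = {V, - V}" using MR_positive[OF 2(1)] V 2(3) by (force simp: Z_def)
    \<comment> \<open>The covector is the Euclidean dual of \<open>V c\<close> in the chart; on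
      \<open>Z p\<close> it takes the values plus and minus the squared norm of
      \<open>V c\<close>.\<close>
    have "V c \<noteq> 0" using T_eq_0_iff[OF c V(1)] V(2) by simp
    then show ?thesis
      by (intro adm_local_const[OF 2(2) c, of "V c"]) (auto simp: Z)
  next
    case 3
    obtain t where t: "t \<in> Z p" "\<And>v. v \<in> T p \<Longrightarrow> v \<noteq> 0 \<Longrightarrow> gt p t v = 0 \<Longrightarrow> gt p v v > 0"
      by (rule timelike_Z[OF 3(1)]) (rule that)
    have tT: "t \<in> T p" by (rule Z_T[OF t(1)])
    have "(G c p *v t c) \<bullet> v c \<noteq> 0" if "v \<in> Z p" for v
    proof -
      have v: "v \<in> T p" "v \<noteq> 0" "gt p v v \<le> 0" using that 3(1) by (auto simp: Z_def)
      then have "gt p t v \<noteq> 0" using t(2) by fastforce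
      then show ?thesis using gt.sym[OF tT v(1)] gt_G[OF c v(1) tT] by (simp add: inner_commute)
    qed
    then show ?thesis by (rule adm_local_const[OF 3(2) c])
  qed
qed

text \<open>Non-vanishing on causal vectors, read contrapositively, is positivity on the kernel;
  non-vanishing on the non-empty set \<open>Z q\<close> makes the covector non-zero.\<close>

proposition spacelike_covector_field:
  obtains B where "\<And>p. \<exists>U W. open U \<and> p \<in> U \<and> smooth_covector S U W \<and> (\<forall>q\<in>U.
     (\<forall>v\<in>T q. v \<noteq> 0 \<longrightarrow> W q v = 0 \<longrightarrow> gt q v v > 0) \<and> (\<exists>v\<in>T q. W q v \<noteq> 0) \<and>
     (B q = W q \<or> B q = (\<lambda>v. - W q v)))"
proof -
  obtain B where B: "\<And>p. \<exists>U W. open U \<and> p \<in> U \<and> smooth_covector S U W \<and>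
     (\<forall>q\<in>U. adm q (W q) \<and> (B q = W q \<or> B q = (\<lambda>v. - W q v)))"
  proof (rule glue_covectors[of Z Y, folded adm_def])
    show "Z p \<noteq> {}" for p by (rule Z_nonempty)
    show "\<exists>U W. open U \<and> p \<in> U \<and> smooth_covector S U W \<and> (\<forall>q\<in>U. adm q (W q))" for p
      by (rule adm_local)
  next
    fix p C C' assume "adm p C" "adm p C'"
    then show "(\<forall>v\<in>Z p. C v * C' v > 0) \<or> (\<forall>v\<in>Z p. C v * C' v < 0)" by (rule adm_dichotomy)
  next
    fix p U W W'
    assume "open U" "p \<in> U" "smooth_covector S U W" "smooth_covector S U W'" "\<forall>v\<in>Z p. W p v * W' p v > 0"
    then show "\<exists>N. open N \<and> p \<in> N \<and> N \<subseteq> U \<and> (\<forall>q\<in>N. \<forall>v\<in>Z q. W q v * W' q v > 0)"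
      by (rule same_sign_open)
  qed (rule that)
  show ?thesis
  proof (rule that)
    fix p
    from B[of p] obtain U W where U: "open U" "p \<in> U" "smooth_covector S U W"
      and UW: "\<forall>q\<in>U. adm q (W q) \<and> (B q = W q \<or> B q = (\<lambda>v. - W q v))"
      by (elim exE conjE) (rule that)
    have "(\<forall>v\<in>T q. v \<noteq> 0 \<longrightarrow> W q v = 0 \<longrightarrow> gt q v v > 0) \<and> (\<exists>v\<in>T q. W q v \<noteq> 0)" if "q \<in> U" for q
    proof (intro conjI ballI impI)
      fix v assume "v \<in> T q" "v \<noteq> 0" "W q v = 0"
      then show "gt q v v > 0" using UW that unfolding adm_def Z_def by force
    next
      obtain z where "z \<in> Z q" using Z_nonempty by blast
      then show "\<exists>v\<in>T q. W q v \<noteq> 0" using UW that Z_T unfolding adm_def by blast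
    qed
    then show "\<exists>U W. open U \<and> p \<in> U \<and> smooth_covector S U W \<and> (\<forall>q\<in>U.
     (\<forall>v\<in>T q. v \<noteq> 0 \<longrightarrow> W q v = 0 \<longrightarrow> gt q v v > 0) \<and> (\<exists>v\<in>T q. W q v \<noteq> 0) \<and>
     (B q = W q \<or> B q = (\<lambda>v. - W q v)))"
      using U UW by (intro exI[of _ U] exI[of _ W]) simp
  qed
qed

end

section \<open>The Lorentzian metric of a covector field\<close>

text \<open>Pairing with the basis vectors reads off each coefficient up to sign. This is what later
  shows that the radical at \<open>H\<close> is spanned by \<open>V\<close>.\<close>

lemma (in sym_form) lorentzian_nondegenerate:
  assumes "lorentzian_on T h" "x \<in> T" "\<And>w. w \<in> T \<Longrightarrow> h x w = 0"
  shows "x = 0"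
proof -
  obtain E t where E: "independent E" "span E = T" "t \<in> E" "h t t = -1"
    "\<And>e. e \<in> E - {t} \<Longrightarrow> h e e = 1" "\<And>e e'. e \<in> E \<Longrightarrow> e' \<in> E \<Longrightarrow> e \<noteq> e' \<Longrightarrow> h e e' = 0"
    by (rule lorentzian_onE[OF assms(1)]) (rule that)
  have ET: "E \<subseteq> T" using E(2) span_superset by blast
  obtain F r where F: "finite F" "F \<subseteq> E" "x = (\<Sum>e\<in>F. r e *\<^sub>R e)"
    using assms(2) E(2) unfolding span_explicit by blast
  have "r e = 0" if e: "e \<in> F" for e
  proof -
    have eT: "e \<in> T" using e F ET by blast
    have rT: "r y *\<^sub>R y \<in> T" "y \<in> T" if "y \<in> F" for y using that F ET subspace_scale[OF T] by blast+
    have "h x e = (\<Sum>y\<in>F. h (r y *\<^sub>R y) e)"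
      unfolding F(3) by (rule sum_left[OF rT(1) eT])
    also have "\<dots> = (\<Sum>y\<in>F. if y = e then r e * h e e else 0)"
      using E(6) F e by (intro sum.cong refl) (auto simp: scale_left[OF rT(2) eT])
    also have "\<dots> = r e * h e e" using e F(1) by simp
    finally show ?thesis using assms(3)[OF eT] E(4) E(5)[of e] F e by (cases "e = t") auto
  qed
  then show ?thesis unfolding F(3) by (intro sum.neutral) auto
qed

lemma sym_bilinear_on_rank_one:
  assumes "sym_bilinear_on T b" "covector_on T B"
  shows "sym_bilinear_on T (\<lambda>u w. b u w + k * (B u * B w))"
  using assms unfolding sym_bilinear_on_def covector_on_def
  by (auto simp: algebra_simps)

lemma det_scale_column:
  fixes M :: "real ^ 'n ^ 'n"
  shows "det (\<chi> i j. if j = k then c * b $ i else M $ i $ j)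
    = c * det (\<chi> i j. if j = k then b $ i else M $ i $ j)"
proof -
  have "det (\<chi> i j. if j = k then c * b $ i else M $ i $ j)
      = det (transpose (\<chi> i j. if j = k then c * b $ i else M $ i $ j))"
    by simp
  also have "transpose (\<chi> i j. if j = k then c * b $ i else M $ i $ j)
      = (\<chi> i. if i = k then c *s b else (\<chi> j. M $ j $ i))"
    by (simp add: vec_eq_iff transpose_def)
  also have "det \<dots> = c * det (\<chi> i. if i = k then b else (\<chi> j. M $ j $ i))"
    by (rule det_row_mul)
  also have "(\<chi> i. if i = k then b else (\<chi> j. M $ j $ i))
      = transpose (\<chi> i j. if j = k then b $ i else M $ i $ j)"
    by (simp add: vec_eq_iff transpose_def)
  finally show ?thesis by simp
qed

locale spacelike_covector = transverse_radical_metric S gt MR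
  for S :: "('m::{t2_space, second_countable_topology}, 'n::finite) chart set"
    and gt :: "('m, 'n) tensor02" and MR :: "'m set" +
  fixes B :: "'m \<Rightarrow> ('m, 'n) tvec \<Rightarrow> real"
  assumes B: "\<And>p. \<exists>U W. open U \<and> p \<in> U \<and> smooth_covector S U W \<and> (\<forall>q\<in>U.
     (\<forall>v\<in>T q. v \<noteq> 0 \<longrightarrow> W q v = 0 \<longrightarrow> gt q v v > 0) \<and> (\<exists>v\<in>T q. W q v \<noteq> 0) \<and>
     (B q = W q \<or> B q = (\<lambda>v. - W q v)))"
begin

lemma B_local:
  obtains U W where "open U" "p \<in> U" "smooth_covector S U W"
    "\<And>q v. q \<in> U \<Longrightarrow> v \<in> T q \<Longrightarrow> v \<noteq> 0 \<Longrightarrow> W q v = 0 \<Longrightarrow> gt q v v > 0"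
    "\<And>q. q \<in> U \<Longrightarrow> \<exists>v\<in>T q. W q v \<noteq> 0"
    "\<And>q. q \<in> U \<Longrightarrow> B q = W q \<or> B q = (\<lambda>v. - W q v)"
proof -
  from B[of p] obtain U W where U: "open U" "p \<in> U" "smooth_covector S U W"
    and W: "\<forall>q\<in>U. (\<forall>v\<in>T q. v \<noteq> 0 \<longrightarrow> W q v = 0 \<longrightarrow> gt q v v > 0) \<and> (\<exists>v\<in>T q. W q v \<noteq> 0) \<and>
     (B q = W q \<or> B q = (\<lambda>v. - W q v))"
    by (elim exE conjE) (rule that)
  show ?thesis by (rule that[OF U]) (use W in blast)+
qed

lemma B_covector: "covector_on (T p) (B p)"
  and B_kernel: "v \<in> T p \<Longrightarrow> v \<noteq> 0 \<Longrightarrow> B p v = 0 \<Longrightarrow> gt p v v > 0"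
  and B_nonzero: "\<exists>v\<in>T p. B p v \<noteq> 0"
proof -
  obtain U W where U: "open U" "p \<in> U" "smooth_covector S U W"
    "\<And>q v. q \<in> U \<Longrightarrow> v \<in> T q \<Longrightarrow> v \<noteq> 0 \<Longrightarrow> W q v = 0 \<Longrightarrow> gt q v v > 0"
    "\<And>q. q \<in> U \<Longrightarrow> \<exists>v\<in>T q. W q v \<noteq> 0"
    "\<And>q. q \<in> U \<Longrightarrow> B q = W q \<or> B q = (\<lambda>v. - W q v)"
    by (rule B_local) (rule that)
  show "covector_on (T p) (B p)"
    using U(6)[OF U(2)] smooth_covectorD[OF U(3,2)] by (auto simp: covector_on_def)
  show "gt p v v > 0" if "v \<in> T p" "v \<noteq> 0" "B p v = 0"
    using U(6)[OF U(2)] U(4)[OF U(2) that(1,2)] that(3) by auto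
  show "\<exists>v\<in>T p. B p v \<noteq> 0"
    using U(6)[OF U(2)] U(5)[OF U(2)] by auto
qed

lemma covector_matrix:
  assumes W: "covector_on (T p) W" "\<And>v. v \<in> T p \<Longrightarrow> v \<noteq> 0 \<Longrightarrow> W v = 0 \<Longrightarrow> gt p v v > 0" "\<exists>v\<in>T p. W v \<noteq> 0"
    and c: "c \<in> S" "p \<in> dom_chart c"
  shows "covec_comp S c p W \<noteq> 0"
    and "x \<noteq> 0 \<Longrightarrow> covec_comp S c p W \<bullet> x = 0 \<Longrightarrow> x \<bullet> (G c p *v x) > 0"
proof -
  have b: "W v = covec_comp S c p W \<bullet> v c" if "v \<in> T p" for v by (rule covector_comp[OF W(1) c that])
  then show "covec_comp S c p W \<noteq> 0" using W(3) by fastforce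
  assume x: "x \<noteq> 0" "covec_comp S c p W \<bullet> x = 0"
  let ?v = "coord_vec S c p x"
  have v: "?v \<in> T p" "?v c = x" using coord_vec_T[OF c] coord_vec_app[OF c] by auto
  have "?v \<noteq> 0" using T_eq_0_iff[OF c v(1)] v(2) x(1) by simp
  then have "gt p ?v ?v > 0" using W(2)[OF v(1)] b[OF v(1)] v(2) x(2) by simp
  then show "x \<bullet> (G c p *v x) > 0" using gt_G[OF c v(1) v(1)] v(2) by simp
qed

text \<open>The scalar in the dual equation is recovered by inserting \<open>v\<close> itself: since
  \<open>B p v = 1\<close>, it equals \<open>gt p v v\<close>. So only the vector has to be
  chosen.\<close>

lemma dual_exists: "\<exists>v. v \<in> T p \<and> B p v = 1 \<and> (\<forall>w\<in>T p. gt p v w = gt p v v * B p w)"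
proof -
  obtain c where c: "c \<in> S" "p \<in> dom_chart c" by (rule chart_around)
  note M = covector_matrix[OF B_covector B_kernel B_nonzero c]
  obtain x s where x: "G c p *v x = s *\<^sub>R covec_comp S c p (B p)" "covec_comp S c p (B p) \<bullet> x = 1"
    using dual_vector_exists[of "covec_comp S c p (B p)" "G c p"] M by metis
  let ?v = "coord_vec S c p x"
  have v: "?v \<in> T p" "?v c = x" using coord_vec_T[OF c] coord_vec_app[OF c] by auto
  have B1: "B p ?v = 1" using covector_comp[OF B_covector c v(1)] v(2) x(2) by simp
  have "gt p ?v w = s * B p w" if w: "w \<in> T p" for w
    using gt.sym[OF v(1) w] gt_G[OF c w v(1)] covector_comp[OF B_covector c w] v(2) x(1)
    by (simp add: inner_commute)
  then show ?thesis using v(1) B1 by (intro exI[of _ ?v]) simp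
qed

definition V :: "'m \<Rightarrow> ('m, 'n) tvec" where
  "V p = (SOME v. v \<in> T p \<and> B p v = 1 \<and> (\<forall>w\<in>T p. gt p v w = gt p v v * B p w))"

definition s :: "'m \<Rightarrow> real" where "s p = gt p (V p) (V p)"

lemma V: "V p \<in> T p" "B p (V p) = 1" "w \<in> T p \<Longrightarrow> gt p (V p) w = s p * B p w"
proof -
  have "V p \<in> T p \<and> B p (V p) = 1 \<and> (\<forall>w\<in>T p. gt p (V p) w = gt p (V p) (V p) * B p w)"
    unfolding V_def by (rule someI_ex[OF dual_exists])
  then show "V p \<in> T p" "B p (V p) = 1" "w \<in> T p \<Longrightarrow> gt p (V p) w = s p * B p w"
    unfolding s_def by blast+
qed

lemma V_nonzero: "V p \<noteq> 0"
proof
  assume "V p = 0"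
  then have "B p (0 *\<^sub>R V p) = 1" using V(2)[of p] by simp
  then show False using B_covector[of p] V(1)[of p] unfolding covector_on_def by (metis mult_zero_left zero_neq_one)
qed

text \<open>The value is forced by normalisation: subtracting f \<open>B \<otimes> B\<close> from
  \<open>gt\<close> gives g(V,.) = (s - f) B, which must equal - B.\<close>

definition f :: "'m \<Rightarrow> real" where "f p = 1 + s p"
definition g :: "('m, 'n) tensor02" where "g p u w = gt p u w + (- f p) * (B p u * B p w)"
definition LV :: "'m \<Rightarrow> ('m, 'n) tvec set" where "LV p = {V p, - V p}"

lemma g_sym: "sym_bilinear_on (T p) (g p)"
  unfolding g_def[abs_def] by (rule sym_bilinear_on_rank_one[OF gt_sym B_covector])

sublocale g: sym_form "T p" "g p" for p
  using g_sym subspace_T by unfold_locales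

lemma g_V: "w \<in> T p \<Longrightarrow> g p (V p) w = - B p w"
  by (simp add: g_def V f_def algebra_simps)

lemma g_VV: "g p (V p) (V p) = -1"
  by (simp add: g_V V)

text \<open>Adding 2 \<open>B \<otimes> B\<close> to \<open>g\<close> flips the sign of the timelike
  direction \<open>V p\<close> and leaves the kernel of \<open>B p\<close> alone. The result
  \<open>h\<close> is positive definite, and an \<open>h\<close>-orthonormal basis containing
  \<open>V p\<close> is a Lorentzian basis for \<open>g\<close>.\<close>

lemma g_lorentzian: "lorentzian_on (T p) (g p)"
proof -
  define h where "h = (\<lambda>u w. gt p u w + (1 - s p) * (B p u * B p w))"
  interpret h: sym_form "T p" h
    unfolding h_def using sym_bilinear_on_rank_one[OF gt_sym B_covector] subspace_T by unfold_locales
  have hg: "h u w = g p u w + 2 * (B p u * B p w)" for u w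
    by (simp add: h_def g_def f_def algebra_simps)
  have hV: "h (V p) w = B p w" if "w \<in> T p" for w
    using that by (simp add: hg g_V V)
  have pos: "positive_definite_on (T p) h"
    unfolding positive_definite_on_def
  proof (intro ballI impI)
    fix u assume u: "u \<in> T p" "u \<noteq> 0"
    \<comment> \<open>The \<open>h\<close>-orthogonal splitting into a multiple of
      \<open>V p\<close> and a vector \<open>k\<close> in the kernel of \<open>B p\<close>, where
      \<open>h\<close> equals \<open>gt\<close> and is positive.\<close>
    define a k where "a = B p u" and "k = u + (- a) *\<^sub>R V p"
    have aV: "(- a) *\<^sub>R V p \<in> T p" by (rule subspace_scale[OF subspace_T V(1)])
    have k: "k \<in> T p" unfolding k_def by (rule subspace_add[OF subspace_T u(1) aV])
    have "B p k = B p u + (- a) * B p (V p)"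
      using B_covector[of p] u(1) aV V(1)[of p] unfolding covector_on_def k_def by metis
    then have Bk: "B p k = 0" by (simp add: V a_def)
    have ueq: "u = k + a *\<^sub>R V p" by (simp add: k_def)
    have aV': "a *\<^sub>R V p \<in> T p" by (rule subspace_scale[OF subspace_T V(1)])
    have "h u u = h k k + 2 * a * h (V p) k + a * a * h (V p) (V p)"
      unfolding ueq
      using h.add_left[OF k aV'] h.add_right[OF k aV'] h.scale_left[OF V(1)] h.scale_right[OF _ V(1)]
        h.sym[OF k V(1)] k aV' V(1) subspace_add[OF subspace_T k aV']
      by (simp add: distrib_left mult.assoc)
    also have "\<dots> = gt p k k + a\<^sup>2"
      by (simp add: hV k V Bk) (simp add: h_def Bk power2_eq_square)
    finally have huu: "h u u = gt p k k + a\<^sup>2" .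
    show "h u u > 0"
    proof (cases "k = 0")
      case True
      then have "a \<noteq> 0" using u(2) ueq by auto
      then show ?thesis using huu True gt.zero_left[OF k] by simp
    next
      case False
      then show ?thesis using huu B_kernel[OF k False Bk] zero_le_power2[of a] by linarith
    qed
  qed
  obtain c where c: "c \<in> S" "p \<in> dom_chart c" by (rule chart_around)
  let ?F = "range (\<lambda>\<mu>. coord_vec S c p (axis \<mu> 1))"
  have F: "finite ?F" "?F \<subseteq> T p" using coord_vec_T[OF c] by auto
  have "orthonormal_on h {V p}" by (simp add: orthonormal_on_def hV V)
  from h.orthonormal_extend[OF pos F _ _ this] V(1)
  obtain E where E: "finite E" "{V p} \<subseteq> E" "E \<subseteq> T p" "orthonormal_on h E" "span E = span ({V p} \<union> ?F)"
    by auto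
  have "span E = T p"
  proof (rule equalityI)
    show "span E \<subseteq> T p" by (rule span_minimal[OF E(3) subspace_T])
    show "T p \<subseteq> span E" unfolding E(5) T_span[OF c, symmetric] by (rule span_mono) blast
  qed
  \<comment> \<open>\<open>B p\<close> is \<open>h (V p)\<close> on tangent vectors, so the other
    basis vectors lie in the kernel, where \<open>g\<close> and \<open>h\<close> agree.\<close>
  moreover have BE: "B p e = 0" if "e \<in> E - {V p}" for e
    using E(2,3,4) that hV[of e] by (auto simp: orthonormal_on_def)
  have "g p e e = 1" if "e \<in> E - {V p}" for e
    using hg[of e e] BE[OF that] E(4) that by (auto simp: orthonormal_on_def)
  moreover have "g p e e' = 0" if e: "e \<in> E" "e' \<in> E" "e \<noteq> e'" for e e'
  proof -
    have "B p e * B p e' = 0" using BE[of e] BE[of e'] e by auto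
    then show ?thesis using hg[of e e'] E(4) e by (auto simp: orthonormal_on_def)
  qed
  ultimately show ?thesis
    unfolding lorentzian_on_def
    using h.orthonormal_independent[OF E(1,3,4)] E(2) g_VV
    by (intro exI[of _ E] exI[of _ "V p"]) auto
qed

text \<open>The local representative \<open>W\<close> of \<open>B\<close> fixes the sign of \<open>V\<close>.\<close>

lemma V_local:
  obtains U W V' where "open U" "p \<in> U" "smooth_covector S U W"
    "smooth_vector_field S U V'" "\<And>q. q \<in> U \<Longrightarrow> LV q = {V' q, - V' q}"
    "\<And>q. q \<in> U \<Longrightarrow> V' q = V q \<or> V' q = - V q"
    "\<And>c. c \<in> S \<Longrightarrow> smooth_on (app_chart c ` (dom_chart c \<inter> U)) (\<lambda>x. s (inv_chart c x))"
    "\<And>q v w. q \<in> U \<Longrightarrow> B q v * B q w = W q v * W q w"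
    "\<And>c q. c \<in> S \<Longrightarrow> q \<in> U \<Longrightarrow> q \<in> dom_chart c \<Longrightarrow> G c q *v V' q c = s q *\<^sub>R covec_comp S c q (W q)"
proof -
  obtain U W where U: "open U" "p \<in> U" "smooth_covector S U W"
    "\<And>q v. q \<in> U \<Longrightarrow> v \<in> T q \<Longrightarrow> v \<noteq> 0 \<Longrightarrow> W q v = 0 \<Longrightarrow> gt q v v > 0"
    "\<And>q. q \<in> U \<Longrightarrow> \<exists>v\<in>T q. W q v \<noteq> 0"
    "\<And>q. q \<in> U \<Longrightarrow> B q = W q \<or> B q = (\<lambda>v. - W q v)"
    by (rule B_local) (rule that)
  have BW: "B q v * B q w = W q v * W q w" if "q \<in> U" for q v w
    using U(6)[OF that] by auto
  \<comment> \<open>The factor \<open>W q (V q)\<close> is 1 or -1 on \<open>U\<close>; it is the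
    sign that makes \<open>W q (V' q) = 1\<close>, so that \<open>V'\<close> solves the smooth
    system with covector \<open>W\<close>.\<close>
  define V' where "V' = (\<lambda>q. W q (V q) *\<^sub>R V q)"
  have \<eta>: "W q (V q) = 1 \<or> W q (V q) = -1" if "q \<in> U" for q
    using U(6)[OF that] V(2)[of q] by auto
  have V'pm: "V' q = V q \<or> V' q = - V q" if "q \<in> U" for q
    using \<eta>[OF that] by (auto simp: V'_def)
  have V'T: "V' q \<in> T q" for q unfolding V'_def by (rule subspace_scale[OF subspace_T V(1)])
  have cov: "covector_on (T q) (W q)" if "q \<in> U" for q by (rule smooth_covectorD[OF U(3) that])
  have WV': "W q (V' q) = 1" if "q \<in> U" for q
    using cov[OF that] V(1)[of q] \<eta>[OF that] unfolding covector_on_def V'_def by auto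
  have gV': "gt q (V' q) w = s q * W q w" if q: "q \<in> U" and w: "w \<in> T q" for q w
  proof -
    have "gt q (V' q) w = W q (V q) * (s q * B q w)"
      using gt.scale_left[OF V(1) w] V(3)[OF w] by (simp add: V'_def)
    then show ?thesis using U(6)[OF q] V(2)[of q] by auto
  qed
  have eq: "G c q *v V' q c = s q *\<^sub>R covec_comp S c q (W q)" if c: "c \<in> S" "q \<in> dom_chart c" and q: "q \<in> U" for c q
  proof (rule vector_eq_ldot[THEN iffD1], rule allI)
    fix x
    let ?w = "coord_vec S c q x"
    have w: "?w \<in> T q" "?w c = x" using coord_vec_T[OF c] coord_vec_app[OF c] by auto
    have "x \<bullet> (G c q *v V' q c) = gt q ?w (V' q)" using gt_G[OF c w(1) V'T] w(2) by simp
    also have "\<dots> = s q * W q ?w" using gt.sym[OF w(1) V'T] gV'[OF q w(1)] by simp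
    also have "\<dots> = x \<bullet> (s q *\<^sub>R covec_comp S c q (W q))"
      using covector_comp[OF cov[OF q] c w(1)] w(2) by (simp add: inner_commute)
    finally show "x \<bullet> (G c q *v V' q c) = x \<bullet> (s q *\<^sub>R covec_comp S c q (W q))" .
  qed
  have smooth: "smooth_on (app_chart c ` (dom_chart c \<inter> U)) (\<lambda>x. V' (inv_chart c x) c)"
    "smooth_on (app_chart c ` (dom_chart c \<inter> U)) (\<lambda>x. s (inv_chart c x))" if c: "c \<in> S" for c
  proof -
    let ?O = "app_chart c ` (dom_chart c \<inter> U)" and ?i = "inv_chart c"
    have dom: "?i x \<in> dom_chart c" "?i x \<in> U" if "x \<in> ?O" for x using that c by auto
    have 1: "smooth_on ?O (\<lambda>x. G c (?i x) $ i $ j)" for i j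
      by (rule smooth_on_subset[OF G_smooth[OF c]]) blast
    have 2: "covec_comp S c (?i x) (W (?i x)) \<noteq> 0" if "x \<in> ?O" for x
      using covector_matrix(1)[OF cov U(4) U(5) c] dom[OF that] by blast
    have 3: "v \<bullet> (G c (?i x) *v v) > 0"
      if "x \<in> ?O" "v \<noteq> 0" "covec_comp S c (?i x) (W (?i x)) \<bullet> v = 0" for x v
      using covector_matrix(2)[OF cov U(4) U(5) c _ that(2,3)] dom[OF that(1)] by blast
    have 4: "G c (?i x) *v V' (?i x) c = s (?i x) *\<^sub>R covec_comp S c (?i x) (W (?i x))" if "x \<in> ?O" for x
      using eq[OF c] dom[OF that] by blast
    have 5: "covec_comp S c (?i x) (W (?i x)) \<bullet> V' (?i x) c = 1" if "x \<in> ?O" for x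
      using covector_comp[OF cov c _ V'T] WV' dom[OF that] by metis
    note D = dual_vector_smooth[where V = "\<lambda>x. V' (?i x) c" and s = "\<lambda>x. s (?i x)",
        OF open_app_image[OF c U(1)] 1 smooth_covector_comp[OF U(3) c] 2 3 4 5]
    show "smooth_on ?O (\<lambda>x. V' (?i x) c)" by (rule D(1)) auto
    show "smooth_on ?O (\<lambda>x. s (?i x))" by (rule D(2)) auto
  qed
  show ?thesis
  proof (rule that[OF U(1-3), of V'])
    show "smooth_vector_field S U V'" using V'T smooth(1) by (simp add: smooth_vector_field_def)
    show "LV q = {V' q, - V' q}" if "q \<in> U" for q using V'pm[OF that] by (auto simp: LV_def)
  qed (use V'pm smooth(2) BW eq in auto)
qed

lemma f_smooth: "smooth_function S f"
proof (rule smooth_function_local)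
  fix p c assume c: "c \<in> S" "p \<in> dom_chart c"
  obtain U where U: "open U" "p \<in> U" "smooth_on (app_chart c ` (dom_chart c \<inter> U)) (\<lambda>x. s (inv_chart c x))"
    by (rule V_local[of p]) (use c in blast)
  show "\<exists>N h. open N \<and> p \<in> N \<and> smooth_on (app_chart c ` (dom_chart c \<inter> N)) h \<and>
     (\<forall>q\<in>dom_chart c \<inter> N. f q = h (app_chart c q))"
  proof (intro exI conjI)
    show "smooth_on (app_chart c ` (dom_chart c \<inter> U)) (\<lambda>x. 1 + s (inv_chart c x))"
      by (intro smooth_on_add smooth_on_const U open_app_image c)
  qed (use U c in \<open>auto simp: f_def\<close>)
qed

text \<open>\<open>B\<close> enters quadratically, so its undetermined sign drops out and locally it
  may be replaced by the smooth \<open>W\<close>.\<close>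

lemma g_smooth: "smooth_sym_tensor S g"
  unfolding smooth_sym_tensor_def
proof (intro conjI allI ballI)
  show "sym_bilinear_on (T p) (g p)" for p by (rule g_sym)
  fix c \<mu> \<nu> assume c: "c \<in> S"
  show "smooth_on (app_chart c ` dom_chart c) (\<lambda>x. tensor_comp S g c (inv_chart c x) $ \<mu> $ \<nu>)"
  proof (rule smooth_on_local)
    fix x assume "x \<in> app_chart c ` dom_chart c"
    then obtain p where p: "p \<in> dom_chart c" "x = app_chart c p" by auto
    obtain U W where U: "open U" "p \<in> U" "smooth_covector S U W"
      "\<And>q v w. q \<in> U \<Longrightarrow> B q v * B q w = W q v * W q w"
      by (rule V_local[of p]) (rule that)
    let ?O = "app_chart c ` (dom_chart c \<inter> U)" and ?i = "inv_chart c"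
    have o: "open ?O" by (rule open_app_image[OF c U(1)])
    have f: "smooth_on ?O (\<lambda>y. f (?i y))"
      using smooth_on_subset[OF smooth_functionD[OF f_smooth c], of ?O] by (auto simp: o_def)
    have G: "smooth_on ?O (\<lambda>y. G c (?i y) $ \<mu> $ \<nu>)"
      by (rule smooth_on_subset[OF G_smooth[OF c]]) blast
    note w = smooth_on_component[OF o smooth_covector_comp[OF U(3) c]]
    let ?w = "\<lambda>y. covec_comp S c (?i y) (W (?i y))"
    have "smooth_on ?O (\<lambda>y. G c (?i y) $ \<mu> $ \<nu> - f (?i y) * (?w y $ \<mu> * ?w y $ \<nu>))"
      by (intro smooth_on_diff smooth_on_mult o f G w)
    then have "smooth_on ?O (\<lambda>y. tensor_comp S g c (?i y) $ \<mu> $ \<nu>)"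
    proof (rule iffD1[OF smooth_on_cong[OF o], rotated])
      fix y assume "y \<in> ?O"
      then have "?i y \<in> U" using c by auto
      then show "G c (?i y) $ \<mu> $ \<nu> - f (?i y) * (?w y $ \<mu> * ?w y $ \<nu>) = tensor_comp S g c (?i y) $ \<mu> $ \<nu>"
        using U(4) by (simp add: G_def tensor_comp_def g_def covec_comp_def)
    qed
    then show "\<exists>N. open N \<and> x \<in> N \<and> smooth_on N (\<lambda>y. tensor_comp S g c (?i y) $ \<mu> $ \<nu>)"
      using o p U(2) by blast
  qed
qed

text \<open>If \<open>s p = 0\<close>, then \<open>V p\<close> itself is radical. Conversely a
  radical \<open>r\<close> is null, so \<open>B p r\<close> is non-zero, and 0 = gt(V,r) = s
  B(r).\<close>

lemma s_zero_iff: "s p = 0 \<longleftrightarrow> p \<in> H"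
proof
  assume "s p = 0"
  then show "p \<in> H" by (intro H_I[OF V(1) V_nonzero]) (simp add: V)
next
  assume "p \<in> H"
  then obtain r where r: "r \<in> radical_on (T p) (gt p)" "r \<in> T p" "r \<noteq> 0" by (rule in_H_radical)
  then have "gt p r r = 0" "gt p r (V p) = 0" using radical_iff V(1) by auto
  then have "B p r \<noteq> 0" "gt p (V p) r = 0" using B_kernel[OF r(2,3)] gt.sym[OF V(1) r(2)] by auto
  then show "s p = 0" using V(3)[OF r(2)] by simp
qed

text \<open>By Cramer's rule \<open>V\<^sub>k \<cdot> det G = s \<cdot> m\<close>, where \<open>m\<close> is the determinant of \<open>G\<close> with its
  \<open>k\<close>-th column replaced by the covector. At a zero of \<open>s\<close> this compares the differentials.\<close>

lemma differential_f_V: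
  assumes q: "q \<in> H" shows "differential S f q (V q) \<noteq> 0"
proof
  assume df: "differential S f q (V q) = 0"
  have s0: "s q = 0" using s_zero_iff q by simp
  obtain U W V' where U: "open U" "q \<in> U" "smooth_covector S U W"
    "smooth_vector_field S U V'" "\<And>q. q \<in> U \<Longrightarrow> V' q = V q \<or> V' q = - V q"
    "\<And>c q. c \<in> S \<Longrightarrow> q \<in> U \<Longrightarrow> q \<in> dom_chart c \<Longrightarrow> G c q *v V' q c = s q *\<^sub>R covec_comp S c q (W q)"
    by (rule V_local[of q]) (rule that)
  obtain c where c: "c \<in> S" "q \<in> dom_chart c" by (rule chart_around)
  have "V' q \<noteq> 0" using U(5)[OF U(2)] V_nonzero[of q] by auto
  moreover have "V' q \<in> T q" using U(2,4) by (simp add: smooth_vector_field_def)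
  ultimately have "V' q c \<noteq> 0" using T_eq_0_iff[OF c] by blast
  \<comment> \<open>A component of \<open>V'\<close> that is non-zero at \<open>q\<close> and can
    therefore be cancelled from the scalar identity below.\<close>
  then obtain k where k: "V' q c $ k \<noteq> 0" by (auto simp: vec_eq_iff)
  let ?O = "app_chart c ` (dom_chart c \<inter> U)" and ?i = "inv_chart c" and ?a = "app_chart c q"
  have o: "open ?O" by (rule open_app_image[OF c(1) U(1)])
  have a: "?a \<in> ?O" using c U(2) by blast
  define m where "m = (\<lambda>x. det (\<chi> i j. if j = k then covec_comp S c (?i x) (W (?i x)) $ i else G c (?i x) $ i $ j))"
  define vk where "vk = (\<lambda>x. V' (?i x) c $ k)"
  define \<delta> where "\<delta> = (\<lambda>x. (detG c \<circ> ?i) x)"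
  define \<sigma> where "\<sigma> = (\<lambda>x. (f \<circ> ?i) x)"
  have key: "vk x * \<delta> x = (\<sigma> x - 1) * m x" if "x \<in> ?O" for x
  proof -
    have dom: "?i x \<in> dom_chart c" "?i x \<in> U" using that c by auto
    have "vk x * \<delta> x = det (\<chi> i j. if j = k then (G c (?i x) *v V' (?i x) c) $ i else G c (?i x) $ i $ j)"
      unfolding cramer_lemma by (simp add: vk_def \<delta>_def detG_def)
    also have "\<dots> = s (?i x) * m x"
      unfolding U(6)[OF c(1) dom(2,1)] m_def vector_scaleR_component real_scaleR_def
      using det_scale_column[of k "s (?i x)" "covec_comp S c (?i x) (W (?i x))" "G c (?i x)"] by simp
    finally show ?thesis by (simp add: \<sigma>_def f_def)
  qed
  have "smooth_on ?O m"
    unfolding m_def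
  proof (rule smooth_on_det[OF o])
    fix i j
    have "smooth_on ?O (\<lambda>x. G c (?i x) $ i $ j)" by (rule smooth_on_subset[OF G_smooth[OF c(1)]]) blast
    then show "smooth_on ?O (\<lambda>x. (\<chi> i j. if j = k then covec_comp S c (?i x) (W (?i x)) $ i else G c (?i x) $ i $ j) $ i $ j)"
      using smooth_on_component[OF o smooth_covector_comp[OF U(3) c(1)], of i] by (cases "j = k") simp_all
  qed
  moreover have "smooth_on ?O vk"
    unfolding vk_def using U(4) c(1) by (intro smooth_on_component[OF o]) (simp add: smooth_vector_field_def)
  moreover have \<delta>: "smooth_on ?O \<delta>"
    unfolding \<delta>_def by (rule smooth_on_subset[OF detG_smooth[OF c(1)]]) blast
  moreover have \<sigma>: "smooth_on ?O \<sigma>"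
    unfolding \<sigma>_def by (rule smooth_on_subset[OF smooth_functionD[OF f_smooth c(1)]]) blast
  ultimately obtain m' vk' \<delta>' \<sigma>' where D: "(m has_derivative m') (at ?a)" "(vk has_derivative vk') (at ?a)"
    "(\<delta> has_derivative \<delta>') (at ?a)" "(\<sigma> has_derivative \<sigma>') (at ?a)"
    using smooth_on_has_derivative a by meson
  have \<delta>0: "\<delta> ?a = 0" using H_iff_det[OF c] q c by (simp add: \<delta>_def)
  have \<sigma>1: "\<sigma> ?a = 1" using s0 c by (simp add: \<sigma>_def f_def)
  have d1: "((\<lambda>x. vk x * \<delta> x) has_derivative (\<lambda>v. vk ?a * \<delta>' v + vk' v * \<delta> ?a)) (at ?a)"
    by (rule has_derivative_mult[OF D(2,3)])
  have "((\<lambda>x. \<sigma> x - 1) has_derivative (\<lambda>v. \<sigma>' v - 0)) (at ?a)"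
    by (rule has_derivative_diff[OF D(4) has_derivative_const])
  from has_derivative_mult[OF this D(1)]
  have "((\<lambda>x. (\<sigma> x - 1) * m x) has_derivative (\<lambda>v. (\<sigma> ?a - 1) * m' v + (\<sigma>' v - 0) * m ?a)) (at ?a)" .
  then have d2: "((\<lambda>x. vk x * \<delta> x) has_derivative (\<lambda>v. (\<sigma> ?a - 1) * m' v + (\<sigma>' v - 0) * m ?a)) (at ?a)"
    by (rule has_derivative_transform_within_open[OF _ o a]) (simp add: key)
  from fun_cong[OF has_derivative_unique[OF d1 d2], of "V q c"]
  \<comment> \<open>The terms with the derivatives of \<open>vk\<close> and \<open>m\<close> carry
    the factors \<open>\<delta> ?a = 0\<close> and \<open>\<sigma> ?a - 1 = 0\<close>.\<close>
  have eq: "vk ?a * \<delta>' (V q c) = \<sigma>' (V q c) * m ?a" by (simp add: \<delta>0 \<sigma>1)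
  have "\<sigma>' (V q c) = differential S f q (V q)"
  proof -
    have "(f \<circ> ?i) differentiable (at ?a)"
      using smooth_on_differentiable[OF smooth_functionD[OF f_smooth c(1)]] c by blast
    from differential_chart[OF c this V(1)] show ?thesis
      using frechet_derivative_at[OF D(4)] by (simp add: \<sigma>_def o_def)
  qed
  \<comment> \<open>Hence \<open>V q\<close> is tangent to \<open>H\<close>. Since
    \<open>s q = 0\<close> it is also radical, contradicting transversality of the radical.\<close>
  then have "\<delta>' (V q c) = 0" using eq df k c by (simp add: vk_def)
  moreover have "\<delta>' (V q c) = differential S (detG c) q (V q)"
    using differential_chart[OF c detG_differentiable[OF c] V(1)] frechet_derivative_at[OF D(3)]
    by (simp add: \<delta>_def o_def)
  ultimately have "V q \<in> tangent_space_sub S H q" using tangent_H_iff[OF q c V(1)] by simp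
  moreover have "V q \<in> radical_on (T q) (gt q)" using V s0 by (simp add: radical_iff)
  ultimately show False using radical_tangent[OF q] V_nonzero by blast
qed

proposition prescription: "transformation_prescription S gt g LV f"
  unfolding transformation_prescription_def
proof (intro conjI)
  show "lorentzian_metric S g" using g_smooth g_lorentzian by (simp add: lorentzian_metric_def)
  show "line_element_field S UNIV LV"
    unfolding line_element_field_def
  proof
    fix p
    obtain U V' where U: "open U" "p \<in> U" "smooth_vector_field S U V'"
      "\<And>q. q \<in> U \<Longrightarrow> LV q = {V' q, - V' q}" "\<And>q. q \<in> U \<Longrightarrow> V' q = V q \<or> V' q = - V q"
      by (rule V_local[of p]) (rule that)
    have "V' q \<noteq> 0" if "q \<in> U" for q using U(5)[OF that] V_nonzero[of q] by auto
    then show "\<exists>U V. open U \<and> p \<in> U \<and> smooth_vector_field S U V \<and>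
        (\<forall>q\<in>U \<inter> UNIV. V q \<noteq> 0 \<and> LV q = {V q, - V q})"
      using U(1-4) by (intro exI[of _ U] exI[of _ V']) simp
  qed
  \<comment> \<open>For either representative \<open>v\<close> of the line element,
    \<open>g p v\<close> is \<open>B p\<close> up to sign, and the sign cancels in products of two
    values.\<close>
  have gm: "g p v u = - B p u \<or> g p v u = B p u" "g p v v = -1"
    "g p v u * g p v w = B p u * B p w" if "v \<in> LV p" "u \<in> T p" "w \<in> T p" for p v u w
    using that g_V[of _ p] g_VV[of p] g.minus_left[OF V(1), of _ p] g.minus_right[OF _ V(1), of _ p]
      subspace_neg[OF subspace_T V(1)] V(2)[of p]
    by (auto simp: LV_def V(1))
  show "\<forall>p. \<forall>V\<in>LV p. g p V V = -1 \<and>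
        (\<forall>u\<in>T p. \<forall>w\<in>T p. gt p u w = g p u w + f p * (g p V u * g p V w))"
  proof (intro allI ballI conjI)
    show "g p v v = -1" if "v \<in> LV p" for p v by (rule gm(2)[OF that V(1) V(1)])
    show "gt p u w = g p u w + f p * (g p v u * g p v w)" if "v \<in> LV p" "u \<in> T p" "w \<in> T p" for p v u w
      unfolding gm(3)[OF that] by (simp add: g_def)
  qed
  show "smooth_function S f" by (rule f_smooth)
  show "degeneracy_locus S gt = {q. f q = 1}" using s_zero_iff by (auto simp: f_def H_def)
  show "\<forall>q\<in>degeneracy_locus S gt. (\<exists>v\<in>T q. differential S f q v \<noteq> 0) \<and> (\<forall>V\<in>LV q. differential S f q V \<noteq> 0)"
  proof
    fix q assume "q \<in> degeneracy_locus S gt"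
    then have dV: "differential S f q (V q) \<noteq> 0" by (intro differential_f_V) (simp add: H_def)
    obtain c where c: "c \<in> S" "q \<in> dom_chart c" by (rule chart_around)
    have "(f \<circ> inv_chart c) differentiable (at (app_chart c q))"
      using smooth_on_differentiable[OF smooth_functionD[OF f_smooth c(1)]] c by blast
    from covector_minus[OF differential_covector[OF c this] V(1)]
    show "(\<exists>v\<in>T q. differential S f q v \<noteq> 0) \<and> (\<forall>V\<in>LV q. differential S f q V \<noteq> 0)"
      using dV V(1) by (auto simp: LV_def)
  qed
qed

end

section \<open>The transformation prescription yields a transverse radical\<close>

text \<open>The prescription gives gt(V,.) = (1 - f) g(V,.), so \<open>V\<close> is radical where f
  = 1. There a radical \<open>r\<close> satisfies g(r,.) + g(V,r) g(V,.) = 0, and nondegeneracy of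
  \<open>g\<close> makes it a multiple of \<open>V\<close>. The locus is the level f = 1, regular
  because df(V) is non-zero, so its tangent space is the kernel of df and \<open>V\<close> spans a
  complement.\<close>

lemma (in type_changing) prescription_transverse_radical:
  assumes pr: "transformation_prescription S gt g L f"
  shows "transverse_radical S gt"
  unfolding transverse_radical_def Let_def
proof (intro ballI conjI)
  fix q assume "q \<in> degeneracy_locus S gt"
  then have q: "q \<in> H" by (simp add: H_def)
  have lor: "lorentzian_on (T q) (g q)" and gs: "sym_bilinear_on (T q) (g q)"
    using pr by (auto simp: transformation_prescription_def lorentzian_metric_def smooth_sym_tensor_def)
  interpret g: sym_form "T q" "g q" using gs subspace_T by unfold_locales
  have Hf: "H = {q. f q = 1}" using pr by (simp add: transformation_prescription_def H_def)
  have fs: "smooth_function S f" using pr by (simp add: transformation_prescription_def)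
  have lef: "line_element_field S UNIV L" using pr by (simp add: transformation_prescription_def)
  from lef obtain U V0 where "q \<in> U" "smooth_vector_field S U V0" "\<forall>q\<in>U \<inter> UNIV. V0 q \<noteq> 0 \<and> L q = {V0 q, - V0 q}"
    unfolding line_element_field_def by blast
  then obtain V where V: "V \<in> T q" "V \<in> L q" by (auto simp: smooth_vector_field_def)
  have gV: "g q V V = -1" "\<And>u w. u \<in> T q \<Longrightarrow> w \<in> T q \<Longrightarrow> gt q u w = g q u w + f q * (g q V u * g q V w)"
    "differential S f q V \<noteq> 0"
    using pr V(2) q by (auto simp: transformation_prescription_def H_def)
  have fq: "f q = 1" using q Hf by simp
  obtain c where c: "c \<in> S" "q \<in> dom_chart c" by (rule chart_around)
  have df: "(f \<circ> inv_chart c) differentiable (at (app_chart c q))"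
    using smooth_on_differentiable[OF smooth_functionD[OF fs c(1)]] c by blast
  have cov: "covector_on (T q) (differential S f q)" by (rule differential_covector[OF c df])
  have dscale: "differential S f q (a *\<^sub>R v) = a * differential S f q v" if "v \<in> T q" for a v
    using cov that by (simp add: covector_on_def)
  have dadd: "differential S f q (u + v) = differential S f q u + differential S f q v" if "u \<in> T q" "v \<in> T q" for u v
    using cov that by (simp add: covector_on_def)
  let ?TH = "tangent_space_sub S (degeneracy_locus S gt) q" and ?R = "radical_on (T q) (gt q)"
  have TH: "v \<in> ?TH \<longleftrightarrow> differential S f q v = 0" if v: "v \<in> T q" for v
  proof
    show "differential S f q v = 0" if "v \<in> ?TH"
      by (rule tangent_sub_level_zero[OF c df _ that, of 1]) (use Hf in \<open>simp add: H_def\<close>)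
    show "v \<in> ?TH" if "differential S f q v = 0"
      by (rule tangent_sub_levelI[OF c smooth_functionD[OF fs c(1)] _ fq V(1) gV(3) v that])
        (use Hf in \<open>simp add: H_def\<close>)
  qed
  have VR: "a *\<^sub>R V \<in> ?R" for a
  proof -
    have "gt q (a *\<^sub>R V) w = 0" if w: "w \<in> T q" for w
      using gV(2)[OF V(1) w] gt.scale_left[OF V(1) w] gV(1) fq by simp
    then show ?thesis using subspace_scale[OF subspace_T V(1)] by (simp add: radical_iff)
  qed
  have RV: "r = (- g q V r) *\<^sub>R V" if r: "r \<in> ?R" for r
  proof -
    have rT: "r \<in> T q" using r radical_iff by blast
    have aV: "g q V r *\<^sub>R V \<in> T q" by (rule subspace_scale[OF subspace_T V(1)])
    have "r + g q V r *\<^sub>R V = 0"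
    proof (rule g.lorentzian_nondegenerate[OF lor])
      show "r + g q V r *\<^sub>R V \<in> T q" by (rule subspace_add[OF subspace_T rT aV])
      fix w assume w: "w \<in> T q"
      have "gt q r w = 0" using r w radical_iff by blast
      then show "g q (r + g q V r *\<^sub>R V) w = 0"
        using gV(2)[OF rT w] fq g.add_left[OF rT aV w] g.scale_left[OF V(1) w] by simp
    qed
    then show ?thesis unfolding scaleR_minus_left by (rule iffD2[OF eq_neg_iff_add_eq_0])
  qed
  show "?R \<inter> ?TH = {0}"
  proof (intro equalityI subsetI)
    fix v assume v: "v \<in> ?R \<inter> ?TH"
    then have vT: "v \<in> T q" using radical_iff by blast
    define a where "a = - g q V v"
    have va: "v = a *\<^sub>R V" using RV v by (simp add: a_def)
    have "differential S f q v = 0" using TH[OF vT] v by blast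
    then have "a = 0" using dscale[OF V(1), of a] va gV(3) by simp
    then show "v \<in> {0}" using va by simp
  next
    fix v :: "('m, 'n) tvec" assume "v \<in> {0}"
    then have "v = 0 *\<^sub>R V" by simp
    then show "v \<in> ?R \<inter> ?TH"
      using VR[of 0] TH[of v] dscale[OF V(1), of 0] subspace_scale[OF subspace_T V(1), of 0] by simp
  qed
  show "{r + h | r h. r \<in> ?R \<and> h \<in> ?TH} = T q"
  proof (intro equalityI subsetI)
    fix u assume "u \<in> {r + h | r h. r \<in> ?R \<and> h \<in> ?TH}"
    then obtain r h where "u = r + h" "r \<in> T q" "h \<in> T q"
      using radical_iff by (auto simp: tangent_space_sub_def)
    then show "u \<in> T q" using subspace_add[OF subspace_T] by blast
  next
    fix u assume u: "u \<in> T q"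
    define a where "a = differential S f q u / differential S f q V"
    have aV: "(- a) *\<^sub>R V \<in> T q" "u + (- a) *\<^sub>R V \<in> T q"
      using subspace_scale[OF subspace_T V(1)] subspace_add[OF subspace_T u] by blast+
    have "differential S f q (u + (- a) *\<^sub>R V) = 0"
      unfolding dadd[OF u aV(1)] dscale[OF V(1)] using gV(3) by (simp add: a_def)
    then have "u + (- a) *\<^sub>R V \<in> ?TH" using TH[OF aV(2)] by blast
    moreover have "u = a *\<^sub>R V + (u + (- a) *\<^sub>R V)" by simp
    ultimately show "u \<in> {r + h | r h. r \<in> ?R \<and> h \<in> ?TH}" using VR by blast
  qed
qed

theorem theorem1p6:
  fixes S :: "('m::{t2_space, second_countable_topology}, 'n::finite) chart set"
    and gt :: "('m, 'n) tensor02"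
    and M\<^sub>R :: "'m set"
  assumes "smooth_manifold S"
    and "CARD('n) \<ge> 2"
    and "transverse_type_changing S gt M\<^sub>R"
    and "\<exists>L. line_element_field S (M\<^sub>R \<union> degeneracy_locus S gt) L \<and>
             transverse_line_field S (degeneracy_locus S gt) L"
  shows "(transverse_type_changing S gt M\<^sub>R \<and> transverse_radical S gt) \<longleftrightarrow>
         (\<exists>g L f. transformation_prescription S gt g L f)"
proof -
  interpret type_changing S gt M\<^sub>R using assms(1,3) by unfold_locales
  show ?thesis
  proof
    assume "transverse_type_changing S gt M\<^sub>R \<and> transverse_radical S gt"
    moreover obtain L where "line_element_field S A L" "transverse_line_field S H L"
      using assms(4) by (auto simp: A_def H_def)
    ultimately interpret transverse_radical_line S gt M\<^sub>R L by unfold_locales auto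
    obtain B where B: "\<And>p. \<exists>U W. open U \<and> p \<in> U \<and> smooth_covector S U W \<and> (\<forall>q\<in>U.
       (\<forall>v\<in>T q. v \<noteq> 0 \<longrightarrow> W q v = 0 \<longrightarrow> gt q v v > 0) \<and> (\<exists>v\<in>T q. W q v \<noteq> 0) \<and>
       (B q = W q \<or> B q = (\<lambda>v. - W q v)))"
      by (rule spacelike_covector_field) (rule that)
    interpret spacelike_covector S gt M\<^sub>R B by unfold_locales (rule B)
    show "\<exists>g L f. transformation_prescription S gt g L f" using prescription by blast
  next
    assume "\<exists>g L f. transformation_prescription S gt g L f"
    then show "transverse_type_changing S gt M\<^sub>R \<and> transverse_radical S gt"
      using assms(3) prescription_transverse_radical by blast
  qed
qed

end
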